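(* Let $n\ge 1$, $m\in\mathbb{R}$, and let $P(D)$ be a pseudodifferential operator with constant coefficients on $\mathbb{R}^n$ whose symbol $P(\xi)$ belongs to the class $S^m$. Let $s\in\mathbb{R}$, $\theta\geq 1$ and $\alpha\in\mathbb{N}^n$, where $\mathbb{N}=\{1,2,\dots\}$. Then for every $\delta>0$ there exist $\rho>0$ and $c>0$ such that for every open domain $\Omega\subset\mathbb{R}^n$ with $\operatorname{diam}(\Omega)<\rho$ and every $u\in C_0^\infty(\Omega)$, $$\left\|(\partial^\alpha P)(D)u\right\|_s\leq \delta\left\|P(D)u\right\|_s+c\left\|u\right\|_{s+m-\theta}.$$
   Context: $S^m$ is the space of infinitely differentiable (complex-valued) functions $P(\xi)$ on $\mathbb{R}^n$ such that for every multi-index $\alpha\in\mathbb{Z}_+^n$ (entries nonnegative integers) there exists $c>0$ with $|(\partial^\alpha P)(\xi)|\le c(1+|\xi|)^{m-|\alpha|}$ for all $\xi\in\mathbb{R}^n$. For a symbol $P\in S^m$, the pseudodifferential operator with constant coefficients $P(D)$ acts on functions $u\in H^s$ by $P(D)u(x)=\int_{\mathbb{R}^n}e^{ix\cdot\xi}P(\xi)\widehat{u}(\xi)\,d\xi$, where $\widehat u$ is the Fourier transform of $u$ (normalized so that the symbol $P\equiv 1$ gives the identity). $(\partial^\alpha P)(D)$ is the pseudodifferential operator whose symbol is the derivative $(\partial^\alpha P)(\xi)$ of $P$ with respect to $\xi$. $H^s$, $s\in\mathbb{R}$, is the Sobolev space on $\mathbb{R}^n$ with norm $\|\cdot\|_s$.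 $C_0^\infty(\Omega)$ is the space of infinitely differentiable functions with compact support in $\Omega$ (extended by zero to $\mathbb{R}^n$). The convention is $\mathbb{N}=\{1,2,\dots\}$. *)

theory Defs
  imports "HOL-Analysis.Analysis"
begin

section \<open>Partial derivatives and smoothness\<close>

definition partial_deriv :: "'n::finite \<Rightarrow> (real^'n \<Rightarrow> complex) \<Rightarrow> real^'n \<Rightarrow> complex" where
  "partial_deriv i f x = vector_derivative (\<lambda>t. f (x + t *\<^sub>R axis i 1)) (at 0)"

primrec C_k :: "nat \<Rightarrow> (real^'n::finite \<Rightarrow> complex) \<Rightarrow> bool" where
  "C_k 0 f \<longleftrightarrow> continuous_on UNIV f"
| "C_k (Suc k) f \<longleftrightarrow> (\<forall>x. f differentiable (at x)) \<and> (\<forall>i. C_k k (partial_deriv i f))"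

definition C_infinity :: "(real^'n::finite \<Rightarrow> complex) \<Rightarrow> bool" where
  "C_infinity f \<longleftrightarrow> (\<forall>k. C_k k f)"

text \<open>
  A multi-index is a function from coordinates to naturals. To avoid fixing an order on the
  coordinates, its derivative is taken along some list in which each coordinate \<open>i\<close> occurs
  exactly \<open>\<alpha> i\<close> times. For a smooth function the choice of the list does not matter, since
  partial derivatives commute.
\<close>

definition multi_deriv :: "('n::finite \<Rightarrow> nat) \<Rightarrow> (real^'n \<Rightarrow> complex) \<Rightarrow> real^'n \<Rightarrow> complex" where
  "multi_deriv \<alpha> f = foldr partial_deriv (SOME is. \<forall>i. count_list is i = \<alpha> i) f"

lemma multi_index_list_exists:
  fixes \<alpha> :: "'n::finite \<Rightarrow> nat"
  shows "\<exists>is. \<forall>i. count_list is i = \<alpha> i"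
proof -
  have "\<exists>is. \<forall>i. count_list is i = (if i \<in> A then \<alpha> i else 0)" for A :: "'n set"
    using finite[of A]
  proof (induction A rule: finite_induct)
    case empty
    show ?case by (rule exI[of _ "[]"]) simp
  next
    case (insert a A)
    then obtain js where js: "\<And>i. count_list js i = (if i \<in> A then \<alpha> i else 0)" by auto
    have rep: "count_list (replicate k a) i = (if i = a then k else 0)" for k i
      by (induction k) auto
    show ?case
      by (rule exI[of _ "replicate (\<alpha> a) a @ js"])
        (use insert.hyps in \<open>auto simp: js rep\<close>)
  qed
  from this[of UNIV] show ?thesis by simp
qed

definition multi_order :: "('n::finite \<Rightarrow> nat) \<Rightarrow> nat" where
  "multi_order \<alpha> = (\<Sum>i\<in>UNIV. \<alpha> i)"

section \<open>Symbols, test functions and pseudodifferential operators\<close>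

definition symbol_class :: "real \<Rightarrow> (real^'n::finite \<Rightarrow> complex) set" where
  "symbol_class m = {P. C_infinity P \<and>
     (\<forall>\<alpha>. \<exists>c>0. \<forall>\<xi>. norm (multi_deriv \<alpha> P \<xi>) \<le> c * (1 + norm \<xi>) powr (m - real (multi_order \<alpha>)))}"

definition test_functions :: "(real^'n::finite) set \<Rightarrow> (real^'n \<Rightarrow> complex) set" where
  "test_functions \<Omega> = {u. C_infinity u \<and> compact (closure {x. u x \<noteq> 0}) \<and> closure {x. u x \<noteq> 0} \<subseteq> \<Omega>}"

text \<open>
  The factor \<open>(2 * pi)\<close> to the power \<open>- n\<close> makes \<open>u x\<close> the integral of
  \<open>cis (x \<bullet> \<xi>) * fourier u \<xi>\<close> over \<open>\<xi>\<close>, so that the symbol \<open>1\<close> gives the identity.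
\<close>

definition fourier :: "(real^'n::finite \<Rightarrow> complex) \<Rightarrow> real^'n \<Rightarrow> complex" where
  "fourier u \<xi> = complex_of_real (1 / (2 * pi) ^ CARD('n)) * (LINT x|lborel. cis (- (x \<bullet> \<xi>)) * u x)"

definition pseudo_diff ::
    "(real^'n::finite \<Rightarrow> complex) \<Rightarrow> (real^'n \<Rightarrow> complex) \<Rightarrow> real^'n \<Rightarrow> complex" where
  "pseudo_diff P u x = (LINT \<xi>|lborel. cis (x \<bullet> \<xi>) * (P \<xi> * fourier u \<xi>))"

text \<open>
  The norm of the Sobolev space of order \<open>s\<close>. As \<open>fourier\<close> is the classical Fourier integral,
  this is meaningful for integrable functions in that space only. These include all
  rapidly decreasing functions, hence all test functions \<open>u\<close> and all
  \<open>pseudo_diff P u\<close> with \<open>P\<close> in some symbol class: there \<open>P \<xi> * fourier u \<xi>\<close> is rapidly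
  decreasing together with all its derivatives.
\<close>

definition sobolev_norm :: "real \<Rightarrow> (real^'n::finite \<Rightarrow> complex) \<Rightarrow> real" where
  "sobolev_norm s v = sqrt (LINT \<xi>|lborel. (1 + (norm \<xi>)\<^sup>2) powr s * (norm (fourier v \<xi>))\<^sup>2)"

end

theory Submission
  imports Defs "HOL-Probability.Probability"
begin

text \<open>
  Write \<open>h\<close> for the Fourier transform of \<open>u\<close>, recentred at a point of \<open>\<Omega>\<close>. By Fourier inversion
  the Sobolev norms are weighted \<open>L\<^sup>2\<close> norms of \<open>h\<close>, and it suffices to treat one derivative in
  one direction. As in Hoermander's estimates for differential operators, an integration by parts
  in \<open>\<integral> W |\<partial>\<^sup>k Q|\<^sup>2 |h|\<^sup>2\<close> bounds this quantity by \<open>\<partial>\<^sup>k\<^sup>-\<^sup>1 Q h\<close> times \<open>\<partial>\<^sup>k\<^sup>+\<^sup>1 Q h\<close> and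
  \<open>\<partial>\<^sup>k Q \<partial>h\<close>. If \<open>u\<close> is supported within distance \<open>\<rho>\<close>, then \<open>\<partial>h\<close> is \<open>\<rho>\<close> times an average of
  translates of \<open>h\<close> at distance of order \<open>1/\<rho>\<close>. The weight
  \<open>W (\<Sum>\<^sub>l |\<rho>\<^sup>-\<^sup>l \<partial>\<^sup>l Q|\<^sup>2 + B\<^sup>2)\<close>, where \<open>B\<close> dominates a derivative of high order, varies slowly on
  that scale, uniformly in \<open>\<rho>\<close>, if \<open>1 + |\<xi>|\<^sup>2\<close> is replaced by \<open>1/\<rho>\<^sup>2 + |\<xi>|\<^sup>2\<close>. This gives a
  weighted Bernstein inequality for \<open>\<partial>h\<close>. A downward induction on \<open>k\<close>, starting where the order
  of \<open>\<partial>\<^sup>k Q\<close> is so low that it only contributes to the error, yields a factor \<open>\<rho>\<close> for \<open>k = 1\<close>.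
\<close>

text \<open>For a differential operator \<open>P(D)u\<close> is supported in \<Omega>, and
  multiplication by \<open>x - a\<close> is small on it. Here \<open>P(D)\<close> is not local and
  only \<open>u\<close> has small support, so every gain must come from the derivative of
  \<open>h\<close>, with the derivatives of the symbol appearing in the weight. A single weight
  \<open>|\<partial>^k Q|^2\<close> is not admissible: it may vanish at a translate and not at the
  point itself. Adding the higher derivatives repairs this, as Taylor's formula suggests. For a
  polynomial the list of derivatives ends; for a symbol it does not, and \<open>B\<close> closes it.
  The order of the choices shapes the rest. The absorption constant must be known before \<rho>,
  which is then taken small against it. Hence the scaling by powers of \<rho> and the modified
  weight: both make one derivative in \<xi> cost exactly one factor \<rho>. What does depend on
  \<rho>, namely the size of \<open>B\<close> and the frequencies up to \<open>1/\<rho>\<close>,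
  goes into the constant of the error term.\<close>

section \<open>Fubini's theorem and changes of variables\<close>

lemma borel_measurable_cis [measurable (raw)]:
  "f \<in> borel_measurable M \<Longrightarrow> (\<lambda>x. cis (f x)) \<in> borel_measurable M"
  by (rule measurable_compose[OF _ borel_measurable_continuous_onI]) (auto intro: continuous_intros)

lemma integrable_Fubini_product:
  fixes f :: "'a::euclidean_space \<Rightarrow> 'b::euclidean_space \<Rightarrow> complex"
  assumes meas: "(\<lambda>(x, y). f x y) \<in> borel_measurable borel"
    and bound: "\<And>x y. norm (f x y) \<le> p x * q y"
    and p: "integrable lborel p" and q: "integrable lborel q"
  shows "integrable (lborel \<Otimes>\<^sub>M lborel) (\<lambda>(x, y). f x y)"
proof -
  have m: "(\<lambda>(x, y). f x y) \<in> borel_measurable (lborel \<Otimes>\<^sub>M lborel)"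
    using meas by (simp add: lborel_prod)
  have 1: "integrable (lborel \<Otimes>\<^sub>M lborel) (\<lambda>(x, y). p x * q y)"
  proof (rule lborel_pair.Fubini_integrable)
    show "(\<lambda>(x, y). p x * q y) \<in> borel_measurable (lborel \<Otimes>\<^sub>M lborel)"
      using p q by (simp add: split_beta) measurable
    show "integrable lborel (\<lambda>x. LINT y|lborel. norm (case (x, y) of (x, y) \<Rightarrow> p x * q y))"
      using p by (simp add: abs_mult)
    show "AE x in lborel. integrable lborel (\<lambda>y. case (x, y) of (x, y) \<Rightarrow> p x * q y)"
      using q by simp
  qed
  show ?thesis
    by (rule Bochner_Integration.integrable_bound[OF 1 m])
      (use bound in \<open>force intro: order_trans[OF _ abs_ge_self]\<close>)
qed

lemma integral_swap_product_bound:
  fixes f :: "'a::euclidean_space \<Rightarrow> 'b::euclidean_space \<Rightarrow> complex"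
  assumes meas: "(\<lambda>(x, y). f x y) \<in> borel_measurable borel"
    and bound: "\<And>x y. norm (f x y) \<le> p x * q y"
    and p: "integrable lborel p" and q: "integrable lborel q"
  shows "(LINT x|lborel. LINT y|lborel. f x y) = (LINT y|lborel. LINT x|lborel. f x y)"
  using lborel_pair.Fubini_integral[OF integrable_Fubini_product[OF assms]] by simp

lemma nn_integral_lborel_translate:
  fixes f :: "'a::euclidean_space \<Rightarrow> ennreal"
  assumes [measurable]: "f \<in> borel_measurable borel"
  shows "(\<integral>\<^sup>+x. f (c + x) \<partial>lborel) = (\<integral>\<^sup>+x. f x \<partial>lborel)"
proof -
  have "(\<integral>\<^sup>+x. f x \<partial>lborel) = (\<integral>\<^sup>+x. f x \<partial>distr lborel borel ((+) c))"
    by (simp add: lborel_distr_plus)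
  also have "\<dots> = (\<integral>\<^sup>+x. f (c + x) \<partial>lborel)"
    by (subst nn_integral_distr) auto
  finally show ?thesis by simp
qed

lemma
  fixes f :: "'a::euclidean_space \<Rightarrow> 'b::{banach, second_countable_topology}"
  assumes [measurable]: "f \<in> borel_measurable borel" and c: "c \<noteq> 0"
  shows lborel_integral_affine:
      "(LINT x|lborel. f x) = (\<bar>c\<bar> ^ DIM('a)) *\<^sub>R (LINT x|lborel. f (t + c *\<^sub>R x))"
    and lborel_integrable_affine:
      "integrable lborel (\<lambda>x. f (t + c *\<^sub>R x)) \<longleftrightarrow> integrable lborel f"
proof -
  have *: "lborel = density (distr lborel borel (\<lambda>x. t + c *\<^sub>R x)) (\<lambda>_. ennreal (\<bar>c\<bar> ^ DIM('a)))"
    using lborel_affine[OF c, of t] by simp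
  show "(LINT x|lborel. f x) = (\<bar>c\<bar> ^ DIM('a)) *\<^sub>R (LINT x|lborel. f (t + c *\<^sub>R x))"
    by (subst *) (simp add: integral_density integral_distr)
  have scale: "integrable lborel (\<lambda>x. (\<bar>c\<bar> ^ DIM('a)) *\<^sub>R h x) \<longleftrightarrow> integrable lborel h" for h :: "'a \<Rightarrow> 'b"
    using integrable_scaleR_right[of "inverse (\<bar>c\<bar> ^ DIM('a))" lborel "\<lambda>x. (\<bar>c\<bar> ^ DIM('a)) *\<^sub>R h x"]
      integrable_scaleR_right[of "\<bar>c\<bar> ^ DIM('a)" lborel h] c by auto
  show "integrable lborel (\<lambda>x. f (t + c *\<^sub>R x)) \<longleftrightarrow> integrable lborel f"
    by (subst (2) *) (use c scale in \<open>simp add: integrable_density integrable_distr_eq\<close>)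
qed

lemma
  fixes f :: "'a::euclidean_space \<Rightarrow> 'b::{banach, second_countable_topology}"
  assumes "f \<in> borel_measurable borel"
  shows lborel_integral_translate: "(LINT x|lborel. f (t + x)) = (LINT x|lborel. f x)"
    and lborel_integrable_translate: "integrable lborel (\<lambda>x. f (t + x)) \<longleftrightarrow> integrable lborel f"
  using lborel_integral_affine[OF assms, of 1 t] lborel_integrable_affine[OF assms, of 1 t] by simp_all

section \<open>Polynomial decay\<close>


lemma nn_integral_inverse_1_plus_square: "(\<integral>\<^sup>+x. ennreal (inverse (1 + x\<^sup>2)) \<partial>lborel) < \<infinity>"
proof -
  have "integrable lborel (\<lambda>x::real. inverse (1 + x\<^sup>2))"
    using integrable_inverse_1_plus_square by (simp add: set_integrable_def)
  then show ?thesis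
    by (simp add: integrable_iff_bounded)
qed

text \<open>The inverse of this product can be integrated coordinate by coordinate, which reduces
  integrability of polynomial decay to one variable. This is the origin of the exponent
  \<open>2 * DIM('a)\<close> in the integrability criteria below.\<close>

lemma prod_1_plus_square_le:
  "(\<Prod>b\<in>Basis. 1 + (x \<bullet> b)\<^sup>2) \<le> (1 + norm (x :: 'a::euclidean_space)) ^ (2 * DIM('a))"
proof -
  have "1 + (x \<bullet> b)\<^sup>2 \<le> (1 + norm x)\<^sup>2" if "b \<in> Basis" for b
  proof -
    have "(x \<bullet> b)\<^sup>2 \<le> (norm x)\<^sup>2"
      using Basis_le_norm[OF that, of x] by (metis abs_le_square_iff abs_norm_cancel)
    then show ?thesis
      by (simp add: power2_sum order_trans[OF _ add_increasing2])
  qed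
  then have "(\<Prod>b\<in>Basis. 1 + (x \<bullet> b)\<^sup>2) \<le> (\<Prod>b\<in>(Basis::'a set). (1 + norm x)\<^sup>2)"
    by (intro prod_mono) auto
  also have "\<dots> = (1 + norm x) ^ (2 * DIM('a))"
    by (simp add: power_mult)
  finally show ?thesis .
qed

lemma integrable_poly_decay:
  assumes "2 * DIM('a) \<le> N"
  shows "integrable lborel (\<lambda>x::'a::euclidean_space. 1 / (1 + norm x) ^ N)"
proof (rule integrableI_bounded)
  show "(\<lambda>x::'a. 1 / (1 + norm x) ^ N) \<in> borel_measurable lborel"
    by measurable
  have le: "1 / (1 + norm x) ^ N \<le> (\<Prod>b\<in>Basis. inverse (1 + (x \<bullet> b)\<^sup>2))" for x :: 'a
  proof -
    have "(\<Prod>b\<in>Basis. 1 + (x \<bullet> b)\<^sup>2) \<le> (1 + norm x) ^ N"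
      by (rule order_trans[OF prod_1_plus_square_le power_increasing]) (use assms in auto)
    moreover have "0 < (\<Prod>b\<in>Basis. 1 + (x \<bullet> b)\<^sup>2)"
      by (intro prod_pos) (auto intro: add_pos_nonneg)
    ultimately have "inverse ((1 + norm x) ^ N) \<le> inverse (\<Prod>b\<in>Basis. 1 + (x \<bullet> b)\<^sup>2)"
      by (rule le_imp_inverse_le)
    then show ?thesis
      by (simp add: inverse_eq_divide prod_dividef)
  qed
  have "(\<integral>\<^sup>+(x::'a). ennreal (norm (1 / (1 + norm x) ^ N)) \<partial>lborel)
      \<le> (\<integral>\<^sup>+(x::'a). ennreal (\<Prod>b\<in>Basis. inverse (1 + (x \<bullet> b)\<^sup>2)) \<partial>lborel)"
    using le by (intro nn_integral_mono ennreal_leI) auto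
  also have "\<dots> = (\<integral>\<^sup>+(x::'a). (\<Prod>b\<in>Basis. ennreal (inverse (1 + (x \<bullet> b)\<^sup>2))) \<partial>lborel)"
    by (intro nn_integral_cong) (simp add: prod_ennreal add_nonneg_nonneg)
  also have "\<dots> = (\<Prod>b\<in>(Basis::'a set). (\<integral>\<^sup>+x. ennreal (inverse (1 + x\<^sup>2)) \<partial>lborel))"
    by (rule nn_integral_lborel_prod) auto
  also have "\<dots> < \<infinity>"
    using nn_integral_inverse_1_plus_square by (simp add: power_less_top_ennreal)
  finally show "(\<integral>\<^sup>+(x::'a). ennreal (norm (1 / (1 + norm x) ^ N)) \<partial>lborel) < \<infinity>" .
qed

text \<open>Integration by parts controls the powers of one coordinate at a time. At each point the
  largest coordinate, or 1 if all are smaller, is comparable to \<open>1 + norm x\<close>, so the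
  bound for that coordinate gives the decay there. Summing the constants makes the choice of the
  coordinate irrelevant.\<close>

lemma norm_decay_from_coordinates:
  fixes G :: "'a::euclidean_space \<Rightarrow> 'b::real_normed_vector"
  assumes "\<And>b k. b \<in> Basis \<Longrightarrow> \<exists>C. \<forall>x. \<bar>x \<bullet> b\<bar> ^ k * norm (G x) \<le> C"
  obtains C where "C \<ge> 0" "\<And>x. norm (G x) \<le> C / (1 + norm x) ^ N"
proof -
  let ?n = "real DIM('a)"
  obtain c where c: "\<And>b x. b \<in> Basis \<Longrightarrow> \<bar>x \<bullet> b\<bar> ^ N * norm (G x) \<le> c b"
    using assms[where k=N] by metis
  obtain b0 :: 'a where b0: "b0 \<in> Basis"
    using nonempty_Basis by blast
  obtain c0 where c0: "\<And>x. norm (G x) \<le> c0"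
    using assms[OF b0, of 0] by auto
  have c0': "0 \<le> c0"
    using order_trans[OF norm_ge_zero c0] .
  have c': "0 \<le> c b" if "b \<in> Basis" for b
    using order_trans[OF _ c[OF that, of 0]] by simp
  define C where "C = (1 + ?n) ^ N * (c0 + (\<Sum>b\<in>Basis. c b))"
  have "C \<ge> 0"
    unfolding C_def using c0' c' by (intro mult_nonneg_nonneg add_nonneg_nonneg sum_nonneg) auto
  moreover have "norm (G x) \<le> C / (1 + norm x) ^ N" for x
  proof -
    define M where "M = Max (insert 1 ((\<lambda>b. \<bar>x \<bullet> b\<bar>) ` Basis))"
    have M1: "1 \<le> M" and Mb: "\<And>b. b \<in> Basis \<Longrightarrow> \<bar>x \<bullet> b\<bar> \<le> M"
      unfolding M_def by (auto simp del: Max_insert intro!: Max_ge)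
    have Min: "M \<in> insert 1 ((\<lambda>b. \<bar>x \<bullet> b\<bar>) ` Basis)"
      unfolding M_def by (rule Max_in) auto
    have "norm x \<le> (\<Sum>b\<in>Basis. \<bar>x \<bullet> b\<bar>)"
      by (rule norm_le_l1)
    also have "\<dots> \<le> ?n * M"
      using sum_bounded_above[of Basis "\<lambda>b. \<bar>x \<bullet> b\<bar>" M] Mb by simp
    finally have "1 + norm x \<le> (1 + ?n) * M"
      using M1 by (simp add: algebra_simps)
    then have "(1 + norm x) ^ N \<le> (1 + ?n) ^ N * M ^ N"
      by (metis power_mono power_mult_distrib add_nonneg_nonneg norm_ge_zero zero_le_one)
    then have "(1 + norm x) ^ N * norm (G x) \<le> (1 + ?n) ^ N * (M ^ N * norm (G x))"
      by (metis mult.assoc mult_right_mono norm_ge_zero)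
    moreover have "M ^ N * norm (G x) \<le> c0 + (\<Sum>b\<in>Basis. c b)"
      using Min
    proof (elim insertE imageE)
      assume "M = 1"
      then show ?thesis
        using c0[of x] sum_nonneg[of Basis c] c' by simp
    next
      fix b assume b: "b \<in> Basis" "M = \<bar>x \<bullet> b\<bar>"
      have "c b \<le> (\<Sum>b\<in>Basis. c b)"
        using c' b by (intro member_le_sum) auto
      then show ?thesis
        using c[OF b(1), of x] c0' b by simp
    qed
    ultimately have "(1 + norm x) ^ N * norm (G x) \<le> C"
      unfolding C_def by (meson mult_left_mono order_trans zero_le_power add_nonneg_nonneg of_nat_0_le_iff zero_le_one)
    then show ?thesis
      by (subst pos_le_divide_eq) (auto simp: mult.commute intro!: zero_less_power add_pos_nonneg)
  qed
  ultimately show ?thesis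
    using that by blast
qed

lemma integrable_decay:
  fixes f :: "'a::euclidean_space \<Rightarrow> 'b::{banach, second_countable_topology}"
  assumes "f \<in> borel_measurable borel"
    and "\<And>x. norm (f x) \<le> C / (1 + norm x) ^ N" and "2 * DIM('a) \<le> N"
  shows "integrable lborel f"
proof (rule Bochner_Integration.integrable_bound)
  show "integrable lborel (\<lambda>x::'a. C * (1 / (1 + norm x) ^ N))"
    using integrable_poly_decay[OF assms(3)] by (rule integrable_mult_right)
  show "f \<in> borel_measurable lborel"
    using assms(1) by simp
  have "norm (f x) \<le> norm (C * (1 / (1 + norm x) ^ N))" for x
    using order_trans[OF assms(2) abs_ge_self, of x] by simp
  then show "AE x in lborel. norm (f x) \<le> norm (C * (1 / (1 + norm x) ^ N))"
    by blast
qed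

section \<open>Fourier inversion\<close>

lemma norm_cis_mult [simp]: "norm (cis t * z) = norm z"
  by (simp add: norm_mult)

lemma integral_cis_gaussian_real:
  fixes t :: real
  shows "(LINT x|lborel. cis (x * t) * complex_of_real (exp (- x\<^sup>2 / 2)))
      = complex_of_real (sqrt (2 * pi) * exp (- t\<^sup>2 / 2))" (is ?eq)
    and "integrable lborel (\<lambda>x. cis (x * t) * complex_of_real (exp (- x\<^sup>2 / 2)))" (is ?int)
proof -
  have eq: "cis (x * t) * complex_of_real (exp (- x\<^sup>2 / 2))
      = complex_of_real (sqrt (2 * pi)) * (std_normal_density x *\<^sub>R iexp (t * x))" for x
    by (simp add: std_normal_density_def cis_conv_exp scaleR_conv_of_real mult_ac)
  have "char std_normal_distribution t = (LINT x|lborel. std_normal_density x *\<^sub>R iexp (t * x))"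
    unfolding char_def by (subst integral_density) auto
  then show ?eq
    by (simp only: eq integral_mult_right_zero char_std_normal_distribution of_real_mult)
  have "integrable lborel (\<lambda>x. complex_of_real (std_normal_density x))"
    using integrable_normal_density[of 1 0] by (simp add: complex_of_real_integrable_eq)
  then have "integrable lborel (\<lambda>x. std_normal_density x *\<^sub>R iexp (t * x))"
    by (rule Bochner_Integration.integrable_bound) (auto simp: norm_mult)
  then show ?int
    unfolding eq by (intro integrable_mult_right)
qed

lemma integral_cis_gaussian:
  fixes \<zeta> :: "'a::euclidean_space"
  shows "(LINT x|lborel. cis (x \<bullet> \<zeta>) * complex_of_real (exp (- (norm x)\<^sup>2 / 2)))
      = complex_of_real (sqrt (2 * pi) ^ DIM('a) * exp (- (norm \<zeta>)\<^sup>2 / 2))" (is ?eq)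
    and "integrable lborel (\<lambda>x. cis (x \<bullet> \<zeta>) * complex_of_real (exp (- (norm x)\<^sup>2 / 2)))" (is ?int)
proof -
  interpret product_sigma_finite "\<lambda>_::'a. lborel :: real measure"
    by standard
  let ?P = "\<Pi>\<^sub>M b\<in>(Basis::'a set). (lborel :: real measure)"
  let ?F = "\<lambda>f. \<Sum>b\<in>(Basis::'a set). f b *\<^sub>R b :: 'a"
  let ?g = "\<lambda>x. cis (x \<bullet> \<zeta>) * complex_of_real (exp (- (norm x)\<^sup>2 / 2))"
  let ?h = "\<lambda>b x. cis (x * (\<zeta> \<bullet> b)) * complex_of_real (exp (- x\<^sup>2 / 2))"
  have norm2: "(norm (z::'a))\<^sup>2 = (\<Sum>b\<in>Basis. (z \<bullet> b)\<^sup>2)" for z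
    by (simp add: power2_norm_eq_inner euclidean_inner[of z z] power2_eq_square[of "_ \<bullet> _"])
  have gF: "?g (?F f) = (\<Prod>b\<in>Basis. ?h b (f b))" for f
  proof -
    have "?F f \<bullet> \<zeta> = (\<Sum>b\<in>Basis. f b * (\<zeta> \<bullet> b))"
      by (simp add: inner_sum_left inner_commute[of \<zeta>])
    moreover have "(norm (?F f))\<^sup>2 = (\<Sum>b\<in>Basis. (f b)\<^sup>2)"
      unfolding norm2 by (intro sum.cong) (auto simp: inner_sum_left inner_Basis if_distrib sum.delta cong: if_cong)
    ultimately show ?thesis
      by (simp add: prod.distrib cis_conv_exp sum_distrib_left exp_sum[symmetric] sum_divide_distrib sum_negf
          flip: of_real_prod)
  qed
  have [measurable]: "?F \<in> measurable ?P borel" "?g \<in> borel_measurable borel"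
    by measurable
  note int = integral_cis_gaussian_real(2)
  have "integral\<^sup>L lborel ?g = (LINT f|?P. ?g (?F f))"
    by (subst lborel_eq) (simp add: integral_distr)
  also have "\<dots> = (LINT f|?P. (\<Prod>b\<in>Basis. ?h b (f b)))"
    by (simp only: gF)
  also have "\<dots> = (\<Prod>b\<in>Basis. integral\<^sup>L lborel (?h b))"
    by (rule product_integral_prod[OF finite_Basis int])
  also have "\<dots> = (\<Prod>b\<in>Basis. complex_of_real (sqrt (2 * pi) * exp (- (\<zeta> \<bullet> b)\<^sup>2 / 2)))"
    by (simp only: integral_cis_gaussian_real)
  also have "\<dots> = complex_of_real (sqrt (2 * pi) ^ DIM('a) * exp (- (norm \<zeta>)\<^sup>2 / 2))"
    by (simp add: prod.distrib norm2 exp_sum[symmetric] sum_divide_distrib sum_negf flip: of_real_prod)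
  finally show ?eq .
  have "integrable ?P (\<lambda>f. \<Prod>b\<in>Basis. ?h b (f b))"
    by (rule product_integrable_prod[OF finite_Basis int])
  then have "integrable ?P (\<lambda>f. ?g (?F f))"
    by (simp only: gF)
  then show ?int
    by (subst lborel_eq) (simp add: integrable_distr_eq)
qed

lemma integrable_gaussian: "integrable lborel (\<lambda>x::'a::euclidean_space. exp (- (norm x)\<^sup>2 / 2))"
  using integral_cis_gaussian(2)[of "0::'a"]
  unfolding inner_zero_right cis_zero mult_1 complex_of_real_integrable_eq .

lemma integral_cis_gaussian_scaled:
  fixes \<zeta> :: "'a::euclidean_space"
  assumes "\<epsilon> > 0"
  shows "(LINT x|lborel. cis (x \<bullet> \<zeta>) * complex_of_real (exp (- (norm (\<epsilon> *\<^sub>R x))\<^sup>2 / 2)))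
      = complex_of_real ((sqrt (2 * pi) / \<epsilon>) ^ DIM('a) * exp (- (norm (\<zeta> /\<^sub>R \<epsilon>))\<^sup>2 / 2))"
proof -
  have "(LINT x|lborel. cis (x \<bullet> \<zeta>) * complex_of_real (exp (- (norm (\<epsilon> *\<^sub>R x))\<^sup>2 / 2)))
     = \<bar>inverse \<epsilon>\<bar> ^ DIM('a) *\<^sub>R (LINT x|lborel. cis ((0 + inverse \<epsilon> *\<^sub>R x) \<bullet> \<zeta>) *
         complex_of_real (exp (- (norm (\<epsilon> *\<^sub>R (0 + inverse \<epsilon> *\<^sub>R x)))\<^sup>2 / 2)))"
    using assms by (intro lborel_integral_affine) auto
  also have "\<dots> = inverse \<epsilon> ^ DIM('a) *\<^sub>R
      (LINT x|lborel. cis (x \<bullet> (\<zeta> /\<^sub>R \<epsilon>)) * complex_of_real (exp (- (norm x)\<^sup>2 / 2)))"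
    using assms by simp
  also have "\<dots> = complex_of_real ((sqrt (2 * pi) / \<epsilon>) ^ DIM('a) * exp (- (norm (\<zeta> /\<^sub>R \<epsilon>))\<^sup>2 / 2))"
    by (simp only: integral_cis_gaussian) (simp add: scaleR_conv_of_real power_divide field_simps)
  finally show ?thesis .
qed

text \<open>The double integral in the inversion formula does not converge absolutely. The Gaussian
  factor makes Fubini's theorem applicable; the \<open>x\<close>-integral then yields a Gaussian of
  width \<epsilon> around \<eta>, and the substitution \<open>\<xi> = \<eta> + \<epsilon> z\<close>
  removes \<epsilon> from the kernel.\<close>

lemma gaussian_regularized_inversion:
  fixes g :: "'a::euclidean_space \<Rightarrow> complex"
  assumes [measurable]: "g \<in> borel_measurable borel" and int: "integrable lborel g" and \<epsilon>: "\<epsilon> > 0"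
  shows "(LINT x|lborel. complex_of_real (exp (- (norm (\<epsilon> *\<^sub>R x))\<^sup>2 / 2)) *
        (cis (- (x \<bullet> \<eta>)) * (LINT \<xi>|lborel. cis (x \<bullet> \<xi>) * g \<xi>)))
      = (LINT z|lborel. complex_of_real (sqrt (2 * pi) ^ DIM('a) * exp (- (norm z)\<^sup>2 / 2)) * g (\<eta> + \<epsilon> *\<^sub>R z))"
proof -
  let ?E = "\<lambda>x::'a. complex_of_real (exp (- (norm (\<epsilon> *\<^sub>R x))\<^sup>2 / 2))"
  have "integrable lborel (\<lambda>x::'a. exp (- (norm (0 + \<epsilon> *\<^sub>R x))\<^sup>2 / 2))"
    by (subst lborel_integrable_affine[of "\<lambda>x. exp (- (norm x)\<^sup>2 / 2)"]) (use \<epsilon> integrable_gaussian in auto)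
  then have E: "integrable lborel (\<lambda>x::'a. exp (- (norm (\<epsilon> *\<^sub>R x))\<^sup>2 / 2))"
    by simp
  have "(LINT x|lborel. ?E x * (cis (- (x \<bullet> \<eta>)) * (LINT \<xi>|lborel. cis (x \<bullet> \<xi>) * g \<xi>)))
      = (LINT x|lborel. LINT \<xi>|lborel. ?E x * (cis (x \<bullet> (\<xi> - \<eta>)) * g \<xi>))"
  proof (intro Bochner_Integration.integral_cong refl)
    fix x
    have "?E x * (cis (- (x \<bullet> \<eta>)) * (LINT \<xi>|lborel. cis (x \<bullet> \<xi>) * g \<xi>))
        = (LINT \<xi>|lborel. (?E x * cis (- (x \<bullet> \<eta>))) * (cis (x \<bullet> \<xi>) * g \<xi>))"
      by simp
    also have "\<dots> = (LINT \<xi>|lborel. ?E x * (cis (x \<bullet> (\<xi> - \<eta>)) * g \<xi>))"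
      by (intro Bochner_Integration.integral_cong refl) (simp add: inner_diff_right cis_mult mult_ac)
    finally show "?E x * (cis (- (x \<bullet> \<eta>)) * (LINT \<xi>|lborel. cis (x \<bullet> \<xi>) * g \<xi>))
        = (LINT \<xi>|lborel. ?E x * (cis (x \<bullet> (\<xi> - \<eta>)) * g \<xi>))" .
  qed
  also have "\<dots> = (LINT \<xi>|lborel. LINT x|lborel. ?E x * (cis (x \<bullet> (\<xi> - \<eta>)) * g \<xi>))"
  proof (rule integral_swap_product_bound[where p="\<lambda>x. exp (- (norm (\<epsilon> *\<^sub>R x))\<^sup>2 / 2)" and q="\<lambda>\<xi>. norm (g \<xi>)"])
    show "integrable lborel (\<lambda>\<xi>. norm (g \<xi>))"
      using int by simp
    show "norm (?E x * (cis (x \<bullet> (\<xi> - \<eta>)) * g \<xi>)) \<le> exp (- (norm (\<epsilon> *\<^sub>R x))\<^sup>2 / 2) * norm (g \<xi>)" for x \<xi>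
      by (simp add: norm_mult)
    show "(\<lambda>(x, \<xi>). ?E x * (cis (x \<bullet> (\<xi> - \<eta>)) * g \<xi>)) \<in> borel_measurable borel"
      unfolding borel_prod[symmetric] by measurable
  qed (rule E)
  also have "\<dots> = (LINT \<xi>|lborel. complex_of_real ((sqrt (2 * pi) / \<epsilon>) ^ DIM('a) *
      exp (- (norm ((\<xi> - \<eta>) /\<^sub>R \<epsilon>))\<^sup>2 / 2)) * g \<xi>)"
  proof (intro Bochner_Integration.integral_cong refl)
    fix \<xi>
    have "(LINT x|lborel. ?E x * (cis (x \<bullet> (\<xi> - \<eta>)) * g \<xi>)) = (LINT x|lborel. cis (x \<bullet> (\<xi> - \<eta>)) * ?E x * g \<xi>)"
      by (simp add: mult_ac)
    also have "\<dots> = (LINT x|lborel. cis (x \<bullet> (\<xi> - \<eta>)) * ?E x) * g \<xi>"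
      by (rule integral_mult_left_zero)
    finally show "(LINT x|lborel. ?E x * (cis (x \<bullet> (\<xi> - \<eta>)) * g \<xi>)) =
        complex_of_real ((sqrt (2 * pi) / \<epsilon>) ^ DIM('a) * exp (- (norm ((\<xi> - \<eta>) /\<^sub>R \<epsilon>))\<^sup>2 / 2)) * g \<xi>"
      by (simp only: integral_cis_gaussian_scaled[OF \<epsilon>])
  qed
  also have "\<dots> = \<bar>\<epsilon>\<bar> ^ DIM('a) *\<^sub>R (LINT z|lborel. complex_of_real ((sqrt (2 * pi) / \<epsilon>) ^ DIM('a) *
      exp (- (norm ((\<eta> + \<epsilon> *\<^sub>R z - \<eta>) /\<^sub>R \<epsilon>))\<^sup>2 / 2)) * g (\<eta> + \<epsilon> *\<^sub>R z))"
    using \<epsilon> by (intro lborel_integral_affine) auto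
  also have "\<dots> = (LINT z|lborel. complex_of_real (sqrt (2 * pi) ^ DIM('a) * exp (- (norm z)\<^sup>2 / 2)) * g (\<eta> + \<epsilon> *\<^sub>R z))"
    unfolding integral_scaleR_right[symmetric]
    by (intro Bochner_Integration.integral_cong refl)
      (use \<epsilon> in \<open>simp add: scaleR_conv_of_real power_divide\<close>)
  finally show ?thesis .
qed

text \<open>Both sides are limits of the regularized identity as \<epsilon> tends to 0: one by
  integrability of the transform, the other by continuity and boundedness of \<open>g\<close>. Of
  the two factors \<open>sqrt (2 * pi) ^ DIM('a)\<close> one is the constant of the kernel, the
  other the integral of the Gaussian.\<close>

theorem fourier_inversion:
  fixes g :: "'a::euclidean_space \<Rightarrow> complex"
  assumes cont: "continuous_on UNIV g" and int: "integrable lborel g"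
    and bdd: "\<And>\<xi>. norm (g \<xi>) \<le> B"
    and int': "integrable lborel (\<lambda>x. LINT \<xi>|lborel. cis (x \<bullet> \<xi>) * g \<xi>)"
  shows "(LINT x|lborel. cis (- (x \<bullet> \<eta>)) * (LINT \<xi>|lborel. cis (x \<bullet> \<xi>) * g \<xi>)) = (2 * pi) ^ DIM('a) * g \<eta>"
proof (rule LIMSEQ_unique)
  have [measurable]: "g \<in> borel_measurable borel"
    using cont by (rule borel_measurable_continuous_onI)
  define G where "G = (\<lambda>x::'a. LINT \<xi>|lborel. cis (x \<bullet> \<xi>) * g \<xi>)"
  have [measurable]: "G \<in> borel_measurable borel"
    using int' unfolding G_def by auto
  define \<epsilon> where "\<epsilon> k = inverse (real (Suc k))" for k
  have \<epsilon>0: "\<epsilon> \<longlonglongrightarrow> 0"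
    unfolding \<epsilon>_def by (rule LIMSEQ_inverse_real_of_nat)
  have \<epsilon>: "\<epsilon> k > 0" for k
    by (simp add: \<epsilon>_def)
  let ?I = "\<lambda>k. LINT x|lborel. complex_of_real (exp (- (norm (\<epsilon> k *\<^sub>R x))\<^sup>2 / 2)) * (cis (- (x \<bullet> \<eta>)) * G x)"
  show "?I \<longlonglongrightarrow> (LINT x|lborel. cis (- (x \<bullet> \<eta>)) * G x)"
  proof (rule integral_dominated_convergence)
    show "integrable lborel (\<lambda>x. norm (G x))"
      using int' by (simp add: G_def)
    show "AE x in lborel. (\<lambda>k. complex_of_real (exp (- (norm (\<epsilon> k *\<^sub>R x))\<^sup>2 / 2)) * (cis (- (x \<bullet> \<eta>)) * G x))
        \<longlonglongrightarrow> cis (- (x \<bullet> \<eta>)) * G x"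
    proof (rule AE_I2)
      fix x
      have "(\<lambda>k. complex_of_real (exp (- (norm (\<epsilon> k *\<^sub>R x))\<^sup>2 / 2)) * (cis (- (x \<bullet> \<eta>)) * G x))
        \<longlonglongrightarrow> complex_of_real (exp (- (norm (0 *\<^sub>R x))\<^sup>2 / 2)) * (cis (- (x \<bullet> \<eta>)) * G x)"
        by (intro tendsto_intros \<epsilon>0) auto
      then show "(\<lambda>k. complex_of_real (exp (- (norm (\<epsilon> k *\<^sub>R x))\<^sup>2 / 2)) * (cis (- (x \<bullet> \<eta>)) * G x))
        \<longlonglongrightarrow> cis (- (x \<bullet> \<eta>)) * G x"
        by simp
    qed
    show "AE x in lborel. norm (complex_of_real (exp (- (norm (\<epsilon> k *\<^sub>R x))\<^sup>2 / 2)) * (cis (- (x \<bullet> \<eta>)) * G x)) \<le> norm (G x)" for k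
      by (rule AE_I2) (simp add: norm_mult mult_left_le_one_le)
  qed auto
  have "?I = (\<lambda>k. LINT z|lborel. complex_of_real (sqrt (2 * pi) ^ DIM('a) * exp (- (norm z)\<^sup>2 / 2)) * g (\<eta> + \<epsilon> k *\<^sub>R z))"
    unfolding G_def using gaussian_regularized_inversion[OF _ int \<epsilon>] by auto
  also have "\<dots> \<longlonglongrightarrow> (LINT z|lborel. complex_of_real (sqrt (2 * pi) ^ DIM('a) * exp (- (norm (z::'a))\<^sup>2 / 2)) * g \<eta>)"
  proof (rule integral_dominated_convergence)
    show "integrable lborel (\<lambda>z::'a. (sqrt (2 * pi) ^ DIM('a) * B) * exp (- (norm z)\<^sup>2 / 2))"
      by (intro integrable_mult_right integrable_gaussian)
    show "AE z in lborel. (\<lambda>k. complex_of_real (sqrt (2 * pi) ^ DIM('a) * exp (- (norm z)\<^sup>2 / 2)) * g (\<eta> + \<epsilon> k *\<^sub>R z))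
        \<longlonglongrightarrow> complex_of_real (sqrt (2 * pi) ^ DIM('a) * exp (- (norm (z::'a))\<^sup>2 / 2)) * g \<eta>"
    proof (intro AE_I2 tendsto_intros)
      fix z
      have "(\<lambda>k. \<eta> + \<epsilon> k *\<^sub>R z) \<longlonglongrightarrow> \<eta> + 0 *\<^sub>R z"
        by (intro tendsto_intros \<epsilon>0)
      moreover have "isCont g \<eta>"
        using cont by (simp add: continuous_on_eq_continuous_at)
      ultimately show "(\<lambda>k. g (\<eta> + \<epsilon> k *\<^sub>R z)) \<longlonglongrightarrow> g \<eta>"
        using isCont_tendsto_compose by fastforce
    qed
    show "AE z in lborel. norm (complex_of_real (sqrt (2 * pi) ^ DIM('a) * exp (- (norm z)\<^sup>2 / 2)) * g (\<eta> + \<epsilon> k *\<^sub>R z))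
        \<le> (sqrt (2 * pi) ^ DIM('a) * B) * exp (- (norm z)\<^sup>2 / 2)" for k
      using bdd by (intro AE_I2) (auto simp: norm_mult norm_power mult_ac intro!: mult_left_mono)
  qed auto
  also have "(LINT z|lborel. complex_of_real (sqrt (2 * pi) ^ DIM('a) * exp (- (norm (z::'a))\<^sup>2 / 2)) * g \<eta>)
      = (2 * pi) ^ DIM('a) * g \<eta>"
  proof -
    let ?c = "sqrt (2 * pi) ^ DIM('a)"
    have 1: "(LINT z|lborel. complex_of_real (exp (- (norm (z::'a))\<^sup>2 / 2))) = complex_of_real ?c"
      using integral_cis_gaussian(1)[of "0::'a"] by simp
    have 2: "?c * ?c = (2 * pi) ^ DIM('a)"
      by (simp only: power_mult_distrib[symmetric] real_sqrt_mult_self) simp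
    have "(LINT z|lborel. complex_of_real (?c * exp (- (norm (z::'a))\<^sup>2 / 2)) * g \<eta>)
        = complex_of_real (?c * ?c) * g \<eta>"
      unfolding of_real_mult integral_mult_left_zero integral_mult_right_zero 1 ..
    also have "\<dots> = (2 * pi) ^ DIM('a) * g \<eta>"
      unfolding 2 by simp
    finally show ?thesis .
  qed
  finally show "?I \<longlonglongrightarrow> (2 * pi) ^ DIM('a) * g \<eta>" .
qed

section \<open>Derivatives along a direction\<close>

text \<open>A relation and not an operator, so that the product and chain rules, used as
  introduction rules, also construct the derivative. Only restrictions to lines are differentiated,
  which is what the fundamental theorem of calculus asks for.\<close>

definition deriv_along :: "'a::real_normed_vector \<Rightarrow> ('a \<Rightarrow> 'b::real_normed_vector) \<Rightarrow> ('a \<Rightarrow> 'b) \<Rightarrow> bool" where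
  "deriv_along e f f' \<longleftrightarrow>
    (\<forall>x t. ((\<lambda>t. f (x + t *\<^sub>R e)) has_vector_derivative f' (x + t *\<^sub>R e)) (at t))"

lemma deriv_alongD:
  "deriv_along e f f' \<Longrightarrow> ((\<lambda>t. f (x + t *\<^sub>R e)) has_vector_derivative f' (x + t *\<^sub>R e)) (at t within S)"
  by (auto simp: deriv_along_def intro: has_vector_derivative_at_within)

lemma deriv_along_add:
  "deriv_along e f f' \<Longrightarrow> deriv_along e g g' \<Longrightarrow> deriv_along e (\<lambda>x. f x + g x) (\<lambda>x. f' x + g' x)"
  by (auto simp: deriv_along_def intro!: derivative_intros)

lemma deriv_along_mult:
  fixes f g :: "_ \<Rightarrow> 'b::real_normed_algebra"
  shows "deriv_along e f f' \<Longrightarrow> deriv_along e g g' \<Longrightarrow>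
    deriv_along e (\<lambda>x. f x * g x) (\<lambda>x. f x * g' x + f' x * g x)"
  by (auto simp: deriv_along_def intro!: has_vector_derivative_mult)

lemma deriv_along_const: "deriv_along e (\<lambda>x. c) (\<lambda>x. 0)"
  by (simp add: deriv_along_def)

lemma deriv_along_cmult:
  fixes f :: "_ \<Rightarrow> 'b::real_normed_algebra"
  shows "deriv_along e f f' \<Longrightarrow> deriv_along e (\<lambda>x. c * f x) (\<lambda>x. c * f' x)"
  using deriv_along_mult[OF deriv_along_const, of e f f' c] by simp

lemma deriv_along_bounded_linear:
  "bounded_linear h \<Longrightarrow> deriv_along e f f' \<Longrightarrow> deriv_along e (\<lambda>x. h (f x)) (\<lambda>x. h (f' x))"
  unfolding deriv_along_def by (auto intro: bounded_linear.has_vector_derivative)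

lemmas deriv_along_cnj = deriv_along_bounded_linear[OF bounded_linear_cnj]
lemmas deriv_along_of_real = deriv_along_bounded_linear[OF bounded_linear_of_real]

lemma deriv_along_unique:
  assumes "deriv_along e f f'" "deriv_along e f g'"
  shows "f' = g'"
proof
  fix x
  show "f' x = g' x"
    using vector_derivative_unique_at[OF deriv_alongD[OF assms(1)] deriv_alongD[OF assms(2)], of x 0] by simp
qed

text \<open>Integration by parts without cut-offs or boundary terms: \<open>f (x + e) - f x\<close>
  is the integral of \<open>f'\<close> over the segment from \<open>x\<close> to
  \<open>x + e\<close>. Integrated over \<open>x\<close>, the left side vanishes and the right side
  is the integral of \<open>f'\<close>, both by translation invariance.\<close>

lemma integral_deriv_along_eq_0:
  fixes f f' :: "'a::euclidean_space \<Rightarrow> complex"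
  assumes d: "deriv_along e f f'" and f: "integrable lborel f" and f': "integrable lborel f'"
    and cont: "continuous_on UNIV f'"
  shows "integral\<^sup>L lborel f' = 0"
proof -
  have [measurable]: "f \<in> borel_measurable borel" "f' \<in> borel_measurable borel"
    using f f' by auto
  let ?k = "\<lambda>t x. indicator {0..1} t *\<^sub>R f' (t *\<^sub>R e + x)"
  have int: "integrable (lborel \<Otimes>\<^sub>M lborel) (\<lambda>(t::real, x). ?k t x)"
  proof (rule lborel_pair.Fubini_integrable)
    show "(\<lambda>(t::real, x). ?k t x) \<in> borel_measurable (lborel \<Otimes>\<^sub>M lborel)"
      by measurable
    have *: "(\<lambda>t. LINT x|lborel. norm (?k t x)) = (\<lambda>t::real. indicator {0..1} t * (LINT x|lborel. norm (f' x)))"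
      using lborel_integral_translate[of "\<lambda>x. norm (f' x)" "t *\<^sub>R e" for t] by (auto simp: fun_eq_iff)
    show "integrable lborel (\<lambda>t::real. LINT x|lborel. norm (case (t, x) of (t, x) \<Rightarrow> ?k t x))"
      unfolding prod.case by (subst *) (intro integrable_mult_left, simp)
    show "AE t::real in lborel. integrable lborel (\<lambda>x. case (t, x) of (t, x) \<Rightarrow> ?k t x)"
      using f' by (auto simp: lborel_integrable_translate)
  qed
  have "integral\<^sup>L lborel f' = (LINT t::real|lborel. LINT x|lborel. ?k t x)"
    by (simp add: lborel_integral_translate)
  also have "\<dots> = (LINT x|lborel. LINT t::real|lborel. ?k t x)"
    using lborel_pair.Fubini_integral[OF int] by simp
  also have "\<dots> = (LINT x|lborel. f (e + x) - f x)"
  proof (intro Bochner_Integration.integral_cong refl)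
    fix x
    have "(LINT t::real|lborel. indicator {0..1} t *\<^sub>R f' (x + t *\<^sub>R e)) = f (x + 1 *\<^sub>R e) - f (x + 0 *\<^sub>R e)"
    proof (rule integral_FTC_Icc)
      show "continuous_on {0..1} (\<lambda>t. f' (x + t *\<^sub>R e))"
        by (intro continuous_intros continuous_on_compose2[OF cont]) auto
    qed (auto intro: deriv_alongD[OF d])
    then show "(LINT t::real|lborel. ?k t x) = f (e + x) - f x"
      by (simp add: add.commute)
  qed
  also have "\<dots> = 0"
    using f by (simp add: lborel_integral_translate lborel_integrable_translate)
  finally show ?thesis .
qed

section \<open>Smooth functions\<close>

lemma C_infinity_differentiable: "C_infinity f \<Longrightarrow> f differentiable (at x)"
  by (metis C_infinity_def C_k.simps(2))

lemma C_infinity_partial: "C_infinity f \<Longrightarrow> C_infinity (partial_deriv i f)"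
  by (metis C_infinity_def C_k.simps(2))

lemma C_infinity_foldr: "C_infinity f \<Longrightarrow> C_infinity (foldr partial_deriv is f)"
  by (induction "is") (auto intro: C_infinity_partial)

lemma C_infinity_continuous: "C_infinity f \<Longrightarrow> continuous_on S f"
  by (metis C_infinity_def C_k.simps(1) continuous_on_subset top_greatest)

lemma deriv_along_partial:
  fixes f :: "real^'n::finite \<Rightarrow> complex"
  assumes "\<And>x. f differentiable (at x)"
  shows "deriv_along (axis i 1) f (partial_deriv i f)"
  unfolding deriv_along_def
proof (intro allI)
  fix x :: "real^'n" and t :: real
  let ?e = "axis i 1 :: real^'n"
  obtain D where D: "(f has_derivative D) (at (x + t *\<^sub>R ?e))"
    using assms unfolding differentiable_def by blast
  have *: "((\<lambda>s. f (y + s *\<^sub>R ?e)) has_vector_derivative D ?e) (at s)"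
    if "y + s *\<^sub>R ?e = x + t *\<^sub>R ?e" for y s
  proof -
    have "((\<lambda>s. y + s *\<^sub>R ?e) has_vector_derivative ?e) (at s)"
      by (auto intro!: derivative_eq_intros)
    then have "(f \<circ> (\<lambda>s. y + s *\<^sub>R ?e) has_vector_derivative D ?e) (at s)"
      using vector_derivative_diff_chain_within[of "\<lambda>s. y + s *\<^sub>R ?e" ?e s UNIV f D] D that
      by (simp add: has_derivative_at_withinI)
    then show ?thesis
      by (simp add: o_def)
  qed
  have "partial_deriv i f (x + t *\<^sub>R ?e) = D ?e"
    unfolding partial_deriv_def by (rule vector_derivative_at) (rule *, simp)
  then show "((\<lambda>t. f (x + t *\<^sub>R ?e)) has_vector_derivative partial_deriv i f (x + t *\<^sub>R ?e)) (at t)"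
    using *[of x t] by simp
qed

lemma C_infinity_deriv_along: "C_infinity f \<Longrightarrow> deriv_along (axis i 1) f (partial_deriv i f)"
  by (intro deriv_along_partial C_infinity_differentiable)

lemma partial_deriv_add:
  assumes "\<And>x. f differentiable (at x)" "\<And>x. g differentiable (at x)"
  shows "partial_deriv i (\<lambda>x. f x + g x) = (\<lambda>x. partial_deriv i f x + partial_deriv i g x)"
  using assms by (intro deriv_along_unique[OF deriv_along_partial deriv_along_add] deriv_along_partial) auto

lemma partial_deriv_mult:
  assumes "\<And>x. f differentiable (at x)" "\<And>x. g differentiable (at x)"
  shows "partial_deriv i (\<lambda>x. f x * g x) = (\<lambda>x. f x * partial_deriv i g x + partial_deriv i f x * g x)"
  using assms by (intro deriv_along_unique[OF deriv_along_partial deriv_along_mult] deriv_along_partial) auto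

lemma C_k_SucD: "C_k (Suc k) f \<Longrightarrow> C_k k f"
proof (induction k arbitrary: f)
  case 0
  then show ?case
    by (auto intro!: continuous_at_imp_continuous_on differentiable_imp_continuous_within)
qed (metis C_k.simps(2))

lemma C_k_add: "C_k k f \<Longrightarrow> C_k k g \<Longrightarrow> C_k k (\<lambda>x. f x + g x)"
proof (induction k arbitrary: f g)
  case 0
  then show ?case
    by (simp add: continuous_on_add)
next
  case (Suc k)
  then show ?case
    by (auto simp: partial_deriv_add intro!: differentiable_add)
qed

lemma C_k_mult: "C_k k f \<Longrightarrow> C_k k g \<Longrightarrow> C_k k (\<lambda>x. f x * g x)"
proof (induction k arbitrary: f g)
  case 0
  then show ?case
    by (simp add: continuous_on_mult)
next
  case (Suc k)
  then have "C_k k f" "C_k k g"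
    using C_k_SucD by blast+
  with Suc show ?case
    by (auto simp: partial_deriv_mult intro!: differentiable_mult C_k_add)
qed

lemma C_infinity_mult: "C_infinity f \<Longrightarrow> C_infinity g \<Longrightarrow> C_infinity (\<lambda>x. f x * g x)"
  by (auto simp: C_infinity_def C_k_mult)

lemma partial_deriv_const: "partial_deriv i (\<lambda>x. c) = (\<lambda>x. 0)"
  by (simp add: partial_deriv_def fun_eq_iff)

lemma C_infinity_const: "C_infinity (\<lambda>x. c)"
proof -
  have "C_k k (\<lambda>x. c)" for k and c :: complex
    by (induction k arbitrary: c) (auto simp: partial_deriv_const)
  then show ?thesis
    unfolding C_infinity_def by blast
qed

lemma C_infinity_coord: "C_infinity (\<lambda>x::real^'n::finite. complex_of_real (x $ j - c))"
proof -
  have d: "(\<lambda>x::real^'n. complex_of_real (x $ j - c)) differentiable (at x)" for x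
    unfolding of_real_diff
    by (intro differentiable_diff differentiable_const bounded_linear_imp_differentiable
        bounded_linear_compose[OF bounded_linear_of_real] bounded_linear_vec_nth)
  have "partial_deriv i (\<lambda>x::real^'n. complex_of_real (x $ j - c)) = (\<lambda>x. complex_of_real (axis i 1 $ j))" for i
  proof (rule deriv_along_unique[OF deriv_along_partial[OF d]])
    show "deriv_along (axis i 1) (\<lambda>x::real^'n. complex_of_real (x $ j - c)) (\<lambda>x. complex_of_real (axis i 1 $ j))"
    proof (rule deriv_along_of_real)
      show "deriv_along (axis i 1) (\<lambda>x::real^'n. x $ j - c) (\<lambda>x. axis i 1 $ j)"
        unfolding deriv_along_def
        by (auto intro!: derivative_eq_intros simp flip: has_real_derivative_iff_has_vector_derivative)
    qed
  qed
  then have "C_k (Suc k) (\<lambda>x::real^'n. complex_of_real (x $ j - c))" for k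
    using d C_infinity_const unfolding C_infinity_def by auto
  then show ?thesis
    unfolding C_infinity_def by (metis C_k_SucD)
qed

text \<open>The increment of \<open>f\<close> in direction \<open>j\<close> is an integral of its
  \<open>j\<close>-th derivative. Differentiating under the integral in direction \<open>i\<close>
  expresses the increment of the \<open>i\<close>-th derivative as an integral of the mixed one, and
  differentiating in the upper limit gives the claim.\<close>

lemma partial_deriv_commute:
  fixes f :: "real^'n::finite \<Rightarrow> complex"
  assumes f: "C_infinity f"
  shows "partial_deriv i (partial_deriv j f) = partial_deriv j (partial_deriv i f)"
proof
  fix x :: "real^'n"
  let ?a = "axis i 1 :: real^'n" and ?b = "axis j 1 :: real^'n"
  let ?ij = "partial_deriv i (partial_deriv j f)"
  have cont: "continuous_on UNIV ?ij"
    using f by (intro C_infinity_continuous C_infinity_partial)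
  have cont': "continuous_on UNIV (partial_deriv j f)"
    using f by (intro C_infinity_continuous C_infinity_partial)
  have *: "integral {0..t} (\<lambda>\<tau>. ?ij (x + \<tau> *\<^sub>R ?b)) = partial_deriv i f (x + t *\<^sub>R ?b) - partial_deriv i f x"
    if "0 \<le> t" for t
  proof (rule vector_derivative_unique_at)
    have I: "f (x + s *\<^sub>R ?a + t *\<^sub>R ?b) - f (x + s *\<^sub>R ?a)
        = integral (cbox 0 t) (\<lambda>\<tau>. partial_deriv j f (x + s *\<^sub>R ?a + \<tau> *\<^sub>R ?b))" for s
      using fundamental_theorem_of_calculus[OF that, of "\<lambda>\<tau>. f (x + s *\<^sub>R ?a + \<tau> *\<^sub>R ?b)",
          OF deriv_alongD[OF C_infinity_deriv_along[OF f]]]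
      by (simp add: integral_unique)
    have "((\<lambda>s. integral (cbox 0 t) (\<lambda>\<tau>. partial_deriv j f (x + s *\<^sub>R ?a + \<tau> *\<^sub>R ?b))) has_vector_derivative
        integral (cbox 0 t) (\<lambda>\<tau>. ?ij (x + 0 *\<^sub>R ?a + \<tau> *\<^sub>R ?b))) (at 0 within UNIV)"
    proof (rule leibniz_rule_vector_derivative)
      fix s \<tau> :: real
      show "((\<lambda>s. partial_deriv j f (x + s *\<^sub>R ?a + \<tau> *\<^sub>R ?b)) has_vector_derivative
          ?ij (x + s *\<^sub>R ?a + \<tau> *\<^sub>R ?b)) (at s within UNIV)"
        using deriv_alongD[OF C_infinity_deriv_along[OF C_infinity_partial[OF f, of j], of i], where x="x + \<tau> *\<^sub>R ?b" and t=s and S=UNIV]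
        by (simp add: add_ac)
      show "(\<lambda>\<tau>. partial_deriv j f (x + s *\<^sub>R ?a + \<tau> *\<^sub>R ?b)) integrable_on cbox 0 t"
        by (intro integrable_continuous continuous_on_compose2[OF cont'] continuous_intros) auto
    next
      show "continuous_on (UNIV \<times> cbox 0 t) (\<lambda>(s, \<tau>). ?ij (x + s *\<^sub>R ?a + \<tau> *\<^sub>R ?b))"
        unfolding split_beta by (intro continuous_on_compose2[OF cont] continuous_intros) auto
    qed auto
    then show "((\<lambda>s. f (x + s *\<^sub>R ?a + t *\<^sub>R ?b) - f (x + s *\<^sub>R ?a)) has_vector_derivative
        integral {0..t} (\<lambda>\<tau>. ?ij (x + \<tau> *\<^sub>R ?b))) (at 0)"
      unfolding I by simp
    have "((\<lambda>s. f (x + t *\<^sub>R ?b + s *\<^sub>R ?a) - f (x + s *\<^sub>R ?a)) has_vector_derivative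
        partial_deriv i f (x + t *\<^sub>R ?b + 0 *\<^sub>R ?a) - partial_deriv i f (x + 0 *\<^sub>R ?a)) (at 0)"
      by (intro has_vector_derivative_diff deriv_alongD C_infinity_deriv_along f)
    then show "((\<lambda>s. f (x + s *\<^sub>R ?a + t *\<^sub>R ?b) - f (x + s *\<^sub>R ?a)) has_vector_derivative
        partial_deriv i f (x + t *\<^sub>R ?b) - partial_deriv i f x) (at 0)"
      by (simp add: add_ac)
  qed
  \<comment> \<open>The identity \<open>*\<close> holds for nonnegative \<open>t\<close>, so the
    derivatives at 0 are compared from the right.\<close>
  have "((\<lambda>t. integral {0..t} (\<lambda>\<tau>. ?ij (x + \<tau> *\<^sub>R ?b))) has_vector_derivative ?ij (x + 0 *\<^sub>R ?b)) (at 0 within {0..1})"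
    by (intro integral_has_vector_derivative continuous_on_compose2[OF cont] continuous_intros) auto
  then have "((\<lambda>t. partial_deriv i f (x + t *\<^sub>R ?b) - partial_deriv i f x) has_vector_derivative ?ij x) (at 0 within {0..1})"
    unfolding scaleR_zero_left add_0_right
    by (rule has_vector_derivative_transform[rotated 2]) (auto simp: *)
  moreover have "((\<lambda>t. partial_deriv i f (x + t *\<^sub>R ?b) - partial_deriv i f x) has_vector_derivative
      partial_deriv j (partial_deriv i f) (x + 0 *\<^sub>R ?b) - 0) (at 0 within {0..1})"
    by (intro has_vector_derivative_diff has_vector_derivative_const
        deriv_alongD[OF C_infinity_deriv_along] C_infinity_partial f)
  ultimately show "?ij x = partial_deriv j (partial_deriv i f) x"
    using vector_derivative_unique_within_closed_interval[of 0 1 0] by fastforce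
qed

lemma foldr_partial_deriv_move:
  "C_infinity f \<Longrightarrow> foldr partial_deriv (as @ i # bs) f = foldr partial_deriv (i # as @ bs) f"
proof (induction as)
  case (Cons a as)
  then show ?case
    using partial_deriv_commute[OF C_infinity_foldr[OF Cons.prems, of "as @ bs"]] by simp
qed simp

lemma foldr_partial_deriv_cong:
  assumes f: "C_infinity f" and "\<And>i. count_list is i = count_list js i"
  shows "foldr partial_deriv is f = foldr partial_deriv js f"
  using assms(2)
proof (induction "is" arbitrary: js)
  case Nil
  then have "js = []"
    by (metis count_list.simps(1) count_list_0_iff list.set_intros(1) neq_Nil_conv)
  then show ?case
    by simp
next
  case (Cons i "is")
  have "i \<in> set js"
    using Cons.prems[of i] count_list_0_iff[of js i] by auto
  then obtain as bs where js: "js = as @ i # bs"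
    by (meson split_list)
  have "count_list is k = count_list (as @ bs) k" for k
    using Cons.prems[of k] unfolding js by (simp split: if_splits)
  from Cons.IH[OF this] show ?case
    unfolding js foldr_partial_deriv_move[OF f] by simp
qed

text \<open>Eliminates the chosen list: it has the same counts as \<open>is\<close>, hence is a
  rearrangement of it, and partial derivatives of smooth functions commute.\<close>

lemma multi_deriv_eq_foldr:
  assumes "C_infinity f"
  shows "multi_deriv (count_list is) f = foldr partial_deriv is f"
  unfolding multi_deriv_def
  by (rule foldr_partial_deriv_cong[OF assms])
    (use someI_ex[OF multi_index_list_exists[of "count_list is"]] in blast)

section \<open>Symbols and compactly supported smooth functions\<close>

text \<open>Lists of directions replace multi-indices. A derivative of a symbol is then handled by
  appending to the list, and statements about several derivatives by induction on it.\<close>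

definition symbol :: "real \<Rightarrow> (real^'n::finite \<Rightarrow> complex) \<Rightarrow> bool" where
  "symbol m Q \<longleftrightarrow> C_infinity Q \<and>
    (\<forall>is. \<exists>c\<ge>0. \<forall>\<xi>. norm (foldr partial_deriv is Q \<xi>) \<le> c * (1 + norm \<xi>) powr (m - real (length is)))"

lemma symbol_class_symbol:
  fixes P :: "real^'n::finite \<Rightarrow> complex"
  assumes "P \<in> symbol_class m"
  shows "symbol m P"
  unfolding symbol_def
proof (intro conjI allI)
  show P: "C_infinity P"
    using assms by (simp add: symbol_class_def)
  fix "is" :: "'n list"
  obtain c where "c > 0" "\<And>\<xi>. norm (multi_deriv (count_list is) P \<xi>) \<le> c * (1 + norm \<xi>) powr (m - real (multi_order (count_list is)))"
    using assms unfolding symbol_class_def by blast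
  moreover have "multi_order (count_list is) = length is"
    unfolding multi_order_def by (rule sum_count_set) auto
  ultimately show "\<exists>c\<ge>0. \<forall>\<xi>. norm (foldr partial_deriv is P \<xi>) \<le> c * (1 + norm \<xi>) powr (m - real (length is))"
    by (auto simp: multi_deriv_eq_foldr[OF P] intro: less_imp_le)
qed

lemma symbol_partial:
  assumes "symbol m Q"
  shows "symbol (m - 1) (partial_deriv i Q)"
  unfolding symbol_def
proof (intro conjI allI)
  show "C_infinity (partial_deriv i Q)"
    using assms by (auto simp: symbol_def intro: C_infinity_partial)
  fix "is"
  obtain c where "c \<ge> 0" "\<And>\<xi>. norm (foldr partial_deriv (is @ [i]) Q \<xi>) \<le> c * (1 + norm \<xi>) powr (m - real (length (is @ [i])))"
    using assms unfolding symbol_def by blast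
  then show "\<exists>c\<ge>0. \<forall>\<xi>. norm (foldr partial_deriv is (partial_deriv i Q) \<xi>) \<le> c * (1 + norm \<xi>) powr (m - 1 - real (length is))"
    by (auto intro!: exI[of _ c] simp: algebra_simps)
qed

lemma symbol_foldr: "symbol m Q \<Longrightarrow> symbol (m - real (length is)) (foldr partial_deriv is Q)"
  by (induction "is") (auto dest: symbol_partial simp: algebra_simps)

lemma symbol_bound:
  assumes "symbol m Q"
  obtains c where "c \<ge> 0" "\<And>\<xi>. norm (Q \<xi>) \<le> c * (1 + norm \<xi>) powr m"
  using assms unfolding symbol_def by (metis foldr.simps(1) id_apply list.size(3) of_nat_0 diff_zero)

text \<open>Test functions without reference to a domain. This class is stable under derivatives and
  smooth factors; the smallness of the support enters later as a separate hypothesis with its centre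
  and radius.\<close>

definition bump :: "(real^'n::finite \<Rightarrow> complex) \<Rightarrow> bool" where
  "bump v \<longleftrightarrow> C_infinity v \<and> (\<exists>R. \<forall>x. v x \<noteq> 0 \<longrightarrow> norm x \<le> R)"

lemma test_functions_bump:
  assumes "u \<in> test_functions \<Omega>"
  shows "bump u"
proof -
  have "bounded {x. u x \<noteq> 0}"
    using assms by (auto simp: test_functions_def dest!: compact_imp_bounded intro: bounded_subset[OF _ closure_subset])
  then show ?thesis
    using assms by (auto simp: bump_def test_functions_def bounded_iff)
qed

lemma bump_mult: "bump v \<Longrightarrow> C_infinity f \<Longrightarrow> bump (\<lambda>x. f x * v x)"
  by (force simp: bump_def intro: C_infinity_mult)

lemma bump_partial:
  assumes "bump v"
  shows "bump (partial_deriv i v)"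
proof -
  obtain R where v: "C_infinity v" and R: "\<And>x. v x \<noteq> 0 \<Longrightarrow> norm x \<le> R"
    using assms by (auto simp: bump_def)
  have "partial_deriv i v x = 0" if "norm x > R" for x
  proof -
    let ?S = "{t. norm (x + t *\<^sub>R axis i 1) > R}"
    have "open ?S"
      by (intro open_Collect_less continuous_intros)
    have "((\<lambda>t. v (x + t *\<^sub>R axis i 1)) has_vector_derivative 0) (at 0)"
      by (rule has_vector_derivative_transform_within_open[OF has_vector_derivative_const \<open>open ?S\<close>, of _ 0])
        (use that R in \<open>auto simp: not_le[symmetric]\<close>)
    then show ?thesis
      unfolding partial_deriv_def by (rule vector_derivative_at)
  qed
  then show ?thesis
    unfolding bump_def using v by (meson C_infinity_partial linorder_not_le)
qed

lemma bump_continuous: "bump v \<Longrightarrow> continuous_on S v"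
  by (simp add: bump_def C_infinity_continuous)

lemma bump_measurable: "bump v \<Longrightarrow> v \<in> borel_measurable borel"
  by (intro borel_measurable_continuous_onI bump_continuous)

lemma bump_cbox:
  assumes "bump v"
  obtains a b where "\<And>x. v x \<noteq> 0 \<Longrightarrow> x \<in> cbox a b"
proof -
  have "bounded {x. v x \<noteq> 0}"
    using assms by (auto simp: bump_def bounded_iff)
  then show ?thesis
    using that by (meson bounded_subset_cbox_symmetric subsetD mem_Collect_eq)
qed

lemma continuous_support_integrable:
  fixes f :: "'a::euclidean_space \<Rightarrow> complex"
  assumes cont: "continuous_on UNIV f" and supp: "\<And>x. f x \<noteq> 0 \<Longrightarrow> x \<in> cbox a b"
  shows "integrable lborel f" "integral\<^sup>L lborel f = integral (cbox a b) f"
proof -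
  have eq: "indicator (cbox a b) x *\<^sub>R f x = f x" for x
    using supp[of x] by (auto simp: indicator_def)
  have *: "set_integrable lborel (cbox a b) f"
    using borel_integrable_compact[OF compact_cbox continuous_on_subset[OF cont]] 
    by (auto simp: set_integrable_def indicator_scaleR_eq_if)
  then show "integrable lborel f"
    by (simp add: set_integrable_def eq)
  have "integral\<^sup>L lborel f = set_lebesgue_integral lborel (cbox a b) f"
    by (simp add: set_lebesgue_integral_def eq)
  also have "\<dots> = integral (cbox a b) f"
    by (rule set_borel_integral_eq_integral(2)[OF *])
  finally show "integral\<^sup>L lborel f = integral (cbox a b) f" .
qed

lemma bump_integrable: "bump v \<Longrightarrow> integrable lborel v"
  by (metis bump_cbox bump_continuous continuous_support_integrable(1))

section \<open>Functions of polynomial growth and rapidly decreasing functions\<close>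

text \<open>This notion and \<open>rapid\<close> record size only. Their product rule reduces all
  integrability questions in \<xi> to rapid decay of \<open>ft a v\<close>, since symbols and
  weights grow at most polynomially.\<close>

definition poly_bounded :: "('a::real_normed_vector \<Rightarrow> 'b::real_normed_vector) \<Rightarrow> bool" where
  "poly_bounded f \<longleftrightarrow> (\<exists>c\<ge>0. \<exists>N::nat. \<forall>x. norm (f x) \<le> c * (1 + norm x) ^ N)"

definition rapid :: "('a::real_normed_vector \<Rightarrow> 'b::real_normed_vector) \<Rightarrow> bool" where
  "rapid f \<longleftrightarrow> (\<forall>N::nat. \<exists>c\<ge>0. \<forall>x. norm (f x) \<le> c / (1 + norm x) ^ N)"

lemma poly_bounded_mult:
  fixes f g :: "'a::real_normed_vector \<Rightarrow> 'b::real_normed_algebra"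
  assumes "poly_bounded f" "poly_bounded g"
  shows "poly_bounded (\<lambda>x. f x * g x)"
proof -
  obtain c N d M where f: "c \<ge> 0" "\<And>x. norm (f x) \<le> c * (1 + norm x) ^ N"
    and g: "d \<ge> 0" "\<And>x. norm (g x) \<le> d * (1 + norm x) ^ M"
    using assms unfolding poly_bounded_def by blast
  have "norm (f x * g x) \<le> (c * d) * (1 + norm x) ^ (N + M)" for x
  proof -
    have "norm (f x * g x) \<le> (c * (1 + norm x) ^ N) * (d * (1 + norm x) ^ M)"
      using f g by (intro order_trans[OF norm_mult_ineq mult_mono]) auto
    then show ?thesis
      by (simp add: power_add mult_ac)
  qed
  then show ?thesis
    unfolding poly_bounded_def using f g by (intro exI[of _ "c * d"]) auto
qed

lemma poly_bounded_bound:
  assumes "poly_bounded g" "\<And>x. norm (f x) \<le> C * norm (g x)"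
  shows "poly_bounded f"
proof -
  obtain c N where c: "c \<ge> 0" "\<And>x. norm (g x) \<le> c * (1 + norm x) ^ N"
    using assms(1) unfolding poly_bounded_def by blast
  have "norm (f x) \<le> (\<bar>C\<bar> * c) * (1 + norm x) ^ N" for x
  proof -
    have "norm (f x) \<le> \<bar>C\<bar> * norm (g x)"
      using assms(2)[of x] mult_right_mono[OF abs_ge_self[of C] norm_ge_zero[of "g x"]] by linarith
    also have "\<dots> \<le> \<bar>C\<bar> * (c * (1 + norm x) ^ N)"
      by (intro mult_left_mono c) simp
    finally show ?thesis
      by (simp only: mult.assoc)
  qed
  then show ?thesis
    unfolding poly_bounded_def using c by (intro exI[of _ "\<bar>C\<bar> * c"]) auto
qed

lemma rapid_mult_poly_bounded:
  fixes f g :: "'a::real_normed_vector \<Rightarrow> 'b::real_normed_algebra"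
  assumes "poly_bounded f" "rapid g"
  shows "rapid (\<lambda>x. f x * g x)"
  unfolding rapid_def
proof
  fix N
  obtain c M where f: "c \<ge> 0" "\<And>x. norm (f x) \<le> c * (1 + norm x) ^ M"
    using assms(1) unfolding poly_bounded_def by blast
  obtain d where g: "d \<ge> 0" "\<And>x. norm (g x) \<le> d / (1 + norm x) ^ (M + N)"
    using assms(2) unfolding rapid_def by blast
  have "norm (f x * g x) \<le> (c * d) / (1 + norm x) ^ N" for x
  proof -
    have "1 + norm x \<noteq> 0"
      using norm_ge_zero[of x] by linarith
    have "norm (f x * g x) \<le> (c * (1 + norm x) ^ M) * (d / (1 + norm x) ^ (M + N))"
      using f g by (intro order_trans[OF norm_mult_ineq mult_mono]) auto
    then show ?thesis
      using \<open>1 + norm x \<noteq> 0\<close> by (simp add: power_add)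
  qed
  then show "\<exists>c\<ge>0. \<forall>x. norm (f x * g x) \<le> c / (1 + norm x) ^ N"
    using f g by (intro exI[of _ "c * d"]) auto
qed

lemma rapid_bound:
  assumes "rapid g" "\<And>x. norm (f x) \<le> norm (g x)"
  shows "rapid f"
  using assms unfolding rapid_def by (meson order_trans)

lemma rapid_integrable:
  fixes f :: "'a::euclidean_space \<Rightarrow> 'b::{banach, second_countable_topology}"
  assumes "f \<in> borel_measurable borel" "rapid f"
  shows "integrable lborel f"
  using assms integrable_decay[of f _ "2 * DIM('a)"] unfolding rapid_def by blast

lemma rapid_imp_poly_bounded:
  assumes "rapid f"
  shows "poly_bounded f"
proof -
  obtain c where "c \<ge> 0" "\<And>x. norm (f x) \<le> c / (1 + norm x) ^ 0"
    using assms unfolding rapid_def by blast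
  then show ?thesis
    unfolding poly_bounded_def by (intro exI[of _ c] conjI exI[of _ 0]) auto
qed

lemma poly_bounded_norm_power2: "poly_bounded f \<Longrightarrow> poly_bounded (\<lambda>x. (norm (f x))\<^sup>2)"
proof -
  assume f: "poly_bounded f"
  have "poly_bounded (\<lambda>x. norm (f x))"
    by (rule poly_bounded_bound[OF f, of _ 1]) simp
  from poly_bounded_mult[OF this this] show ?thesis
    by (simp add: power2_eq_square)
qed

lemma rapid_norm_power2: "rapid f \<Longrightarrow> rapid (\<lambda>x. (norm (f x))\<^sup>2)"
proof -
  assume f: "rapid f"
  have "rapid (\<lambda>x. norm (f x))"
    by (rule rapid_bound[OF f]) simp
  from rapid_mult_poly_bounded[OF rapid_imp_poly_bounded[OF this] this] show ?thesis
    by (simp add: power2_eq_square)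
qed

section \<open>Fourier transforms of compactly supported smooth functions\<close>

lemma deriv_along_cis:
  assumes "deriv_along e f f'"
  shows "deriv_along e (\<lambda>x. cis (f x)) (\<lambda>x. \<i> * complex_of_real (f' x) * cis (f x))"
  unfolding deriv_along_def
proof (intro allI)
  fix x t
  have "((\<lambda>t. \<i> * complex_of_real (f (x + t *\<^sub>R e))) has_vector_derivative \<i> * complex_of_real (f' (x + t *\<^sub>R e))) (at t)"
    using deriv_alongD[OF deriv_along_cmult[OF deriv_along_of_real[OF assms]]] .
  then have "(exp \<circ> (\<lambda>t. \<i> * complex_of_real (f (x + t *\<^sub>R e))) has_vector_derivative
      \<i> * complex_of_real (f' (x + t *\<^sub>R e)) * exp (\<i> * complex_of_real (f (x + t *\<^sub>R e)))) (at t)"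
    by (rule field_vector_diff_chain_at) (rule DERIV_exp)
  then show "((\<lambda>t. cis (f (x + t *\<^sub>R e))) has_vector_derivative
      \<i> * complex_of_real (f' (x + t *\<^sub>R e)) * cis (f (x + t *\<^sub>R e))) (at t)"
    by (simp add: o_def cis_conv_exp)
qed

lemma deriv_along_inner_left:
  "deriv_along e (\<lambda>x. - ((x - a) \<bullet> \<xi>)) (\<lambda>x. - (e \<bullet> \<xi>))"
  unfolding deriv_along_def
  by (auto intro!: derivative_eq_intros
      simp: inner_diff_left inner_add_left simp flip: has_real_derivative_iff_has_vector_derivative)

lemma deriv_along_inner_right:
  "deriv_along e (\<lambda>\<xi>. c * (x \<bullet> \<xi>)) (\<lambda>\<xi>. c * (x \<bullet> e))"
  unfolding deriv_along_def
  by (auto intro!: derivative_eq_intros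
      simp: inner_add_right simp flip: has_real_derivative_iff_has_vector_derivative)

text \<open>The parameter \<open>a\<close> is a point near the support of \<open>v\<close>. It changes the transform by a phase
  only, but makes the derivative involve \<open>x - a\<close>, which is small on the support.\<close>

definition ft :: "real^'n::finite \<Rightarrow> (real^'n \<Rightarrow> complex) \<Rightarrow> real^'n \<Rightarrow> complex" where
  "ft a v \<xi> = (LINT x|lborel. cis (- ((x - a) \<bullet> \<xi>)) * v x)"

lemma fourier_eq_ft: "fourier v \<xi> = complex_of_real (1 / (2 * pi) ^ CARD('n)) * ft 0 v \<xi>"
  for v :: "real^'n::finite \<Rightarrow> complex"
  by (simp add: fourier_def ft_def)

lemma ft_shift: "ft a v \<xi> = cis (a \<bullet> \<xi>) * ft 0 v \<xi>"
proof -
  have "cis (- ((x - a) \<bullet> \<xi>)) * v x = cis (a \<bullet> \<xi>) * (cis (- (x \<bullet> \<xi>)) * v x)" for x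
    by (simp add: inner_diff_left cis_mult flip: mult.assoc)
  then show ?thesis
    unfolding ft_def by (simp only: integral_mult_right_zero diff_zero)
qed

lemma norm_ft_shift: "norm (ft a v \<xi>) = norm (ft 0 v \<xi>)"
  by (simp add: ft_shift[of a])

lemma ft_integrable: "bump v \<Longrightarrow> integrable lborel (\<lambda>x. cis (- ((x - a) \<bullet> \<xi>)) * v x)"
  by (rule Bochner_Integration.integrable_bound[OF bump_integrable]) (auto dest: bump_measurable)

text \<open>The compact support turns the transform into an integral over a fixed box, where
  continuity and differentiation in the parameter follow from the rules for parameter
  integrals.\<close>

lemma
  fixes v :: "real^'n::finite \<Rightarrow> complex"
  assumes v: "bump v"
  shows ft_continuous: "continuous_on S (ft a v)"
    and ft_deriv_along: "deriv_along (axis i 1) (ft a v) (ft a (\<lambda>x. - \<i> * complex_of_real (x $ i - a $ i) * v x))"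
proof -
  let ?w = "\<lambda>x. - \<i> * complex_of_real (x $ i - a $ i) * v x"
  obtain l u where lu: "\<And>x. v x \<noteq> 0 \<Longrightarrow> x \<in> cbox l u"
    using bump_cbox[OF v] by blast
  have contv: "continuous_on S v" for S
    using v by (rule bump_continuous)
  have contv': "continuous_on S (\<lambda>x. v (f x))" if "continuous_on S f" for S and f :: "_ \<Rightarrow> real^'n"
    using continuous_on_compose2[OF contv[of UNIV] that] by simp
  have *: "ft a v = (\<lambda>\<xi>. integral (cbox l u) (\<lambda>x. cis (- ((x - a) \<bullet> \<xi>)) * v x))"
    unfolding ft_def using lu
    by (intro ext continuous_support_integrable(2)) (auto intro!: continuous_intros contv)
  have **: "ft a ?w = (\<lambda>\<xi>. integral (cbox l u) (\<lambda>x. cis (- ((x - a) \<bullet> \<xi>)) * ?w x))"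
    unfolding ft_def using lu
    by (intro ext continuous_support_integrable(2)) (auto intro!: continuous_intros contv)
  have "continuous_on UNIV (ft a v)"
    unfolding * by (rule integral_continuous_on_param) (auto simp: split_beta intro!: continuous_intros contv')
  then show "continuous_on S (ft a v)"
    using continuous_on_subset by blast
  show "deriv_along (axis i 1) (ft a v) (ft a ?w)"
    unfolding deriv_along_def
  proof (intro allI)
    fix \<xi> :: "real^'n" and t :: real
    let ?e = "axis i 1 :: real^'n"
    show "((\<lambda>t. ft a v (\<xi> + t *\<^sub>R ?e)) has_vector_derivative ft a ?w (\<xi> + t *\<^sub>R ?e)) (at t)"
      unfolding * **
    proof (rule leibniz_rule_vector_derivative)
      fix t x
      have "deriv_along ?e (\<lambda>\<xi>. cis (- 1 * ((x - a) \<bullet> \<xi>)) * v x) (\<lambda>\<xi>. cis (- 1 * ((x - a) \<bullet> \<xi>)) * 0 +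
          (\<i> * complex_of_real (- 1 * ((x - a) \<bullet> ?e)) * cis (- 1 * ((x - a) \<bullet> \<xi>))) * v x)"
        by (intro deriv_along_mult deriv_along_cis deriv_along_inner_right deriv_along_const)
      from deriv_alongD[OF this, of \<xi> t UNIV]
      show "((\<lambda>t. cis (- ((x - a) \<bullet> (\<xi> + t *\<^sub>R ?e))) * v x) has_vector_derivative
          cis (- ((x - a) \<bullet> (\<xi> + t *\<^sub>R ?e))) * ?w x) (at t within UNIV)"
        by (simp add: inner_axis algebra_simps)
    next
      fix t
      show "(\<lambda>x. cis (- ((x - a) \<bullet> (\<xi> + t *\<^sub>R ?e))) * v x) integrable_on cbox l u"
        by (intro integrable_continuous continuous_intros contv)
    next
      show "continuous_on (UNIV \<times> cbox l u) (\<lambda>(t, x). cis (- ((x - a) \<bullet> (\<xi> + t *\<^sub>R ?e))) * ?w x)"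
        by (auto simp: split_beta intro!: continuous_intros contv')
    qed auto
  qed
qed

lemma ft_measurable: "bump v \<Longrightarrow> ft a v \<in> borel_measurable borel"
  by (intro borel_measurable_continuous_onI ft_continuous)

lemma ft_partial:
  fixes v :: "real^'n::finite \<Rightarrow> complex"
  assumes v: "bump v"
  shows "ft a (partial_deriv i v) \<xi> = \<i> * complex_of_real (\<xi> $ i) * ft a v \<xi>"
proof -
  let ?e = "axis i 1 :: real^'n"
  let ?c = "\<lambda>x. cis (- ((x - a) \<bullet> \<xi>))"
  have v': "C_infinity v" "bump (partial_deriv i v)"
    using v bump_partial[OF v] by (auto simp: bump_def[of v])
  have d: "deriv_along ?e (\<lambda>x. ?c x * v x)
      (\<lambda>x. ?c x * partial_deriv i v x + (\<i> * complex_of_real (- (?e \<bullet> \<xi>)) * ?c x) * v x)"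
    by (intro deriv_along_mult deriv_along_cis deriv_along_inner_left C_infinity_deriv_along v')
  have i: "integrable lborel (\<lambda>x. (\<i> * complex_of_real (- (?e \<bullet> \<xi>)) * ?c x) * v x)"
    using integrable_mult_right[OF ft_integrable[OF v], of "\<i> * complex_of_real (- (?e \<bullet> \<xi>))" a \<xi>]
    by (simp only: mult.assoc)
  have "(LINT x|lborel. ?c x * partial_deriv i v x + (\<i> * complex_of_real (- (?e \<bullet> \<xi>)) * ?c x) * v x) = 0"
    by (rule integral_deriv_along_eq_0[OF d])
      (intro ft_integrable v v' Bochner_Integration.integrable_add i continuous_intros bump_continuous)+
  then have "ft a (partial_deriv i v) \<xi> + (LINT x|lborel. (\<i> * complex_of_real (- (?e \<bullet> \<xi>))) * (?c x * v x)) = 0"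
    using Bochner_Integration.integral_add[OF ft_integrable[OF v'(2)] i] by (simp add: ft_def mult.assoc)
  then show ?thesis
    by (simp add: ft_def inner_axis' add_eq_0_iff)
qed

lemma norm_integral_cis_le:
  "norm (LINT x|lborel. cis (f x) * g x) \<le> (LINT x|lborel. norm (g x))"
  using integral_norm_bound[of lborel "\<lambda>x. cis (f x) * g x"] by simp

text \<open>Each factor \<open>\<xi> $ i\<close> is traded for a derivative of \<open>v\<close>,
  which is again a bump; hence the induction is over all \<open>v\<close>.\<close>

lemma ft_coordinate_decay: "bump v \<Longrightarrow> \<exists>C. \<forall>\<xi>. \<bar>\<xi> $ i\<bar> ^ k * norm (ft a v \<xi>) \<le> C"
proof (induction k arbitrary: v)
  case 0
  show ?case
    by (auto simp: ft_def intro: norm_integral_cis_le)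
next
  case (Suc k)
  obtain C where "\<And>\<xi>. \<bar>\<xi> $ i\<bar> ^ k * norm (ft a (partial_deriv i v) \<xi>) \<le> C"
    using Suc.IH[OF bump_partial[OF Suc.prems]] by blast
  then have "\<bar>\<xi> $ i\<bar> ^ Suc k * norm (ft a v \<xi>) \<le> C" for \<xi>
    by (simp add: ft_partial[OF Suc.prems] norm_mult mult_ac)
  then show ?case
    by blast
qed

lemma ft_decay:
  fixes v :: "real^'n::finite \<Rightarrow> complex"
  assumes "bump v"
  obtains C where "C \<ge> 0" "\<And>\<xi>. norm (ft a v \<xi>) \<le> C / (1 + norm \<xi>) ^ N"
proof (rule norm_decay_from_coordinates[of "ft a v"])
  fix b :: "real^'n" and k :: nat
  assume "b \<in> Basis"
  then obtain i where b: "b = axis i 1"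
    by (auto simp: Basis_vec_def)
  show "\<exists>C. \<forall>x. \<bar>x \<bullet> b\<bar> ^ k * norm (ft a v x) \<le> C"
    using ft_coordinate_decay[OF assms] by (simp add: b inner_axis)
qed (use that in blast)

lemma powr_le_power:
  assumes "x \<ge> (1::real)" "m \<le> real k"
  shows "x powr m \<le> x ^ k"
  using powr_mono[OF assms(2,1)] assms(1) by (simp add: powr_realpow)

lemma symbol_poly_bounded:
  assumes "symbol m Q"
  shows "poly_bounded Q"
proof -
  obtain k where k: "m \<le> real k"
    using real_arch_simple by blast
  obtain c where c: "c \<ge> 0" "\<And>\<xi>. norm (Q \<xi>) \<le> c * (1 + norm \<xi>) powr m"
    using symbol_bound[OF assms] by blast
  have "norm (Q \<xi>) \<le> c * (1 + norm \<xi>) ^ k" for \<xi>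
    using c(2) mult_left_mono[OF powr_le_power[OF _ k, of "1 + norm \<xi>"] c(1)]
    by (meson order_trans le_add_same_cancel1 norm_ge_zero)
  then show ?thesis
    unfolding poly_bounded_def using c(1) by blast
qed

lemma rapid_ft: "bump v \<Longrightarrow> rapid (ft a v)"
  unfolding rapid_def by (metis ft_decay)

lemma symbol_ft_decay:
  fixes v :: "real^'n::finite \<Rightarrow> complex"
  assumes Q: "symbol m Q" and v: "bump v"
  obtains C where "C \<ge> 0" "\<And>\<xi>. norm (Q \<xi> * ft a v \<xi>) \<le> C / (1 + norm \<xi>) ^ N"
  using rapid_mult_poly_bounded[OF symbol_poly_bounded[OF Q] rapid_ft[OF v, of a]]
  unfolding rapid_def by blast

lemma symbol_continuous: "symbol m Q \<Longrightarrow> continuous_on S Q"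
  by (simp add: symbol_def C_infinity_continuous)

lemma symbol_measurable: "symbol m Q \<Longrightarrow> Q \<in> borel_measurable borel"
  by (intro borel_measurable_continuous_onI symbol_continuous)

lemma symbol_ft_integrable:
  fixes v :: "real^'n::finite \<Rightarrow> complex"
  assumes Q: "symbol m Q" and v: "bump v" and [measurable]: "f \<in> borel_measurable borel"
  shows "integrable lborel (\<lambda>\<xi>. cis (f \<xi>) * (Q \<xi> * ft a v \<xi>))"
proof -
  note [measurable] = symbol_measurable[OF Q] ft_measurable[OF v]
  obtain C where C: "\<And>\<xi>. norm (Q \<xi> * ft a v \<xi>) \<le> C / (1 + norm \<xi>) ^ (2 * DIM(real^'n))"
    using symbol_ft_decay[OF Q v] by blast
  show ?thesis
    by (rule integrable_decay[of _ C "2 * DIM(real^'n)"]) (use C in auto)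
qed

section \<open>The Fourier transform of a pseudodifferential operator\<close>

definition inverse_ft :: "(real^'n::finite \<Rightarrow> complex) \<Rightarrow> real^'n \<Rightarrow> complex" where
  "inverse_ft g x = (LINT \<xi>|lborel. cis (x \<bullet> \<xi>) * g \<xi>)"

text \<open>Provides the integrability of \<open>pseudo_diff Q v\<close> that inversion requires. A
  factor \<open>x $ i\<close> becomes a derivative of \<open>Q * ft 0 v\<close>. By the product rule
  this is a sum of two terms of the same form, with \<open>v\<close> multiplied by a coordinate or
  \<open>Q\<close> differentiated, so the induction runs over all symbols and bumps at once.\<close>

lemma inverse_ft_coordinate_decay:
  fixes v :: "real^'n::finite \<Rightarrow> complex"
  shows "symbol m Q \<Longrightarrow> bump v \<Longrightarrow> \<exists>C. \<forall>x. \<bar>x $ i\<bar> ^ k * norm (inverse_ft (\<lambda>\<xi>. Q \<xi> * ft 0 v \<xi>) x) \<le> C"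
proof (induction k arbitrary: m Q v)
  case 0
  show ?case
    by (auto simp: inverse_ft_def intro: norm_integral_cis_le)
next
  case (Suc k)
  let ?e = "axis i 1 :: real^'n"
  let ?w = "\<lambda>x. - \<i> * complex_of_real (x $ i - 0 $ i) * v x"
  let ?Q = "partial_deriv i Q"
  note Q = Suc.prems(1) and v = Suc.prems(2)
  have Q': "symbol (m - 1) ?Q"
    using Q by (rule symbol_partial)
  have w: "bump ?w"
    unfolding mult.assoc by (intro bump_mult v C_infinity_coord C_infinity_const)
  obtain C1 where C1: "\<And>x. \<bar>x $ i\<bar> ^ k * norm (inverse_ft (\<lambda>\<xi>. Q \<xi> * ft 0 ?w \<xi>) x) \<le> C1"
    using Suc.IH[OF Q w] by blast
  obtain C2 where C2: "\<And>x. \<bar>x $ i\<bar> ^ k * norm (inverse_ft (\<lambda>\<xi>. ?Q \<xi> * ft 0 v \<xi>) x) \<le> C2"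
    using Suc.IH[OF Q' v] by blast
  have "\<bar>x $ i\<bar> ^ Suc k * norm (inverse_ft (\<lambda>\<xi>. Q \<xi> * ft 0 v \<xi>) x) \<le> C1 + C2" for x
  proof -
    let ?c = "\<lambda>\<xi>. cis (x \<bullet> \<xi>)"
    have int: "integrable lborel (\<lambda>\<xi>. ?c \<xi> * (Q \<xi> * ft 0 v \<xi>))" "integrable lborel (\<lambda>\<xi>. ?c \<xi> * (Q \<xi> * ft 0 ?w \<xi>))"
      "integrable lborel (\<lambda>\<xi>. ?c \<xi> * (?Q \<xi> * ft 0 v \<xi>))"
      by (rule symbol_ft_integrable, rule Q Q', rule v w, measurable)+
    have int4: "integrable lborel (\<lambda>\<xi>. \<i> * complex_of_real (1 * (x \<bullet> ?e)) * ?c \<xi> * (Q \<xi> * ft 0 v \<xi>))"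
      using integrable_mult_right[OF int(1), of "\<i> * complex_of_real (1 * (x \<bullet> ?e))"] by (simp only: mult.assoc)
    have int23: "integrable lborel (\<lambda>\<xi>. ?c \<xi> * (Q \<xi> * ft 0 ?w \<xi> + ?Q \<xi> * ft 0 v \<xi>))"
      using Bochner_Integration.integrable_add[OF int(2,3)] by (simp only: distrib_left)
    have "deriv_along ?e (\<lambda>\<xi>. cis (1 * (x \<bullet> \<xi>)) * (Q \<xi> * ft 0 v \<xi>))
        (\<lambda>\<xi>. cis (1 * (x \<bullet> \<xi>)) * (Q \<xi> * ft 0 ?w \<xi> + ?Q \<xi> * ft 0 v \<xi>)
          + \<i> * complex_of_real (1 * (x \<bullet> ?e)) * cis (1 * (x \<bullet> \<xi>)) * (Q \<xi> * ft 0 v \<xi>))"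
      using Q v by (intro deriv_along_mult deriv_along_cis deriv_along_inner_right ft_deriv_along C_infinity_deriv_along)
        (auto simp: symbol_def)
    then have d: "deriv_along ?e (\<lambda>\<xi>. ?c \<xi> * (Q \<xi> * ft 0 v \<xi>))
        (\<lambda>\<xi>. ?c \<xi> * (Q \<xi> * ft 0 ?w \<xi> + ?Q \<xi> * ft 0 v \<xi>)
          + \<i> * complex_of_real (1 * (x \<bullet> ?e)) * ?c \<xi> * (Q \<xi> * ft 0 v \<xi>))"
      unfolding mult_1 .
    have i23: "(LINT \<xi>|lborel. ?c \<xi> * (Q \<xi> * ft 0 ?w \<xi> + ?Q \<xi> * ft 0 v \<xi>)) =
        inverse_ft (\<lambda>\<xi>. Q \<xi> * ft 0 ?w \<xi>) x + inverse_ft (\<lambda>\<xi>. ?Q \<xi> * ft 0 v \<xi>) x"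
      by (simp only: distrib_left Bochner_Integration.integral_add[OF int(2,3)] inverse_ft_def)
    have i4: "(LINT \<xi>|lborel. \<i> * complex_of_real (1 * (x \<bullet> ?e)) * ?c \<xi> * (Q \<xi> * ft 0 v \<xi>)) =
        \<i> * complex_of_real (x $ i) * inverse_ft (\<lambda>\<xi>. Q \<xi> * ft 0 v \<xi>) x"
      by (simp only: mult.assoc integral_mult_right_zero inverse_ft_def) (simp add: inner_axis)
    have "(LINT \<xi>|lborel. ?c \<xi> * (Q \<xi> * ft 0 ?w \<xi> + ?Q \<xi> * ft 0 v \<xi>)
          + \<i> * complex_of_real (1 * (x \<bullet> ?e)) * ?c \<xi> * (Q \<xi> * ft 0 v \<xi>)) = 0"
      by (rule integral_deriv_along_eq_0[OF d])
        (intro int int4 int23 Bochner_Integration.integrable_add continuous_intros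
          symbol_continuous[OF Q] symbol_continuous[OF Q'] ft_continuous v w)+
    then have "inverse_ft (\<lambda>\<xi>. Q \<xi> * ft 0 ?w \<xi>) x + inverse_ft (\<lambda>\<xi>. ?Q \<xi> * ft 0 v \<xi>) x
        + \<i> * complex_of_real (x $ i) * inverse_ft (\<lambda>\<xi>. Q \<xi> * ft 0 v \<xi>) x = 0"
      unfolding Bochner_Integration.integral_add[OF int23 int4] i23 i4 by simp
    then have "\<i> * complex_of_real (x $ i) * inverse_ft (\<lambda>\<xi>. Q \<xi> * ft 0 v \<xi>) x =
        - (inverse_ft (\<lambda>\<xi>. Q \<xi> * ft 0 ?w \<xi>) x + inverse_ft (\<lambda>\<xi>. ?Q \<xi> * ft 0 v \<xi>) x)"
      by (simp add: add_eq_0_iff)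
    then have "norm (\<i> * complex_of_real (x $ i) * inverse_ft (\<lambda>\<xi>. Q \<xi> * ft 0 v \<xi>) x)
        \<le> norm (inverse_ft (\<lambda>\<xi>. Q \<xi> * ft 0 ?w \<xi>) x) + norm (inverse_ft (\<lambda>\<xi>. ?Q \<xi> * ft 0 v \<xi>) x)"
      by (simp only: norm_minus_cancel norm_triangle_ineq)
    then have "\<bar>x $ i\<bar> ^ k * (\<bar>x $ i\<bar> * norm (inverse_ft (\<lambda>\<xi>. Q \<xi> * ft 0 v \<xi>) x))
        \<le> \<bar>x $ i\<bar> ^ k * (norm (inverse_ft (\<lambda>\<xi>. Q \<xi> * ft 0 ?w \<xi>) x) + norm (inverse_ft (\<lambda>\<xi>. ?Q \<xi> * ft 0 v \<xi>) x))"
      by (intro mult_left_mono) (auto simp: norm_mult)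
    also have "\<dots> \<le> C1 + C2"
      unfolding distrib_left using C1 C2 by (rule add_mono)
    finally show ?thesis
      by (simp only: power_Suc mult_ac)
  qed
  then show ?case
    by blast
qed

text \<open>This is Fourier inversion for \<open>Q * ft 0 v\<close>, and it turns Sobolev norms into
  weighted integrals. Of the two normalizing factors one cancels the constant of inversion, the
  other changes \<open>ft 0 v\<close> into \<open>fourier v\<close>.\<close>

lemma fourier_pseudo_diff:
  fixes v :: "real^'n::finite \<Rightarrow> complex"
  assumes Q: "symbol m Q" and v: "bump v"
  shows "fourier (pseudo_diff Q v) \<xi> = Q \<xi> * fourier v \<xi>"
proof -
  let ?g = "\<lambda>\<xi>. Q \<xi> * ft 0 v \<xi>"
  let ?c = "complex_of_real (1 / (2 * pi) ^ CARD('n))"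
  note [measurable] = symbol_measurable[OF Q] ft_measurable[OF v]
  have int: "integrable lborel ?g"
    using symbol_ft_integrable[OF Q v, of "\<lambda>_. 0" 0] by simp
  obtain B where B: "\<And>\<xi>. norm (?g \<xi>) \<le> B"
    using symbol_ft_decay[OF Q v, of 0 0] by auto
  obtain C where C: "C \<ge> 0" "\<And>x. norm (inverse_ft ?g x) \<le> C / (1 + norm x) ^ (2 * DIM(real^'n))"
  proof (rule norm_decay_from_coordinates[of "inverse_ft ?g"])
    fix b :: "real^'n" and k :: nat
    assume "b \<in> Basis"
    then obtain i where b: "b = axis i 1"
      by (auto simp: Basis_vec_def)
    show "\<exists>C. \<forall>x. \<bar>x \<bullet> b\<bar> ^ k * norm (inverse_ft ?g x) \<le> C"
      using inverse_ft_coordinate_decay[OF Q v] by (simp add: b inner_axis)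
  qed blast
  have "inverse_ft ?g \<in> borel_measurable borel"
    unfolding inverse_ft_def by measurable
  then have int': "integrable lborel (inverse_ft ?g)"
    by (rule integrable_decay[OF _ C(2)]) simp
  have inv: "(LINT x|lborel. cis (- (x \<bullet> \<xi>)) * inverse_ft ?g x) = (2 * pi) ^ DIM(real^'n) * ?g \<xi>"
    unfolding inverse_ft_def
    by (rule fourier_inversion[OF _ int B])
      (use int' in \<open>auto simp: inverse_ft_def[abs_def] intro!: continuous_intros symbol_continuous[OF Q] ft_continuous v\<close>)
  have "pseudo_diff Q v x = ?c * inverse_ft ?g x" for x
  proof -
    have "cis (x \<bullet> \<xi>) * (Q \<xi> * fourier v \<xi>) = ?c * (cis (x \<bullet> \<xi>) * ?g \<xi>)" for \<xi>
      by (simp add: fourier_eq_ft mult_ac)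
    then show ?thesis
      by (simp add: pseudo_diff_def inverse_ft_def)
  qed
  then have "fourier (pseudo_diff Q v) \<xi> = ?c * (LINT x|lborel. ?c * (cis (- (x \<bullet> \<xi>)) * inverse_ft ?g x))"
    by (simp add: fourier_def mult_ac)
  also have "\<dots> = ?c * (?c * ((2 * pi) ^ DIM(real^'n) * ?g \<xi>))"
    by (simp only: integral_mult_right_zero inv)
  also have "\<dots> = Q \<xi> * fourier v \<xi>"
    by (simp add: fourier_eq_ft)
  finally show ?thesis .
qed

section \<open>A weighted Bernstein inequality\<close>

text \<open>Repeated integration by parts. The factor \<open>1 - y^2\<close> vanishes at both
  endpoints, so there are no boundary terms, and a derivative lowers its exponent by one while
  changing the cofactor. The arbitrary polynomial \<open>r\<close> absorbs that change in the
  induction.\<close>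

lemma oscillatory_integral_decay:
  "\<exists>C. \<forall>t. \<bar>t\<bar> ^ M * norm (LINT y|lborel. indicator {-1..1} y *\<^sub>R
     (cis (t * y) * complex_of_real (poly ([:1, 0, -1:] ^ M * r) y))) \<le> C"
proof (induction M arbitrary: r)
  case 0
  have "norm (LINT y|lborel. indicator {-1..1} y *\<^sub>R (cis (t * y) * complex_of_real (poly r y)))
      \<le> (LINT y|lborel. indicator {-1..1} y * \<bar>poly r y\<bar>)" for t
    using integral_norm_bound[of lborel "\<lambda>y. indicator {-1..1} y *\<^sub>R (cis (t * y) * complex_of_real (poly r y))"] by simp
  then show ?case
    by auto
next
  case (Suc M)
  let ?q = "[:1, 0, -1:] :: real poly"
  let ?r = "smult (of_nat (Suc M)) (pderiv ?q) * r + ?q * pderiv r"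
  let ?J = "\<lambda>p t. LINT y|lborel. indicator {-1..1} y *\<^sub>R (cis (t * y) * complex_of_real (poly p y))"
  have pd: "pderiv (?q ^ Suc M * r) = ?q ^ M * ?r"
    by (simp add: pderiv_mult pderiv_power_Suc algebra_simps del: power_Suc) (simp add: algebra_simps)
  obtain C where C: "\<And>t. \<bar>t\<bar> ^ M * norm (?J (?q ^ M * ?r) t) \<le> C"
    using Suc.IH by blast
  have eq: "\<bar>t\<bar> * norm (?J (?q ^ Suc M * r) t) = norm (?J (?q ^ M * ?r) t)" for t
  proof -
    let ?F = "\<lambda>y. cis (t * y) * complex_of_real (poly (?q ^ Suc M * r) y)"
    let ?F1 = "\<lambda>y. cis (t * y) * complex_of_real (poly (?q ^ M * ?r) y)"
    have d: "(?F has_vector_derivative (?F1 y + \<i> * complex_of_real t * ?F y)) (at y within S)" for y S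
    proof (rule has_vector_derivative_at_within)
      have "((\<lambda>y. cis (t * y)) has_vector_derivative \<i> * complex_of_real t * cis (t * y)) (at y)"
        using deriv_alongD[OF deriv_along_cis[OF deriv_along_inner_right[of "1::real" t 1]], of 0 y UNIV] by simp
      moreover have "((\<lambda>y. complex_of_real (poly (?q ^ Suc M * r) y)) has_vector_derivative
          complex_of_real (poly (?q ^ M * ?r) y)) (at y)"
        using poly_DERIV[of "?q ^ Suc M * r" y, unfolded pd]
        by (intro bounded_linear.has_vector_derivative[OF bounded_linear_of_real])
          (simp only: has_real_derivative_iff_has_vector_derivative)
      ultimately show "(?F has_vector_derivative (?F1 y + \<i> * complex_of_real t * ?F y)) (at y)"
        by (rule has_vector_derivative_eq_rhs[OF has_vector_derivative_mult]) (simp add: algebra_simps)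
    qed
    have int: "integrable lborel (\<lambda>y. indicator {-1..1} y *\<^sub>R (cis (t * y) * complex_of_real (poly p y)))" for p
      by (rule borel_integrable_compact) (auto intro!: continuous_intros)
    have "(LINT y|lborel. indicator {-1..1} y *\<^sub>R (?F1 y + \<i> * complex_of_real t * ?F y)) = ?F 1 - ?F (-1)"
      by (rule integral_FTC_Icc[OF _ d]) (simp, intro continuous_intros)
    also have "\<dots> = 0"
      by simp
    finally have "?J (?q ^ M * ?r) t + \<i> * complex_of_real t * ?J (?q ^ Suc M * r) t = 0"
      using int[of "?q ^ M * ?r"] int[of "?q ^ Suc M * r"]
      by (simp only: scaleR_add_right mult_scaleR_right[symmetric] integral_mult_right_zero
          Bochner_Integration.integral_add integrable_mult_right)
    then have "\<i> * complex_of_real t * ?J (?q ^ Suc M * r) t = - ?J (?q ^ M * ?r) t"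
      by (rule add_eq_0_iff[THEN iffD1])
    then have "norm (\<i> * complex_of_real t * ?J (?q ^ Suc M * r) t) = norm (?J (?q ^ M * ?r) t)"
      by (simp only: norm_minus_cancel)
    then show ?thesis
      by (simp only: norm_mult norm_ii norm_of_real mult_1)
  qed
  have "\<bar>t\<bar> ^ Suc M * norm (?J (?q ^ Suc M * r) t) \<le> C" for t
    using C[of t] unfolding eq[of t, symmetric] power_Suc2 mult.assoc .
  then show ?case
    by blast
qed

text \<open>The transform of \<open>\<psi>\<close> is the convolution of \<open>z\<close>, cut off to \<open>[-2, 2]\<close>, with an even bump
  supported in \<open>[-1, 1]\<close>, which reproduces linear functions on \<open>[-1, 1]\<close>.\<close>

lemma linear_multiplier_kernel:
  obtains \<psi> :: "real \<Rightarrow> complex" and C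
  where "\<psi> \<in> borel_measurable borel" "\<And>t. norm (\<psi> t) \<le> C / (1 + norm t) ^ M"
    and "\<And>x. \<bar>x\<bar> \<le> 1 \<Longrightarrow> (LINT t|lborel. cis (- (x * t)) * \<psi> t) = complex_of_real x"
proof -
  \<comment> \<open>The two extra powers make the transform \<open>G\<close> integrable on the line
    even for \<open>M = 0\<close>. They also keep the exponent positive, so that \<open>p\<close>
    vanishes outside [-1, 1].\<close>
  define L where "L = M + 2"
  define p where "p y = (max 0 (1 - y\<^sup>2)) ^ L" for y :: real
  define a where "a z = indicator {-2..2} z * z" for z :: real
  define f where "f x = (LINT z|lborel. a z * p (x - z))" for x
  have contp: "continuous_on S p" for S
    unfolding p_def by (intro continuous_intros)
  have contp': "continuous_on S (\<lambda>x. p (f x))" if "continuous_on S f" for S and f :: "'z::topological_space \<Rightarrow> real"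
    using continuous_on_compose2[OF contp[of UNIV] that] by simp
  have [measurable]: "p \<in> borel_measurable borel" "a \<in> borel_measurable borel"
    unfolding a_def p_def by measurable
  have p0: "p y = 0" if "\<bar>y\<bar> > 1" for y
    using that abs_square_le_1[of y] by (auto simp: p_def L_def not_le max_def power_0_left)
  have p1: "0 \<le> p y" "p y \<le> 1" for y
    by (auto simp: p_def intro!: power_le_one)
  have p_eq: "complex_of_real (p y) = indicator {-1..1} y *\<^sub>R complex_of_real (poly ([:1, 0, -1:] ^ L * 1) y)" for y
    using p0[of y] abs_square_le_1[of y]
    by (auto simp: indicator_def p_def abs_le_iff power2_eq_square poly_power)
  have int_p: "integrable lborel p"
  proof (rule Bochner_Integration.integrable_bound)
    show "AE y in lborel. norm (p y) \<le> norm (indicator {-1..1} y :: real)"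
      using p0 p1 by (intro AE_I2) (auto simp: indicator_def abs_le_iff not_le)
  qed auto
  have int_a: "integrable lborel a"
  proof (rule Bochner_Integration.integrable_bound)
    show "integrable lborel (\<lambda>z::real. 2 * indicator {-2..2} z :: real)"
      by simp
    show "AE z in lborel. norm (a z) \<le> norm (2 * indicator {-2..2} z :: real)"
      by (intro AE_I2) (auto simp: a_def indicator_def)
  qed auto
  define c0 where "c0 = (LINT y|lborel. p y)"
  have c0: "c0 > 0"
  proof -
    have "(LINT y|lborel. (3/4) ^ L * indicator {-1/2..1/2::real} y) \<le> (LINT y|lborel. p y)"
    proof (rule integral_mono[OF _ int_p])
      fix y :: real
      have "3/4 \<le> 1 - y\<^sup>2" if "-1/2 \<le> y" "y \<le> 1/2"
        using that abs_le_square_iff[of y "1/2"] by (auto simp: power2_eq_square)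
      then have "(3/4) ^ L \<le> p y" if "-1/2 \<le> y" "y \<le> 1/2"
        using that unfolding p_def by (intro power_mono) auto
      then show "(3/4) ^ L * indicator {-1/2..1/2} y \<le> p y"
        using p1[of y] by (auto simp: indicator_def)
    qed simp
    moreover have "(LINT y|lborel. (3/4::real) ^ L * indicator {-1/2..1/2::real} y) = (3/4) ^ L"
      by simp
    ultimately show ?thesis
      unfolding c0_def using zero_less_power[of "3/4::real" L] by linarith
  qed
  \<comment> \<open>For \<open>x\<close> and \<open>y\<close> in [-1, 1] the point
    \<open>x - y\<close> lies in [-2, 2], where the cut-off is inactive. The first moment of
    \<open>p\<close> vanishes because \<open>p\<close> is even.\<close>
  have f_eq: "f x = c0 * x" if "\<bar>x\<bar> \<le> 1" for x
  proof -
    have odd: "(LINT y|lborel. y * p y) = 0"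
      using lborel_integral_real_affine[of "-1" "\<lambda>y. y * p y" 0] by (simp add: p_def)
    have int: "integrable lborel (\<lambda>y. y * p y)"
    proof (rule Bochner_Integration.integrable_bound[OF int_p])
      have "\<bar>y * p y\<bar> \<le> \<bar>p y\<bar>" for y
        using p0[of y] mult_right_mono[of "\<bar>y\<bar>" 1 "\<bar>p y\<bar>"] by (cases "\<bar>y\<bar> \<le> 1") (auto simp: abs_mult)
      then show "AE y in lborel. norm (y * p y) \<le> norm (p y)"
        by simp
    qed simp
    have "f x = (LINT y|lborel. a (x + (-1) * y) * p (x - (x + (-1) * y)))"
      unfolding f_def by (subst lborel_integral_real_affine[of "-1" _ x]) auto
    also have "\<dots> = (LINT y|lborel. x * p y - y * p y)"
    proof (intro Bochner_Integration.integral_cong refl)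
      fix y
      show "a (x + (-1) * y) * p (x - (x + (-1) * y)) = x * p y - y * p y"
        using that p0[of y] by (cases "\<bar>y\<bar> \<le> 1") (auto simp: a_def indicator_def algebra_simps)
    qed
    also have "\<dots> = x * c0"
      using int int_p odd by (simp add: c0_def)
    finally show ?thesis
      by simp
  qed
  have f0: "f x = 0" if "\<bar>x\<bar> > 3" for x
  proof -
    have "a z * p (x - z) = 0" for z
      using that p0[of "x - z"] by (cases "\<bar>z\<bar> \<le> 2") (auto simp: a_def indicator_def)
    then show ?thesis
      unfolding f_def by (simp only: integral_zero)
  qed
  have contf: "continuous_on UNIV f"
  proof -
    have eq: "f = (\<lambda>x. integral (cbox (-2) 2) (\<lambda>z. z * p (x - z)))"
    proof
      fix x
      have *: "set_integrable lborel {-2..2} (\<lambda>z. z * p (x - z))"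
        unfolding set_integrable_def
        by (rule borel_integrable_compact) (auto intro!: continuous_intros contp')
      show "f x = integral (cbox (-2) 2) (\<lambda>z. z * p (x - z))"
        using set_borel_integral_eq_integral(2)[OF *] by (simp add: f_def a_def set_lebesgue_integral_def mult_ac)
    qed
    show ?thesis
      unfolding eq by (rule integral_continuous_on_param)
        (auto simp: split_beta intro!: continuous_intros contp')
  qed
  define g where "g x = complex_of_real (f x)" for x
  have contg: "continuous_on UNIV g"
    unfolding g_def by (intro continuous_intros contf)
  have supp: "x \<in> cbox (-3) 3" if "g x \<noteq> 0" for x
    using that f0[of x] by (force simp: g_def)
  have int_g: "integrable lborel g"
    using continuous_support_integrable(1)[OF contg supp] .
  have "bounded (g ` cbox (-3) 3)"
    by (intro compact_imp_bounded compact_continuous_image continuous_on_subset[OF contg]) auto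
  then obtain B where B0: "\<And>x. x \<in> cbox (-3) 3 \<Longrightarrow> norm (g x) \<le> B"
    unfolding bounded_iff by blast
  then have B: "norm (g x) \<le> max B 0" for x
    using B0[OF supp, of x] by (cases "g x = 0") (simp_all add: max.coboundedI1)
  define G where "G t = (LINT x|lborel. cis (t \<bullet> x) * g x)" for t :: real
  define J where "J t = (LINT y|lborel. cis (t * y) * complex_of_real (p y))" for t
  define A where "A t = (LINT z|lborel. complex_of_real (a z) * cis (t * z))" for t
  \<comment> \<open>A convolution becomes a product. Since \<open>a\<close> jumps at both ends of
    its interval, all the decay is taken from the smoother factor \<open>J\<close>, and
    \<open>A\<close> is merely bounded.\<close>
  have G_eq: "G t = A t * J t" for t
  proof -
    have "G t = (LINT x|lborel. LINT z|lborel. cis (t * x) * complex_of_real (a z * p (x - z)))"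
      unfolding G_def g_def f_def
      by (simp only: integral_mult_right_zero integral_complex_of_real inner_real_def)
    also have "\<dots> = (LINT z|lborel. LINT x|lborel. cis (t * x) * complex_of_real (a z * p (x - z)))"
    proof (rule integral_swap_product_bound[where p="\<lambda>x. indicator {-3..3} x" and q="\<lambda>z. \<bar>a z\<bar>"])
      show "(\<lambda>(x, z). cis (t * x) * complex_of_real (a z * p (x - z))) \<in> borel_measurable borel"
        unfolding borel_prod[symmetric] by measurable
      fix x z
      show "norm (cis (t * x) * complex_of_real (a z * p (x - z))) \<le> indicator {-3..3} x * \<bar>a z\<bar>"
      proof (cases "\<bar>x\<bar> \<le> 3")
        case True
        then show ?thesis
          using p1[of "x - z"] by (auto simp: norm_mult mult_left_le indicator_def abs_le_iff)
      next
        case False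
        then show ?thesis
          using p0[of "x - z"] by (cases "\<bar>z\<bar> \<le> 2") (auto simp: a_def indicator_def)
      qed
    qed (use int_a in auto)
    also have "\<dots> = (LINT z|lborel. complex_of_real (a z) * cis (t * z) * J t)"
    proof (intro Bochner_Integration.integral_cong refl)
      fix z
      have "(LINT x|lborel. cis (t * x) * complex_of_real (a z * p (x - z)))
          = (LINT x|lborel. cis (t * (z + x)) * complex_of_real (a z * p (z + x - z)))"
        by (rule lborel_integral_translate[symmetric]) measurable
      also have "\<dots> = (LINT x|lborel. complex_of_real (a z) * cis (t * z) * (cis (t * x) * complex_of_real (p x)))"
        by (intro Bochner_Integration.integral_cong refl) (simp add: distrib_left mult_ac flip: cis_mult)
      also have "\<dots> = complex_of_real (a z) * cis (t * z) * J t"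
        unfolding J_def by (rule integral_mult_right_zero)
      finally show "(LINT x|lborel. cis (t * x) * complex_of_real (a z * p (x - z))) = complex_of_real (a z) * cis (t * z) * J t" .
    qed
    finally show ?thesis
      unfolding A_def by (simp only: integral_mult_left_zero)
  qed
  have A: "norm (A t) \<le> (LINT z|lborel. \<bar>a z\<bar>)" for t
    using integral_norm_bound[of lborel "\<lambda>z. complex_of_real (a z) * cis (t * z)"] by (simp add: A_def norm_mult)
  obtain C1 where C1: "\<And>t. \<bar>t\<bar> ^ L * norm (J t) \<le> C1"
    using oscillatory_integral_decay[of L 1] unfolding J_def p_eq mult_scaleR_right by blast
  have C2: "norm (J t) \<le> c0" for t
    using norm_integral_cis_le[of "\<lambda>y. t * y" "\<lambda>y. complex_of_real (p y)"] p1 by (simp add: J_def c0_def)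
  define C where "C = (LINT z|lborel. \<bar>a z\<bar>) * (2 ^ L * (C1 + c0))"
  have G_decay: "norm (G t) \<le> C / (1 + norm t) ^ L" for t
  proof -
    have "1 + \<bar>t\<bar> \<le> 2 * max 1 \<bar>t\<bar>"
      by auto
    then have "(1 + \<bar>t\<bar>) ^ L \<le> 2 ^ L * max 1 \<bar>t\<bar> ^ L"
      by (metis power_mono power_mult_distrib abs_ge_zero add_nonneg_nonneg zero_le_one)
    also have "max 1 \<bar>t\<bar> ^ L \<le> 1 + \<bar>t\<bar> ^ L"
      by (auto simp: max_def)
    finally have "(1 + \<bar>t\<bar>) ^ L * norm (J t) \<le> 2 ^ L * (1 + \<bar>t\<bar> ^ L) * norm (J t)"
      by (intro mult_right_mono) auto
    also have "\<dots> = 2 ^ L * (\<bar>t\<bar> ^ L * norm (J t) + norm (J t))"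
      by (simp add: algebra_simps)
    also have "\<dots> \<le> 2 ^ L * (C1 + c0)"
      by (intro mult_left_mono add_mono C1 C2) auto
    finally have "norm (A t) * ((1 + \<bar>t\<bar>) ^ L * norm (J t)) \<le> C"
      unfolding C_def by (rule mult_mono[OF A]) auto
    then have "norm (G t) * (1 + \<bar>t\<bar>) ^ L \<le> C"
      by (simp add: G_eq norm_mult mult_ac)
    then show ?thesis
      by (subst pos_le_divide_eq) (auto intro!: zero_less_power add_pos_nonneg)
  qed
  have [measurable]: "g \<in> borel_measurable borel"
    using contg by (rule borel_measurable_continuous_onI)
  have [measurable]: "G \<in> borel_measurable borel"
    unfolding G_def by measurable
  have int_G: "integrable lborel G"
    by (rule integrable_decay[OF _ G_decay]) (auto simp: L_def)
  have inv: "(LINT t|lborel. cis (- (t * x)) * G t) = complex_of_real (2 * pi * f x)" for x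
    using fourier_inversion[OF contg int_g B, of x] int_G
    by (simp add: G_def[abs_def] g_def)
  \<comment> \<open>Inversion returns \<open>2 * pi * f x\<close>, which is
    \<open>2 * pi * c0 * x\<close> on [-1, 1]; hence the normalization.\<close>
  define \<psi> where "\<psi> t = complex_of_real (1 / (2 * pi * c0)) * G t" for t
  show ?thesis
  proof
    show "\<psi> \<in> borel_measurable borel"
      unfolding \<psi>_def by measurable
    show "norm (\<psi> t) \<le> (1 / (2 * pi * c0) * C) / (1 + norm t) ^ M" for t
    proof -
      have "0 \<le> C"
        using order_trans[OF norm_ge_zero G_decay, of 0] by simp
      then have "C / (1 + norm t) ^ L \<le> C / (1 + norm t) ^ M"
        by (intro divide_left_mono power_increasing) (auto simp: L_def intro!: mult_pos_pos zero_less_power add_pos_nonneg)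
      then have "norm (G t) \<le> C / (1 + norm t) ^ M"
        using G_decay[of t] by linarith
      then have "1 / (2 * pi * c0) * norm (G t) \<le> 1 / (2 * pi * c0) * (C / (1 + norm t) ^ M)"
        using c0 by (intro mult_left_mono) auto
      then show ?thesis
        using c0 by (simp add: \<psi>_def norm_mult norm_divide)
    qed
    show "(LINT t|lborel. cis (- (x * t)) * \<psi> t) = complex_of_real x" if "\<bar>x\<bar> \<le> 1" for x
    proof -
      have "(LINT t|lborel. cis (- (x * t)) * \<psi> t) = complex_of_real (1 / (2 * pi * c0)) * (LINT t|lborel. cis (- (t * x)) * G t)"
        unfolding \<psi>_def integral_mult_right_zero[symmetric] by (simp add: mult_ac)
      also have "\<dots> = complex_of_real (1 / (2 * pi * c0) * (2 * pi * (c0 * x)))"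
        unfolding inv f_eq[OF that] by simp
      also have "\<dots> = complex_of_real x"
        using c0 by simp
      finally show ?thesis .
    qed
  qed
qed

lemma nn_integral_weighted_square_le:
  fixes w f :: "'a \<Rightarrow> real"
  assumes [measurable]: "w \<in> borel_measurable M" "f \<in> borel_measurable M"
    and nn: "\<And>x. 0 \<le> w x" "\<And>x. 0 \<le> f x"
  shows "(\<integral>\<^sup>+x. ennreal (w x * f x) \<partial>M)\<^sup>2 \<le>
    (\<integral>\<^sup>+x. ennreal (w x) \<partial>M) * (\<integral>\<^sup>+x. ennreal (w x * (f x)\<^sup>2) \<partial>M)"
proof -
  have eq: "w x * f x = sqrt (w x) * (sqrt (w x) * f x)" "(sqrt (w x) * f x)\<^sup>2 = w x * (f x)\<^sup>2" for x
    using nn by (auto simp: power_mult_distrib simp flip: mult.assoc)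
  have "(\<integral>\<^sup>+x. ennreal (w x * f x) \<partial>M)\<^sup>2 = (\<integral>\<^sup>+x. ennreal (sqrt (w x)) * ennreal (sqrt (w x) * f x) \<partial>M)\<^sup>2"
    using nn by (subst eq(1)) (simp add: ennreal_mult)
  also have "\<dots> \<le> (\<integral>\<^sup>+x. ennreal (sqrt (w x)) ^ 2 \<partial>M) * (\<integral>\<^sup>+x. ennreal (sqrt (w x) * f x) ^ 2 \<partial>M)"
    by (rule Cauchy_Schwarz_nn_integral) measurable
  also have "\<dots> = (\<integral>\<^sup>+x. ennreal (w x) \<partial>M) * (\<integral>\<^sup>+x. ennreal (w x * (f x)\<^sup>2) \<partial>M)"
    using nn by (simp add: ennreal_power eq(2) del: ennreal_mult')
  finally show ?thesis .
qed

text \<open>On the support of \<open>v\<close> the quotient \<open>(x $ i - a $ i) / \<rho>\<close>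
  lies in [-1, 1], where \<psi> represents it as a superposition of phases in \<open>x\<close>.
  Multiplying \<open>v\<close> by a phase translates its transform, here by
  \<open>t / \<rho>\<close>.\<close>

lemma ft_coordinate_average:
  fixes v :: "real^'n::finite \<Rightarrow> complex"
  assumes v: "bump v" and \<rho>: "\<rho> > 0" and supp: "\<And>x. v x \<noteq> 0 \<Longrightarrow> \<bar>x $ i - a $ i\<bar> \<le> \<rho>"
    and [measurable]: "\<psi> \<in> borel_measurable borel" and int: "integrable lborel (\<lambda>t. norm (\<psi> t))"
    and \<psi>: "\<And>x. \<bar>x\<bar> \<le> 1 \<Longrightarrow> (LINT t|lborel. cis (- (x * t)) * \<psi> t) = complex_of_real x"
  shows "ft a (\<lambda>x. - \<i> * complex_of_real (x $ i - a $ i) * v x) \<xi>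
      = - \<i> * complex_of_real \<rho> * (LINT t|lborel. \<psi> t * ft a v (\<xi> + (t / \<rho>) *\<^sub>R axis i 1))"
proof -
  note [measurable] = bump_measurable[OF v]
  let ?k = "\<lambda>x t. cis (- ((x - a) \<bullet> (\<xi> + (t / \<rho>) *\<^sub>R axis i 1))) * v x * \<psi> t"
  have x: "cis (- ((x - a) \<bullet> \<xi>)) * (- \<i> * complex_of_real (x $ i - a $ i) * v x)
      = - \<i> * complex_of_real \<rho> * (LINT t|lborel. ?k x t)" for x
  proof (cases "v x = 0")
    case True
    then show ?thesis by simp
  next
    case False
    let ?y = "(x $ i - a $ i) / \<rho>"
    have "\<bar>?y\<bar> \<le> 1"
      using supp[OF False] \<rho> by (simp add: divide_le_eq)
    from \<psi>[OF this] have eq: "complex_of_real (x $ i - a $ i) = complex_of_real \<rho> * (LINT t|lborel. cis (- (?y * t)) * \<psi> t)"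
      using \<rho> by simp
    have "?k x t = cis (- ((x - a) \<bullet> \<xi>)) * v x * (cis (- (?y * t)) * \<psi> t)" for t
    proof -
      have "- ((x - a) \<bullet> (\<xi> + (t / \<rho>) *\<^sub>R axis i 1)) = - ((x - a) \<bullet> \<xi>) + - (?y * t)"
        by (simp add: inner_add_right inner_axis)
      then have "cis (- ((x - a) \<bullet> (\<xi> + (t / \<rho>) *\<^sub>R axis i 1))) = cis (- ((x - a) \<bullet> \<xi>)) * cis (- (?y * t))"
        by (simp only: cis_mult)
      then show ?thesis
        by (simp only: mult_ac)
    qed
    then have "(LINT t|lborel. ?k x t) = cis (- ((x - a) \<bullet> \<xi>)) * v x * (LINT t|lborel. cis (- (?y * t)) * \<psi> t)"
      by (simp only: integral_mult_right_zero)
    then show ?thesis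
      unfolding eq by (simp only: mult_ac)
  qed
  have "ft a (\<lambda>x. - \<i> * complex_of_real (x $ i - a $ i) * v x) \<xi>
      = - \<i> * complex_of_real \<rho> * (LINT x|lborel. LINT t|lborel. ?k x t)"
    unfolding ft_def x by (rule integral_mult_right_zero)
  also have "(LINT x|lborel. LINT t|lborel. ?k x t) = (LINT t|lborel. LINT x|lborel. ?k x t)"
  proof (rule integral_swap_product_bound[where p="\<lambda>x. norm (v x)" and q="\<lambda>t. norm (\<psi> t)"])
    show "(\<lambda>(x, t). ?k x t) \<in> borel_measurable borel"
      unfolding borel_prod[symmetric] by measurable
    show "integrable lborel (\<lambda>x. norm (v x))"
      using bump_integrable[OF v] by simp
  qed (use int in \<open>auto simp: norm_mult\<close>)
  also have "\<dots> = (LINT t|lborel. \<psi> t * ft a v (\<xi> + (t / \<rho>) *\<^sub>R axis i 1))"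
    unfolding ft_def integral_mult_left_zero by (simp only: mult_ac)
  finally show ?thesis .
qed

text \<open>The derivative of \<open>ft a v\<close> is \<rho> times an average of translates.
  Cauchy-Schwarz with respect to \<open>norm (\<psi> t)\<close> bounds its square by an average of
  squares; Tonelli's theorem and a translation in \<xi> then move the weight onto the translate,
  which costs \<open>c * (1 + \<bar>t\<bar>) ^ R\<close>. The kernel decays with exponent
  \<open>R + 2\<close>: \<open>R\<close> for this loss and 2 for integrability. It is fixed before
  all other data, so \<open>C\<close> depends on \<open>R\<close> only.\<close>

lemma weighted_bernstein:
  obtains C :: real where "C \<ge> 0"
    "\<And>(v :: real^'n::finite \<Rightarrow> complex) a i \<rho> V c.
      bump v \<Longrightarrow> \<rho> > 0 \<Longrightarrow> (\<And>x. v x \<noteq> 0 \<Longrightarrow> \<bar>x $ i - a $ i\<bar> \<le> \<rho>) \<Longrightarrow>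
      V \<in> borel_measurable borel \<Longrightarrow> (\<And>\<xi>. 0 \<le> V \<xi>) \<Longrightarrow> c \<ge> 0 \<Longrightarrow>
      (\<And>\<xi> t. V \<xi> \<le> c * (1 + \<bar>t\<bar>) ^ R * V (\<xi> + (t / \<rho>) *\<^sub>R axis i 1)) \<Longrightarrow>
      (\<integral>\<^sup>+\<xi>. ennreal (V \<xi> * (norm (ft a (\<lambda>x. - \<i> * complex_of_real (x $ i - a $ i) * v x) \<xi>))\<^sup>2) \<partial>lborel)
        \<le> ennreal (C * c * \<rho>\<^sup>2) * (\<integral>\<^sup>+\<xi>. ennreal (V \<xi> * (norm (ft a v \<xi>))\<^sup>2) \<partial>lborel)"
proof -
  obtain \<psi> C0 where \<psi>m [measurable]: "\<psi> \<in> borel_measurable borel"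
    and C0: "\<And>t. norm (\<psi> t) \<le> C0 / (1 + norm t) ^ (R + 2)"
    and \<psi>: "\<And>x. \<bar>x\<bar> \<le> 1 \<Longrightarrow> (LINT t|lborel. cis (- (x * t)) * \<psi> t) = complex_of_real x"
    using linear_multiplier_kernel[of "R + 2"] by blast
  have int: "integrable lborel (\<lambda>t. norm (\<psi> t))"
    by (intro integrable_norm integrable_decay[OF _ C0]) auto
  have intR: "integrable lborel (\<lambda>t. norm (\<psi> t) * (1 + \<bar>t\<bar>) ^ R)"
  proof (rule integrable_decay)
    show "norm (norm (\<psi> t) * (1 + \<bar>t\<bar>) ^ R) \<le> C0 / (1 + norm t) ^ 2" for t
    proof -
      have "norm (\<psi> t) * (1 + \<bar>t\<bar>) ^ R \<le> C0 / (1 + norm t) ^ (R + 2) * (1 + \<bar>t\<bar>) ^ R"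
        using C0 by (intro mult_right_mono) auto
      also have "\<dots> = C0 / (1 + norm t) ^ 2"
      proof -
        have "1 + \<bar>t\<bar> \<noteq> 0"
          by arith
        then show ?thesis
          by (simp add: power_add power2_eq_square)
      qed
      finally show ?thesis
        by simp
    qed
  qed auto
  define K1 where "K1 = (LINT t|lborel. norm (\<psi> t))"
  define K2 where "K2 = (LINT t|lborel. norm (\<psi> t) * (1 + \<bar>t\<bar>) ^ R)"
  have K: "0 \<le> K1" "0 \<le> K2"
    by (auto simp: K1_def K2_def)
  have nK1: "(\<integral>\<^sup>+t. ennreal (norm (\<psi> t)) \<partial>lborel) = ennreal K1"
    unfolding K1_def by (rule nn_integral_eq_integral[OF int]) simp
  have nK2: "(\<integral>\<^sup>+t. ennreal (norm (\<psi> t) * (1 + \<bar>t\<bar>) ^ R) \<partial>lborel) = ennreal K2"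
    unfolding K2_def by (rule nn_integral_eq_integral[OF intR]) simp
  show ?thesis
  proof
    show "0 \<le> K1 * K2"
      using K by simp
    fix v :: "real^'n \<Rightarrow> complex" and a :: "real^'n" and i :: 'n and \<rho> :: real and V :: "real^'n \<Rightarrow> real" and c :: real
    assume v: "bump v" and \<rho>: "\<rho> > 0" and supp: "\<And>x. v x \<noteq> 0 \<Longrightarrow> \<bar>x $ i - a $ i\<bar> \<le> \<rho>"
      and V [measurable]: "V \<in> borel_measurable borel" and V0: "\<And>\<xi>. 0 \<le> V \<xi>" and c: "c \<ge> 0"
      and temp: "\<And>\<xi> t. V \<xi> \<le> c * (1 + \<bar>t\<bar>) ^ R * V (\<xi> + (t / \<rho>) *\<^sub>R axis i 1)"
    let ?e = "axis i 1 :: real^'n"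
    let ?h = "\<lambda>\<xi>. norm (ft a v \<xi>)"
    let ?h' = "\<lambda>\<xi>. norm (ft a (\<lambda>x. - \<i> * complex_of_real (x $ i - a $ i) * v x) \<xi>)"
    let ?I = "\<integral>\<^sup>+\<xi>. ennreal (V \<xi> * (?h \<xi>)\<^sup>2) \<partial>lborel"
    note hm [measurable] = ft_measurable[OF v]
    have h': "ennreal (?h' \<xi>) \<le> ennreal \<rho> * (\<integral>\<^sup>+t. ennreal (norm (\<psi> t) * ?h (\<xi> + (t / \<rho>) *\<^sub>R ?e)) \<partial>lborel)" for \<xi>
    proof -
      have "?h' \<xi> = \<rho> * norm (LINT t|lborel. \<psi> t * ft a v (\<xi> + (t / \<rho>) *\<^sub>R ?e))"
        using \<rho> by (subst ft_coordinate_average[OF v \<rho> supp \<psi>m int \<psi>]) (simp_all add: norm_mult)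
      moreover have "integrable lborel (\<lambda>t. \<psi> t * ft a v (\<xi> + (t / \<rho>) *\<^sub>R ?e))"
      proof -
        obtain B where B: "\<And>\<xi>. ?h \<xi> \<le> B"
          using ft_decay[OF v, of a 0] by auto
        show ?thesis
        proof (rule Bochner_Integration.integrable_bound)
          show "integrable lborel (\<lambda>t. B * norm (\<psi> t))"
            using int by simp
          have "norm (\<psi> t * ft a v (\<xi> + (t / \<rho>) *\<^sub>R ?e)) \<le> norm (B * norm (\<psi> t))" for t
            using mult_right_mono[OF order_trans[OF B abs_ge_self] norm_ge_zero[of "\<psi> t"]]
            by (simp add: norm_mult abs_mult mult.commute)
          then show "AE t in lborel. norm (\<psi> t * ft a v (\<xi> + (t / \<rho>) *\<^sub>R ?e)) \<le> norm (B * norm (\<psi> t))"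
            by blast
        qed measurable
      qed
      from integral_norm_bound_ennreal[OF this]
      have "ennreal (norm (LINT t|lborel. \<psi> t * ft a v (\<xi> + (t / \<rho>) *\<^sub>R ?e)))
          \<le> (\<integral>\<^sup>+t. ennreal (norm (\<psi> t) * ?h (\<xi> + (t / \<rho>) *\<^sub>R ?e)) \<partial>lborel)"
        by (simp add: norm_mult)
      ultimately show ?thesis
        using \<rho> by (simp add: ennreal_mult mult_left_mono)
    qed
    have h2: "ennreal ((?h' \<xi>)\<^sup>2) \<le> ennreal (\<rho>\<^sup>2 * K1) *
        (\<integral>\<^sup>+t. ennreal (norm (\<psi> t) * (?h (\<xi> + (t / \<rho>) *\<^sub>R ?e))\<^sup>2) \<partial>lborel)" for \<xi>
    proof -
      have "ennreal ((?h' \<xi>)\<^sup>2) = (ennreal (?h' \<xi>))\<^sup>2"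
        by (simp add: ennreal_power)
      also have "\<dots> \<le> (ennreal \<rho> * (\<integral>\<^sup>+t. ennreal (norm (\<psi> t) * ?h (\<xi> + (t / \<rho>) *\<^sub>R ?e)) \<partial>lborel))\<^sup>2"
        by (intro power_mono h') simp
      also have "\<dots> = ennreal (\<rho>\<^sup>2) * (\<integral>\<^sup>+t. ennreal (norm (\<psi> t) * ?h (\<xi> + (t / \<rho>) *\<^sub>R ?e)) \<partial>lborel)\<^sup>2"
        using \<rho> by (simp add: power_mult_distrib ennreal_power)
      also have "\<dots> \<le> ennreal (\<rho>\<^sup>2) * ((\<integral>\<^sup>+t. ennreal (norm (\<psi> t)) \<partial>lborel) *
          (\<integral>\<^sup>+t. ennreal (norm (\<psi> t) * (?h (\<xi> + (t / \<rho>) *\<^sub>R ?e))\<^sup>2) \<partial>lborel))"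
        by (intro mult_left_mono nn_integral_weighted_square_le) auto
      also have "\<dots> = ennreal (\<rho>\<^sup>2 * K1) * (\<integral>\<^sup>+t. ennreal (norm (\<psi> t) * (?h (\<xi> + (t / \<rho>) *\<^sub>R ?e))\<^sup>2) \<partial>lborel)"
        using K by (simp add: nK1 ennreal_mult mult_ac)
      finally show ?thesis .
    qed
    have "(\<integral>\<^sup>+\<xi>. ennreal (V \<xi> * (?h' \<xi>)\<^sup>2) \<partial>lborel) \<le> (\<integral>\<^sup>+\<xi>. ennreal (\<rho>\<^sup>2 * K1) *
        (\<integral>\<^sup>+t. ennreal (V \<xi>) * ennreal (norm (\<psi> t) * (?h (\<xi> + (t / \<rho>) *\<^sub>R ?e))\<^sup>2) \<partial>lborel) \<partial>lborel)"
    proof (intro nn_integral_mono)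
      fix \<xi>
      have "ennreal (V \<xi> * (?h' \<xi>)\<^sup>2) = ennreal (V \<xi>) * ennreal ((?h' \<xi>)\<^sup>2)"
        using V0 by (simp add: ennreal_mult)
      also have "\<dots> \<le> ennreal (V \<xi>) * (ennreal (\<rho>\<^sup>2 * K1) *
        (\<integral>\<^sup>+t. ennreal (norm (\<psi> t) * (?h (\<xi> + (t / \<rho>) *\<^sub>R ?e))\<^sup>2) \<partial>lborel))"
        by (intro mult_left_mono h2) simp
      also have "\<dots> = ennreal (\<rho>\<^sup>2 * K1) *
        (\<integral>\<^sup>+t. ennreal (V \<xi>) * ennreal (norm (\<psi> t) * (?h (\<xi> + (t / \<rho>) *\<^sub>R ?e))\<^sup>2) \<partial>lborel)"
        by (subst nn_integral_cmult) (measurable, simp add: mult_ac)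
      finally show "ennreal (V \<xi> * (?h' \<xi>)\<^sup>2) \<le> ennreal (\<rho>\<^sup>2 * K1) *
        (\<integral>\<^sup>+t. ennreal (V \<xi>) * ennreal (norm (\<psi> t) * (?h (\<xi> + (t / \<rho>) *\<^sub>R ?e))\<^sup>2) \<partial>lborel)" .
    qed
    also have "\<dots> = ennreal (\<rho>\<^sup>2 * K1) * (\<integral>\<^sup>+\<xi>. (\<integral>\<^sup>+t.
        ennreal (V \<xi>) * ennreal (norm (\<psi> t) * (?h (\<xi> + (t / \<rho>) *\<^sub>R ?e))\<^sup>2) \<partial>lborel) \<partial>lborel)"
      by (rule nn_integral_cmult) measurable
    also have "(\<integral>\<^sup>+\<xi>. (\<integral>\<^sup>+t. ennreal (V \<xi>) * ennreal (norm (\<psi> t) * (?h (\<xi> + (t / \<rho>) *\<^sub>R ?e))\<^sup>2) \<partial>lborel) \<partial>lborel)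
      = (\<integral>\<^sup>+t. (\<integral>\<^sup>+\<xi>. ennreal (V \<xi>) * ennreal (norm (\<psi> t) * (?h (\<xi> + (t / \<rho>) *\<^sub>R ?e))\<^sup>2) \<partial>lborel) \<partial>lborel)"
    proof -
      have "(\<lambda>(\<xi>, t). ennreal (V \<xi>) * ennreal (norm (\<psi> t) * (?h (\<xi> + (t / \<rho>) *\<^sub>R ?e))\<^sup>2)) \<in> borel_measurable (lborel \<Otimes>\<^sub>M lborel)"
        by measurable
      from lborel_pair.Fubini[OF this] show ?thesis
        by simp
    qed
    also have "\<dots> \<le> (\<integral>\<^sup>+t. ennreal c * ?I * ennreal (norm (\<psi> t) * (1 + \<bar>t\<bar>) ^ R) \<partial>lborel)"
    proof (intro nn_integral_mono)
      fix t :: real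
      let ?s = "(t / \<rho>) *\<^sub>R ?e"
      have "(\<integral>\<^sup>+\<xi>. ennreal (V \<xi>) * ennreal (norm (\<psi> t) * (?h (\<xi> + ?s))\<^sup>2) \<partial>lborel)
          \<le> (\<integral>\<^sup>+\<xi>. ennreal (c * norm (\<psi> t) * (1 + \<bar>t\<bar>) ^ R) * ennreal (V (?s + \<xi>) * (?h (?s + \<xi>))\<^sup>2) \<partial>lborel)"
      proof (intro nn_integral_mono)
        fix \<xi>
        have "V \<xi> * (norm (\<psi> t) * (?h (\<xi> + ?s))\<^sup>2) \<le> (c * (1 + \<bar>t\<bar>) ^ R * V (\<xi> + ?s)) * (norm (\<psi> t) * (?h (\<xi> + ?s))\<^sup>2)"
          by (intro mult_right_mono temp) simp
        also have "\<dots> = (c * norm (\<psi> t) * (1 + \<bar>t\<bar>) ^ R) * (V (?s + \<xi>) * (?h (?s + \<xi>))\<^sup>2)"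
          by (simp add: mult_ac add.commute)
        finally show "ennreal (V \<xi>) * ennreal (norm (\<psi> t) * (?h (\<xi> + ?s))\<^sup>2)
          \<le> ennreal (c * norm (\<psi> t) * (1 + \<bar>t\<bar>) ^ R) * ennreal (V (?s + \<xi>) * (?h (?s + \<xi>))\<^sup>2)"
          using V0 c by (simp add: ennreal_leI flip: ennreal_mult)
      qed
      also have "\<dots> = ennreal (c * norm (\<psi> t) * (1 + \<bar>t\<bar>) ^ R) * (\<integral>\<^sup>+\<xi>. ennreal (V (?s + \<xi>) * (?h (?s + \<xi>))\<^sup>2) \<partial>lborel)"
        by (rule nn_integral_cmult) measurable
      also have "(\<integral>\<^sup>+\<xi>. ennreal (V (?s + \<xi>) * (?h (?s + \<xi>))\<^sup>2) \<partial>lborel) = ?I"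
        by (rule nn_integral_lborel_translate) measurable
      also have "ennreal (c * norm (\<psi> t) * (1 + \<bar>t\<bar>) ^ R) * ?I = ennreal c * ?I * ennreal (norm (\<psi> t) * (1 + \<bar>t\<bar>) ^ R)"
        using c by (simp add: ennreal_mult mult_ac)
      finally show "(\<integral>\<^sup>+\<xi>. ennreal (V \<xi>) * ennreal (norm (\<psi> t) * (?h (\<xi> + ?s))\<^sup>2) \<partial>lborel)
        \<le> ennreal c * ?I * ennreal (norm (\<psi> t) * (1 + \<bar>t\<bar>) ^ R)" .
    qed
    also have "\<dots> = ennreal c * ?I * ennreal K2"
      by (subst nn_integral_cmult) (measurable, simp only: nK2)
    also have "ennreal (\<rho>\<^sup>2 * K1) * (ennreal c * ?I * ennreal K2) = ennreal (K1 * K2 * c * \<rho>\<^sup>2) * ?I"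
      using K c by (simp add: ennreal_mult mult_ac)
    finally show "(\<integral>\<^sup>+\<xi>. ennreal (V \<xi> * (?h' \<xi>)\<^sup>2) \<partial>lborel) \<le> ennreal (K1 * K2 * c * \<rho>\<^sup>2) * ?I"
      by (simp add: mult_left_mono)
  qed
qed

section \<open>Temperate weights\<close>

text \<open>Comparability in both directions makes one bound serve exponents of either sign.\<close>

lemma powr_le_powr_comparable:
  fixes x y :: real
  assumes "0 < x" "0 < y" "x \<le> c * y" "y \<le> c * x"
  shows "x powr r \<le> c powr \<bar>r\<bar> * y powr r"
proof -
  have c: "c > 0"
    using assms by (meson less_le_trans mult_pos_pos not_le zero_less_mult_pos2)
  show ?thesis
  proof (cases "r \<ge> 0")
    case True
    then have "x powr r \<le> (c * y) powr r"
      using assms by (intro powr_mono2) auto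
    then show ?thesis
      using True assms c by (simp add: powr_mult)
  next
    case False
    then have "y powr (- r) \<le> (c * x) powr (- r)"
      using assms by (intro powr_mono2) auto
    then have "y powr (- r) \<le> c powr \<bar>r\<bar> * x powr (- r)"
      using False assms c by (simp add: powr_mult)
    then show ?thesis
      using assms by (simp add: powr_minus field_simps)
  qed
qed

text \<open>Peetre's inequality in the variable \<open>\<rho> * \<xi>\<close>: there the base is
  \<open>1 + norm^2\<close> up to the factor \<open>1/\<rho>^2\<close>, and the translation has
  length \<open>\<bar>t\<bar>\<close>. The factor cancels, which leaves constants free of \<rho>.
  Natural exponents are used to match the Bernstein inequality.\<close>

lemma temperate_japanese:
  fixes \<xi> :: "real^'n::finite"
  assumes \<rho>: "\<rho> > 0" and N: "\<bar>r\<bar> \<le> real N"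
  shows "((1/\<rho>)\<^sup>2 + (norm \<xi>)\<^sup>2) powr r
    \<le> 2 ^ N * (1 + \<bar>t\<bar>) ^ (2 * N) * ((1/\<rho>)\<^sup>2 + (norm (\<xi> + (t / \<rho>) *\<^sub>R axis i 1))\<^sup>2) powr r"
proof -
  let ?\<eta> = "\<xi> + (t / \<rho>) *\<^sub>R axis i 1"
  let ?X = "\<lambda>\<xi>. (1/\<rho>)\<^sup>2 + (norm \<xi>)\<^sup>2"
  let ?c = "2 * (1 + \<bar>t\<bar>)\<^sup>2"
  have pos: "0 < ?X \<xi>" for \<xi> :: "real^'n"
    using \<rho> by (simp add: add_pos_nonneg)
  have *: "?X \<xi> \<le> ?c * ?X \<eta>" if "norm (\<xi> - \<eta>) = \<bar>t\<bar> / \<rho>" for \<xi> \<eta> :: "real^'n"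
  proof -
    have "norm \<xi> \<le> norm \<eta> + \<bar>t\<bar> / \<rho>"
      using norm_triangle_ineq[of \<eta> "\<xi> - \<eta>"] that by simp
    then have "(norm \<xi>)\<^sup>2 \<le> (norm \<eta> + \<bar>t\<bar> / \<rho>)\<^sup>2"
      by (intro power_mono) auto
    also have "\<dots> \<le> 2 * (norm \<eta>)\<^sup>2 + 2 * (\<bar>t\<bar> / \<rho>)\<^sup>2"
      using sum_squares_bound[of "norm \<eta>" "\<bar>t\<bar> / \<rho>"] by (simp add: power2_sum)
    also have "(\<bar>t\<bar> / \<rho>)\<^sup>2 = t\<^sup>2 * (1/\<rho>)\<^sup>2"
      by (simp add: power_divide)
    finally have "?X \<xi> \<le> (1 + 2 * t\<^sup>2) * (1/\<rho>)\<^sup>2 + 2 * (norm \<eta>)\<^sup>2"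
      by (simp add: algebra_simps)
    also have "\<dots> \<le> ?c * (1/\<rho>)\<^sup>2 + ?c * (norm \<eta>)\<^sup>2"
      by (intro add_mono mult_right_mono) (auto simp: power2_sum)
    finally show ?thesis
      by (simp only: distrib_left)
  qed
  have "?X \<xi> \<le> ?c * ?X ?\<eta>" "?X ?\<eta> \<le> ?c * ?X \<xi>"
    using \<rho> by (auto intro!: * simp: norm_axis_1)
  then have "?X \<xi> powr r \<le> ?c powr \<bar>r\<bar> * ?X ?\<eta> powr r"
    by (intro powr_le_powr_comparable pos)
  also have "\<dots> \<le> ?c ^ N * ?X ?\<eta> powr r"
  proof (intro mult_right_mono powr_le_power N)
    have "1 * 1 \<le> ?c"
      by (intro mult_mono) auto
    then show "1 \<le> ?c" by simp
  qed simp
  also have "?c ^ N = 2 ^ N * (1 + \<bar>t\<bar>) ^ (2 * N)"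
    by (simp add: power_mult_distrib power_mult)
  finally show ?thesis .
qed

lemma derivative_bound_along:
  fixes f :: "'a::real_normed_vector \<Rightarrow> complex"
  assumes d: "deriv_along e f f'" and b: "\<And>\<tau>. \<bar>\<tau>\<bar> \<le> \<bar>s\<bar> \<Longrightarrow> norm (f' (x + \<tau> *\<^sub>R e)) \<le> b"
  shows "norm (f (x + s *\<^sub>R e)) \<le> norm (f x) + b * \<bar>s\<bar>"
proof -
  have "norm (f (x + s *\<^sub>R e) - f (x + 0 *\<^sub>R e)) \<le> b * norm (s - 0)"
  proof (rule differentiable_bound[where S="{- \<bar>s\<bar>..\<bar>s\<bar>}" and f="\<lambda>\<tau>. f (x + \<tau> *\<^sub>R e)"
        and f'="\<lambda>\<tau> h. h *\<^sub>R f' (x + \<tau> *\<^sub>R e)"])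
    fix \<tau> assume "\<tau> \<in> {- \<bar>s\<bar>..\<bar>s\<bar>}"
    then show "((\<lambda>\<tau>. f (x + \<tau> *\<^sub>R e)) has_derivative (\<lambda>h. h *\<^sub>R f' (x + \<tau> *\<^sub>R e))) (at \<tau> within {- \<bar>s\<bar>..\<bar>s\<bar>})"
      "onorm (\<lambda>h. h *\<^sub>R f' (x + \<tau> *\<^sub>R e)) \<le> b"
      using deriv_alongD[OF d] b[of \<tau>] by (auto simp: has_vector_derivative_def onorm_scaleR_left onorm_id)
  qed (auto simp: abs_le_iff)
  then show ?thesis
    using norm_triangle_sub[of "f (x + s *\<^sub>R e)" "f x"] by simp
qed

text \<open>Replaces Taylor's formula. It is essential that the constants do not depend on \<open>\<rho>\<close>.\<close>

lemma temperate_derivatives: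
  fixes A :: "nat \<Rightarrow> real^'n::finite \<Rightarrow> complex"
  assumes \<rho>: "\<rho> > 0"
    and dA: "\<And>l. l < K \<Longrightarrow> deriv_along (axis i 1) (A l) (\<lambda>\<xi>. complex_of_real \<rho> * A (Suc l) \<xi>)"
    and AK: "\<And>\<xi>. norm (A K \<xi>) \<le> B \<xi>"
    and B: "\<And>\<xi> t. B \<xi> \<le> cB * (1 + \<bar>t\<bar>) ^ R * B (\<xi> + (t / \<rho>) *\<^sub>R axis i 1)"
    and cB: "1 \<le> cB" and l: "l \<le> K"
  shows "norm (A l \<xi>) \<le> cB * (1 + \<bar>t\<bar>) ^ (R + (K - l)) *
    ((\<Sum>j=l..<K. norm (A j (\<xi> + (t / \<rho>) *\<^sub>R axis i 1))) + B (\<xi> + (t / \<rho>) *\<^sub>R axis i 1))"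
  using l
\<comment> \<open>Downward from \<open>K\<close>, where the bound by the temperate function
  \<open>B\<close> starts the induction. Base point and translation vary, since the hypothesis is
  used at intermediate points.\<close>
proof (induction l arbitrary: \<xi> t rule: inc_induct)
  case base
  show ?case
    using order_trans[OF AK B] by simp
next
  case (step l)
  let ?e = "axis i 1 :: real^'n"
  let ?\<eta> = "\<xi> + (t / \<rho>) *\<^sub>R ?e"
  define S where "S l = (\<Sum>j=l..<K. norm (A j ?\<eta>)) + B ?\<eta>" for l
  have B0: "0 \<le> B ?\<eta>"
    using order_trans[OF norm_ge_zero AK] .
  then have S0: "0 \<le> S l" for l
    unfolding S_def by (intro add_nonneg_nonneg sum_nonneg) auto
  let ?b = "cB * (1 + \<bar>t\<bar>) ^ (R + (K - Suc l)) * S (Suc l)"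
  have b: "norm (complex_of_real \<rho> * A (Suc l) (?\<eta> + \<tau> *\<^sub>R ?e)) \<le> \<rho> * ?b" if \<tau>: "\<bar>\<tau>\<bar> \<le> \<bar>- (t / \<rho>)\<bar>" for \<tau>
  proof -
    \<comment> \<open>The next derivative, at a point between \<xi> and the translate, is compared
      with values at the translate. Scaled by \<rho>, the way back has length at most
      \<open>\<bar>t\<bar>\<close>.\<close>
    have eq: "?\<eta> + \<tau> *\<^sub>R ?e + ((- (\<rho> * \<tau>)) / \<rho>) *\<^sub>R ?e = ?\<eta>"
      using \<rho> by simp
    have "norm (A (Suc l) (?\<eta> + \<tau> *\<^sub>R ?e)) \<le> cB * (1 + \<bar>- (\<rho> * \<tau>)\<bar>) ^ (R + (K - Suc l)) * S (Suc l)"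
      using step.IH[of "?\<eta> + \<tau> *\<^sub>R ?e" "- (\<rho> * \<tau>)"] unfolding eq S_def by simp
    also have "\<dots> \<le> ?b"
    proof (intro mult_right_mono mult_left_mono power_mono)
      show "1 + \<bar>- (\<rho> * \<tau>)\<bar> \<le> 1 + \<bar>t\<bar>"
        using \<tau> \<rho> by (simp add: abs_mult field_simps)
    qed (use S0 cB in auto)
    finally show ?thesis
      using \<rho> by (simp add: norm_mult mult_left_mono)
  qed
  have "norm (A l (?\<eta> + (- (t / \<rho>)) *\<^sub>R ?e)) \<le> norm (A l ?\<eta>) + \<rho> * ?b * \<bar>- (t / \<rho>)\<bar>"
    by (rule derivative_bound_along[OF dA[OF step.hyps(2)] b])
  then have "norm (A l \<xi>) \<le> norm (A l ?\<eta>) + ?b * \<bar>t\<bar>"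
    using \<rho> by simp
  also have "\<dots> \<le> cB * (1 + \<bar>t\<bar>) ^ (R + (K - l)) * norm (A l ?\<eta>) + cB * (1 + \<bar>t\<bar>) ^ (R + (K - l)) * S (Suc l)"
  proof (rule add_mono)
    have "1 * 1 \<le> cB * (1 + \<bar>t\<bar>) ^ (R + (K - l))"
      using cB by (intro mult_mono one_le_power) auto
    then show "norm (A l ?\<eta>) \<le> cB * (1 + \<bar>t\<bar>) ^ (R + (K - l)) * norm (A l ?\<eta>)"
      using mult_right_mono[of 1 _ "norm (A l ?\<eta>)"] by simp
    \<comment> \<open>Integrating over a segment of length \<open>\<bar>t\<bar> / \<rho>\<close>
      costs one power of \<open>1 + \<bar>t\<bar>\<close>; the factor \<rho> in the derivative of
      \<open>A l\<close> cancels the denominator.\<close>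
    have "R + (K - l) = Suc (R + (K - Suc l))"
      using step.hyps by simp
    then have "cB * (1 + \<bar>t\<bar>) ^ (R + (K - l)) * S (Suc l) = ?b * (1 + \<bar>t\<bar>)"
      by (simp add: mult_ac)
    moreover have "?b * \<bar>t\<bar> \<le> ?b * (1 + \<bar>t\<bar>)"
      using cB S0 by (intro mult_left_mono mult_nonneg_nonneg) auto
    ultimately show "?b * \<bar>t\<bar> \<le> cB * (1 + \<bar>t\<bar>) ^ (R + (K - l)) * S (Suc l)"
      by (simp only:)
  qed
  also have "\<dots> = cB * (1 + \<bar>t\<bar>) ^ (R + (K - l)) * S l"
    using step.hyps unfolding S_def
    by (simp only: sum.atLeast_Suc_lessThan[of l K] distrib_left add.assoc)
  finally show ?case
    unfolding S_def .
qed

text \<open>Makes the tail of derivatives usable as a Bernstein weight. The tail may start at any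
  \<open>k\<close>, so that derivatives of order below \<open>k\<close> stay out of the estimate for
  order \<open>k\<close>; the downward induction relies on this. One factor
  \<open>real K + 1\<close> counts the terms on the left, the other comes from Cauchy-Schwarz on the
  right.\<close>

lemma temperate_sum_squares:
  fixes A :: "nat \<Rightarrow> real^'n::finite \<Rightarrow> complex"
  assumes \<rho>: "\<rho> > 0"
    and dA: "\<And>l. l < K \<Longrightarrow> deriv_along (axis i 1) (A l) (\<lambda>\<xi>. complex_of_real \<rho> * A (Suc l) \<xi>)"
    and AK: "\<And>\<xi>. norm (A K \<xi>) \<le> B \<xi>"
    and B: "\<And>\<xi> t. B \<xi> \<le> cB * (1 + \<bar>t\<bar>) ^ R * B (\<xi> + (t / \<rho>) *\<^sub>R axis i 1)"
    and cB: "1 \<le> cB" and k: "k \<le> K"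
  shows "(\<Sum>j=k..<K. (norm (A j \<xi>))\<^sup>2) + (B \<xi>)\<^sup>2 \<le> (real K + 1)\<^sup>2 * cB\<^sup>2 * (1 + \<bar>t\<bar>) ^ (2 * (R + K)) *
    ((\<Sum>j=k..<K. (norm (A j (\<xi> + (t / \<rho>) *\<^sub>R axis i 1)))\<^sup>2) + (B (\<xi> + (t / \<rho>) *\<^sub>R axis i 1))\<^sup>2)"
proof -
  let ?\<eta> = "\<xi> + (t / \<rho>) *\<^sub>R axis i 1"
  define S where "S = (\<Sum>j=k..<K. norm (A j ?\<eta>)) + B ?\<eta>"
  define q where "q = cB * (1 + \<bar>t\<bar>) ^ (R + K)"
  have q0: "0 \<le> q"
    using cB by (simp add: q_def)
  have B0: "0 \<le> B \<xi>" for \<xi>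
    using order_trans[OF norm_ge_zero AK] .
  have S0: "0 \<le> S"
    unfolding S_def by (intro add_nonneg_nonneg sum_nonneg B0) auto
  have Aj: "norm (A j \<xi>) \<le> q * S" if "j \<in> {k..<K}" for j
  proof -
    have "norm (A j \<xi>) \<le> cB * (1 + \<bar>t\<bar>) ^ (R + (K - j)) * ((\<Sum>j=j..<K. norm (A j ?\<eta>)) + B ?\<eta>)"
      using that by (intro temperate_derivatives[OF \<rho> dA AK B cB]) auto
    also have "\<dots> \<le> q * S"
      unfolding q_def S_def using that cB
      by (intro mult_mono mult_left_mono power_increasing add_right_mono sum_mono2) (auto intro!: add_nonneg_nonneg sum_nonneg B0)
    finally show ?thesis .
  qed
  have Bq: "B \<xi> \<le> q * S"
  proof -
    have "B \<xi> \<le> cB * (1 + \<bar>t\<bar>) ^ R * B ?\<eta>"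
      by (rule B)
    also have "\<dots> \<le> q * S"
      unfolding q_def S_def using cB
      by (intro mult_mono mult_left_mono power_increasing) (auto intro!: sum_nonneg B0)
    finally show ?thesis .
  qed
  have "(\<Sum>j=k..<K. (norm (A j \<xi>))\<^sup>2) + (B \<xi>)\<^sup>2 \<le> (\<Sum>j=k..<K. (q * S)\<^sup>2) + (q * S)\<^sup>2"
    by (intro add_mono sum_mono power_mono Aj Bq B0) auto
  also have "\<dots> \<le> (real K + 1) * (q * S)\<^sup>2"
    using k by (simp add: algebra_simps mult_right_mono)
  also have "(q * S)\<^sup>2 = q\<^sup>2 * S\<^sup>2"
    by (rule power_mult_distrib)
  also have "S\<^sup>2 \<le> (real K + 1) * ((\<Sum>j=k..<K. (norm (A j ?\<eta>))\<^sup>2) + (B ?\<eta>)\<^sup>2)"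
  proof -
    \<comment> \<open>Takes \<open>B\<close> as the \<open>K\<close>-th term, so that Cauchy-Schwarz
      applies to a single sum.\<close>
    let ?f = "\<lambda>j. if j = K then B ?\<eta> else norm (A j ?\<eta>)"
    have sum_eq: "(\<Sum>j=k..K. g (?f j)) = (\<Sum>j=k..<K. g (norm (A j ?\<eta>))) + g (B ?\<eta>)" for g :: "real \<Rightarrow> real"
      using k by (subst sum.last_plus) (auto simp: add.commute intro!: sum.cong)
    have "S\<^sup>2 = (\<Sum>j=k..K. ?f j)\<^sup>2"
      unfolding S_def using sum_eq[of "\<lambda>x. x"] by simp
    also have "\<dots> \<le> (\<Sum>j=k..K. (?f j)\<^sup>2) * real (card {k..K})"
      using Cauchy_Schwarz_ineq_sum[of ?f "\<lambda>_. 1" "{k..K}"] by simp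
    also have "\<dots> \<le> (\<Sum>j=k..K. (?f j)\<^sup>2) * (real K + 1)"
      by (intro mult_left_mono sum_nonneg) (auto simp: of_nat_diff)
    finally show ?thesis
      unfolding sum_eq[of "\<lambda>x. x\<^sup>2"] by (simp only: mult.commute)
  qed
  also have "(real K + 1) * (q\<^sup>2 * ((real K + 1) * ((\<Sum>j=k..<K. (norm (A j ?\<eta>))\<^sup>2) + (B ?\<eta>)\<^sup>2)))
      = (real K + 1)\<^sup>2 * cB\<^sup>2 * (1 + \<bar>t\<bar>) ^ (2 * (R + K)) * ((\<Sum>j=k..<K. (norm (A j ?\<eta>))\<^sup>2) + (B ?\<eta>)\<^sup>2)"
    unfolding q_def power_mult_distrib power_mult[symmetric] by (simp add: power2_eq_square mult_ac)
  finally show ?thesis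
    by (simp add: mult_left_mono)
qed

text \<open>Here \<open>\<alpha> k\<close> is the energy of the \<open>k\<close>-th scaled
  derivative and \<beta> that of the error. If the tail above \<open>k\<close> is already bounded by
  \<open>\<alpha> k + \<beta>\<close>, a large \<open>c\<close> makes its contribution at most half
  of \<open>\<alpha> k\<close>, which the left side absorbs. The price is a large multiple of
  \<open>\<alpha> (k - 1)\<close>, harmless because the next step treats that term. The induction
  ends at \<open>\<alpha> 0\<close>.\<close>

lemma downward_absorption:
  fixes D :: real
  assumes D: "D \<ge> 1" and K: "K \<ge> 1"
  obtains C :: real where "C \<ge> 0"
    "\<And>(\<alpha> :: nat \<Rightarrow> real) \<beta>. (\<And>k. 0 \<le> \<alpha> k) \<Longrightarrow> 0 \<le> \<beta> \<Longrightarrow> \<alpha> K \<le> \<beta> \<Longrightarrow>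
      (\<And>k c. 1 \<le> k \<Longrightarrow> k < K \<Longrightarrow> 0 < c \<Longrightarrow> \<alpha> k \<le> c * D * \<alpha> (k - 1) + D / c * ((\<Sum>l=k..<K. \<alpha> l) + \<beta>)) \<Longrightarrow>
      \<alpha> 1 \<le> C * (\<alpha> 0 + \<beta>)"
proof -
  \<comment> \<open>Bundles the hypotheses on \<alpha> and \<beta>, so that the induction can assert
    one constant for all such sequences.\<close>
  define H where "H \<alpha> \<beta> \<longleftrightarrow> (\<forall>k. 0 \<le> \<alpha> k) \<and> 0 \<le> \<beta> \<and> \<alpha> K \<le> \<beta> \<and> (\<forall>k c. 1 \<le> k \<longrightarrow> k < K \<longrightarrow> 0 < c \<longrightarrow>
      \<alpha> k \<le> c * D * \<alpha> (k - 1) + D / c * ((\<Sum>l=k..<K. \<alpha> l) + \<beta>))" for \<alpha> :: "nat \<Rightarrow> real" and \<beta>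
  have "1 \<le> k \<longrightarrow> (\<exists>C\<ge>0. \<forall>\<alpha> \<beta>. H \<alpha> \<beta> \<longrightarrow> (\<Sum>l=k..<K. \<alpha> l) \<le> C * (\<alpha> (k - 1) + \<beta>))" if "k \<le> K" for k
    using that
  proof (induction k rule: inc_induct)
    case base
    show ?case
      by (auto intro!: exI[of _ 0])
  next
    case (step k)
    show ?case
    proof
      assume k: "1 \<le> k"
      obtain C where C: "C \<ge> 0" "\<And>\<alpha> \<beta>. H \<alpha> \<beta> \<Longrightarrow> (\<Sum>l=Suc k..<K. \<alpha> l) \<le> C * (\<alpha> k + \<beta>)"
        using step.IH by auto
      define C' where "C' = (1 + C) * (4 * D\<^sup>2 * (1 + C)) + (1 + C) + C"
      have "(\<Sum>l=k..<K. \<alpha> l) \<le> C' * (\<alpha> (k - 1) + \<beta>)" if H: "H \<alpha> \<beta>" for \<alpha> \<beta>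
      proof -
        have nn: "0 \<le> \<alpha> l" "0 \<le> \<beta>" for l
          using H by (auto simp: H_def)
        have sum: "(\<Sum>l=k..<K. \<alpha> l) = \<alpha> k + (\<Sum>l=Suc k..<K. \<alpha> l)"
          using step.hyps by (simp add: sum.atLeast_Suc_lessThan)
        \<comment> \<open>Chosen so that \<open>D / c * (1 + C)\<close> equals 1/2.\<close>
        let ?c = "2 * D * (1 + C)"
        have c: "?c > 0"
          using C D by (intro mult_pos_pos) auto
        have "\<alpha> k \<le> ?c * D * \<alpha> (k - 1) + D / ?c * ((\<Sum>l=k..<K. \<alpha> l) + \<beta>)"
          using H k step.hyps c unfolding H_def by blast
        also have "D / ?c * ((\<Sum>l=k..<K. \<alpha> l) + \<beta>) \<le> D / ?c * ((1 + C) * (\<alpha> k + \<beta>))"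
          using C(2)[OF H] c D by (intro mult_left_mono) (auto simp: sum algebra_simps)
        also have "D / ?c * ((1 + C) * (\<alpha> k + \<beta>)) = (\<alpha> k + \<beta>) / 2"
        proof -
          have "1 + C \<noteq> 0" "D \<noteq> 0"
            using C D by auto
          then have "D / ?c * (1 + C) = 1 / 2"
            by (simp add: divide_eq_eq)
          then show ?thesis
            by (simp only: mult.assoc[symmetric])
        qed
        finally have a: "\<alpha> k \<le> 4 * D\<^sup>2 * (1 + C) * \<alpha> (k - 1) + \<beta>"
          by (simp add: power2_eq_square field_simps)
        have "(\<Sum>l=k..<K. \<alpha> l) \<le> (1 + C) * \<alpha> k + C * \<beta>"
          using C(2)[OF H] by (simp add: sum algebra_simps)
        also have "\<dots> \<le> (1 + C) * (4 * D\<^sup>2 * (1 + C) * \<alpha> (k - 1) + \<beta>) + C * \<beta>"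
          using a C by (intro add_right_mono mult_left_mono) auto
        also have "\<dots> = ((1 + C) * (4 * D\<^sup>2 * (1 + C))) * \<alpha> (k - 1) + ((1 + C) + C) * \<beta>"
          by (simp add: algebra_simps)
        also have "\<dots> \<le> C' * \<alpha> (k - 1) + C' * \<beta>"
        proof (rule add_mono; rule mult_right_mono)
          have "0 \<le> (1 + C) * (4 * D\<^sup>2 * (1 + C))"
            using C by simp
          then show "(1 + C) * (4 * D\<^sup>2 * (1 + C)) \<le> C'" "(1 + C) + C \<le> C'"
            unfolding C'_def using C by linarith+
        qed (use nn in auto)
        finally show ?thesis
          by (simp add: distrib_left)
      qed
      moreover have "C' \<ge> 0"
        unfolding C'_def using C by auto
      ultimately show "\<exists>C\<ge>0. \<forall>\<alpha> \<beta>. H \<alpha> \<beta> \<longrightarrow> (\<Sum>l=k..<K. \<alpha> l) \<le> C * (\<alpha> (k - 1) + \<beta>)"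
        by blast
    qed
  qed
  then obtain C where C: "C \<ge> 0" "\<And>\<alpha> \<beta>. H \<alpha> \<beta> \<Longrightarrow> (\<Sum>l=1..<K. \<alpha> l) \<le> C * (\<alpha> 0 + \<beta>)"
    using K by fastforce
  have "\<alpha> 1 \<le> (C + 1) * (\<alpha> 0 + \<beta>)" if H: "H \<alpha> \<beta>" for \<alpha> \<beta>
  \<comment> \<open>For \<open>K = 1\<close> the tail is empty and says nothing about
    \<open>\<alpha> 1\<close>, which is then bounded by \<beta>.\<close>
  proof (cases "K = 1")
    case True
    then show ?thesis
      using H C(1) by (simp add: H_def distrib_left distrib_right add_nonneg_nonneg add_increasing)
  next
    case False
    then have "\<alpha> 1 \<le> (\<Sum>l=1..<K. \<alpha> l)"
      using K H by (intro member_le_sum) (auto simp: H_def)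
    also have "\<dots> \<le> C * (\<alpha> 0 + \<beta>)"
      by (rule C(2)[OF H])
    also have "\<dots> \<le> (C + 1) * (\<alpha> 0 + \<beta>)"
      using H by (intro mult_right_mono) (auto simp: H_def)
    finally show ?thesis .
  qed
  then show ?thesis
    using C(1) by (intro that[of "C + 1"]) (auto simp: H_def)
qed

section \<open>Integration by parts in the energy\<close>

lemma energy_integrable:
  fixes p :: "real^'n::finite \<Rightarrow> real"
  assumes "continuous_on UNIV p" "poly_bounded p" "bump v"
  shows "integrable lborel (\<lambda>\<xi>. p \<xi> * (norm (ft a v \<xi>))\<^sup>2)"
proof (rule rapid_integrable)
  show "(\<lambda>\<xi>. p \<xi> * (norm (ft a v \<xi>))\<^sup>2) \<in> borel_measurable borel"
    by (intro borel_measurable_continuous_onI continuous_intros assms ft_continuous)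
  show "rapid (\<lambda>\<xi>. p \<xi> * (norm (ft a v \<xi>))\<^sup>2)"
    by (intro rapid_mult_poly_bounded rapid_norm_power2 rapid_ft assms)
qed

lemma young_weighted:
  fixes u v c :: real
  assumes "c > 0"
  shows "u * v \<le> c / 2 * u\<^sup>2 + 1 / (2 * c) * v\<^sup>2"
proof -
  have "0 \<le> (c * u - v)\<^sup>2 / (2 * c)"
    using assms by simp
  also have "\<dots> = c / 2 * u\<^sup>2 + 1 / (2 * c) * v\<^sup>2 - u * v"
    using assms by (simp add: power2_eq_square field_simps)
  finally show ?thesis
    by simp
qed

text \<open>The letters stand for the absolute values of \<open>A0\<close>, \<open>A1\<close>,
  \<open>A2\<close> (\<open>p\<close>, \<open>q\<close>, \<open>r\<close>), of the transform and its
  derivative (\<open>x\<close>, \<open>y\<close>), and of the weight and its derivative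
  (\<open>w\<close>, \<open>w'\<close>). Young's inequality puts \<open>c\<close> on the factor
  \<open>p * x\<close> and \<open>1 / c\<close> on its partner. Dividing \<open>y\<close> by \<rho>
  gives it the size of \<open>x\<close>. The constant 3/2 is 1 from the double cross term plus 1/2
  from the term with \<open>r\<close>.\<close>

lemma energy_pointwise:
  fixes c \<rho> w w' d p q r x y :: real
  assumes c: "c > 0" and \<rho>: "\<rho> > 0" and w: "0 \<le> w" and w': "w' \<le> d * \<rho> * w" and d: "0 \<le> d"
    and nn: "0 \<le> p" "0 \<le> q" "0 \<le> r" "0 \<le> x" "0 \<le> y"
  shows "p * (q * (w * (x * y + y * x) + w' * x\<^sup>2) + \<rho> * r * (w * x\<^sup>2)) \<le>
    \<rho> * ((c * (3 / 2 + d / 2)) * (w * p\<^sup>2 * x\<^sup>2) + 1 / (2 * c) * (w * r\<^sup>2 * x\<^sup>2)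
      + d / (2 * c) * (w * q\<^sup>2 * x\<^sup>2) + 1 / (c * \<rho>\<^sup>2) * (w * q\<^sup>2 * y\<^sup>2))"
proof -
  have "p * q * w' * x\<^sup>2 \<le> p * q * (d * \<rho> * w) * x\<^sup>2"
    using w' nn by (intro mult_right_mono mult_left_mono) auto
  then have "p * (q * (w * (x * y + y * x) + w' * x\<^sup>2) + \<rho> * r * (w * x\<^sup>2))
      \<le> p * (q * (w * (x * y + y * x) + (d * \<rho> * w) * x\<^sup>2) + \<rho> * r * (w * x\<^sup>2))"
    by (simp add: algebra_simps)
  also have "\<dots> = \<rho> * w * (2 * ((p * x) * (q * y / \<rho>)) + d * ((p * x) * (q * x)) + (p * x) * (r * x))"
    using \<rho> by (simp add: field_simps power2_eq_square)
  also have "\<dots> \<le> \<rho> * w * (2 * (c / 2 * (p * x)\<^sup>2 + 1 / (2 * c) * (q * y / \<rho>)\<^sup>2)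
      + d * (c / 2 * (p * x)\<^sup>2 + 1 / (2 * c) * (q * x)\<^sup>2) + (c / 2 * (p * x)\<^sup>2 + 1 / (2 * c) * (r * x)\<^sup>2))"
    using \<rho> w d by (intro mult_left_mono add_mono young_weighted[OF c]) auto
  also have "\<dots> = \<rho> * ((c * (3 / 2 + d / 2)) * (w * p\<^sup>2 * x\<^sup>2) + 1 / (2 * c) * (w * r\<^sup>2 * x\<^sup>2)
      + d / (2 * c) * (w * q\<^sup>2 * x\<^sup>2) + 1 / (c * \<rho>\<^sup>2) * (w * q\<^sup>2 * y\<^sup>2))"
    using \<rho> c by (simp add: field_simps power2_eq_square)
  finally show ?thesis .
qed

text \<open>As \<open>\<rho> * A1\<close> is the derivative of \<open>A0\<close>, the quantity
  \<open>\<rho> * E A1\<close> integrates this derivative against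
  \<open>cnj (A1) * W * |h|^2\<close>. Moving the derivative off \<open>A0\<close> leaves
  \<open>A0\<close> in every term and differentiates \<open>A1\<close>, \<open>W\<close> or
  \<open>h\<close>. The first two produce a factor \<rho>, and the third will by the Bernstein
  inequality, so that \<rho> cancels on both sides.\<close>

lemma energy_integration_by_parts:
  fixes A0 A1 A2 :: "real^'n::finite \<Rightarrow> complex" and W W' :: "real^'n \<Rightarrow> real"
    and a :: "real^'n"
  assumes v: "bump v" and \<rho>: "\<rho> > 0" and c: "c > 0" and d: "0 \<le> d"
    and W0: "\<And>\<xi>. 0 \<le> W \<xi>" and dW: "deriv_along (axis i 1) W W'"
    and W': "\<And>\<xi>. \<bar>W' \<xi>\<bar> \<le> d * \<rho> * W \<xi>"
    and contW: "continuous_on UNIV W" "continuous_on UNIV W'" and pbW: "poly_bounded W"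
    and dA0: "deriv_along (axis i 1) A0 (\<lambda>\<xi>. complex_of_real \<rho> * A1 \<xi>)"
    and dA1: "deriv_along (axis i 1) A1 (\<lambda>\<xi>. complex_of_real \<rho> * A2 \<xi>)"
    and contA: "continuous_on UNIV A0" "continuous_on UNIV A1" "continuous_on UNIV A2"
    and pbA: "poly_bounded A0" "poly_bounded A1" "poly_bounded A2"
  defines "E \<equiv> \<lambda>B. LINT \<xi>|lborel. W \<xi> * (norm (B \<xi> :: complex))\<^sup>2 * (norm (ft a v \<xi>))\<^sup>2"
  shows "E A1 \<le> c * (3 / 2 + d / 2) * E A0 + 1 / (2 * c) * E A2 + d / (2 * c) * E A1 + 1 / (c * \<rho>\<^sup>2) *
    (LINT \<xi>|lborel. W \<xi> * (norm (A1 \<xi>))\<^sup>2 * (norm (ft a (\<lambda>x. - \<i> * complex_of_real (x $ i - a $ i) * v x) \<xi>))\<^sup>2)"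
proof -
  let ?v' = "\<lambda>x. - \<i> * complex_of_real (x $ i - a $ i) * v x"
  define h where "h = ft a v"
  define h' where "h' = ft a ?v'"
  have v': "bump ?v'"
    unfolding mult.assoc by (intro bump_mult v C_infinity_coord C_infinity_const)
  have dh: "deriv_along (axis i 1) h h'"
    unfolding h_def h'_def by (rule ft_deriv_along[OF v])
  have conth: "continuous_on UNIV h" "continuous_on UNIV h'"
    unfolding h_def h'_def by (intro ft_continuous v v')+
  have conts: "continuous_on UNIV (\<lambda>\<xi>. W \<xi> * (norm (B \<xi>))\<^sup>2)" if "continuous_on UNIV B" for B :: "real^'n \<Rightarrow> complex"
    by (intro continuous_intros that contW)
  have pbs: "poly_bounded (\<lambda>\<xi>. W \<xi> * (norm (B \<xi>))\<^sup>2)" if "poly_bounded B" for B :: "real^'n \<Rightarrow> complex"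
    by (intro poly_bounded_mult poly_bounded_norm_power2 that pbW)
  have int: "integrable lborel (\<lambda>\<xi>. W \<xi> * (norm (B \<xi>))\<^sup>2 * (norm (h \<xi>))\<^sup>2)"
    "integrable lborel (\<lambda>\<xi>. W \<xi> * (norm (B \<xi>))\<^sup>2 * (norm (h' \<xi>))\<^sup>2)"
    if "continuous_on UNIV B" "poly_bounded B" for B :: "real^'n \<Rightarrow> complex"
    unfolding h_def h'_def by (intro energy_integrable v v' conts pbs that)+
  define P where "P \<xi> = (c * (3 / 2 + d / 2)) * (W \<xi> * (norm (A0 \<xi>))\<^sup>2 * (norm (h \<xi>))\<^sup>2)
      + 1 / (2 * c) * (W \<xi> * (norm (A2 \<xi>))\<^sup>2 * (norm (h \<xi>))\<^sup>2)
      + d / (2 * c) * (W \<xi> * (norm (A1 \<xi>))\<^sup>2 * (norm (h \<xi>))\<^sup>2)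
      + 1 / (c * \<rho>\<^sup>2) * (W \<xi> * (norm (A1 \<xi>))\<^sup>2 * (norm (h' \<xi>))\<^sup>2)" for \<xi>
  have intP: "integrable lborel P"
    unfolding P_def by (intro Bochner_Integration.integrable_add integrable_mult_right int contA pbA)
  \<comment> \<open>The derivative of \<open>cnj (A1) * W * |h|^2\<close>, that is, everything
    except the term in which \<open>A0\<close> is differentiated.\<close>
  define X where "X \<xi> = cnj (A1 \<xi>) * (complex_of_real (W \<xi>) * (h \<xi> * cnj (h' \<xi>) + h' \<xi> * cnj (h \<xi>))
      + complex_of_real (W' \<xi>) * (h \<xi> * cnj (h \<xi>)))
      + cnj (complex_of_real \<rho> * A2 \<xi>) * (complex_of_real (W \<xi>) * (h \<xi> * cnj (h \<xi>)))" for \<xi>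
  have boundX: "norm (A0 \<xi> * X \<xi>) \<le> \<rho> * P \<xi>" for \<xi>
  proof -
    have "norm (X \<xi>) \<le> norm (A1 \<xi>) * (W \<xi> * (norm (h \<xi>) * norm (h' \<xi>) + norm (h' \<xi>) * norm (h \<xi>))
        + \<bar>W' \<xi>\<bar> * (norm (h \<xi>))\<^sup>2) + \<rho> * norm (A2 \<xi>) * (W \<xi> * (norm (h \<xi>))\<^sup>2)"
    proof -
      have 1: "norm (h \<xi> * cnj (h' \<xi>) + h' \<xi> * cnj (h \<xi>)) \<le> norm (h \<xi>) * norm (h' \<xi>) + norm (h' \<xi>) * norm (h \<xi>)"
        by (rule norm_triangle_le) (simp add: norm_mult)
      have 2: "norm (complex_of_real (W \<xi>) * (h \<xi> * cnj (h' \<xi>) + h' \<xi> * cnj (h \<xi>)) + complex_of_real (W' \<xi>) * (h \<xi> * cnj (h \<xi>)))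
         \<le> W \<xi> * (norm (h \<xi>) * norm (h' \<xi>) + norm (h' \<xi>) * norm (h \<xi>)) + \<bar>W' \<xi>\<bar> * (norm (h \<xi>))\<^sup>2"
        using mult_left_mono[OF 1 W0[of \<xi>]] W0[of \<xi>]
        by (intro norm_triangle_mono) (simp_all add: norm_mult power2_eq_square)
      show ?thesis
        unfolding X_def using mult_left_mono[OF 2, of "norm (A1 \<xi>)"] W0[of \<xi>] \<rho>
        by (intro norm_triangle_mono) (simp_all add: norm_mult power2_eq_square)
    qed
    then have "norm (A0 \<xi> * X \<xi>) \<le> norm (A0 \<xi>) * (norm (A1 \<xi>) * (W \<xi> * (norm (h \<xi>) * norm (h' \<xi>) + norm (h' \<xi>) * norm (h \<xi>))
        + \<bar>W' \<xi>\<bar> * (norm (h \<xi>))\<^sup>2) + \<rho> * norm (A2 \<xi>) * (W \<xi> * (norm (h \<xi>))\<^sup>2))"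
      by (simp add: norm_mult mult_left_mono)
    also have "\<dots> \<le> \<rho> * P \<xi>"
      unfolding P_def by (rule energy_pointwise[OF c \<rho> W0 W' d]) auto
    finally show ?thesis .
  qed
  have contX: "continuous_on UNIV X"
    unfolding X_def by (intro continuous_intros contA contW conth)
  have intX: "integrable lborel (\<lambda>\<xi>. A0 \<xi> * X \<xi>)"
  proof (rule Bochner_Integration.integrable_bound)
    show "integrable lborel (\<lambda>\<xi>. \<rho> * P \<xi>)"
      using intP by simp
    have "(\<lambda>\<xi>. A0 \<xi> * X \<xi>) \<in> borel_measurable borel"
      by (intro borel_measurable_continuous_onI continuous_intros contA contX)
    then show "(\<lambda>\<xi>. A0 \<xi> * X \<xi>) \<in> borel_measurable lborel"
      by simp
    show "AE \<xi> in lborel. norm (A0 \<xi> * X \<xi>) \<le> norm (\<rho> * P \<xi>)"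
      unfolding real_norm_def by (intro AE_I2 order_trans[OF boundX abs_ge_self])
  qed
  have sq: "(complex_of_real \<rho> * A1 \<xi>) * (cnj (A1 \<xi>) * (complex_of_real (W \<xi>) * (h \<xi> * cnj (h \<xi>))))
      = complex_of_real (\<rho> * (W \<xi> * (norm (A1 \<xi>))\<^sup>2 * (norm (h \<xi>))\<^sup>2))" for \<xi>
    by (simp add: complex_norm_square algebra_simps del: of_real_power)
  have intS: "integrable lborel (\<lambda>\<xi>. complex_of_real (\<rho> * (W \<xi> * (norm (A1 \<xi>))\<^sup>2 * (norm (h \<xi>))\<^sup>2)))"
    unfolding complex_of_real_integrable_eq by (intro integrable_mult_right int contA pbA)
  have intF: "integrable lborel (\<lambda>\<xi>. A0 \<xi> * (cnj (A1 \<xi>) * (complex_of_real (W \<xi>) * (h \<xi> * cnj (h \<xi>)))))"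
  proof (rule rapid_integrable)
    show "(\<lambda>\<xi>. A0 \<xi> * (cnj (A1 \<xi>) * (complex_of_real (W \<xi>) * (h \<xi> * cnj (h \<xi>))))) \<in> borel_measurable borel"
      by (intro borel_measurable_continuous_onI continuous_intros contA contW conth)
    have "rapid h"
      unfolding h_def by (rule rapid_ft[OF v])
    have "rapid (\<lambda>\<xi>. cnj (h \<xi>))"
      by (rule rapid_bound[OF \<open>rapid h\<close>]) simp
    moreover have "poly_bounded (\<lambda>\<xi>. complex_of_real (W \<xi>))"
      by (rule poly_bounded_bound[OF pbW, of _ 1]) simp
    moreover have "poly_bounded (\<lambda>\<xi>. cnj (A1 \<xi>))"
      by (rule poly_bounded_bound[OF pbA(2), of _ 1]) simp
    ultimately show "rapid (\<lambda>\<xi>. A0 \<xi> * (cnj (A1 \<xi>) * (complex_of_real (W \<xi>) * (h \<xi> * cnj (h \<xi>)))))"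
      by (intro rapid_mult_poly_bounded[of A0] rapid_mult_poly_bounded[of "\<lambda>\<xi>. cnj (A1 \<xi>)"]
          rapid_mult_poly_bounded[of "\<lambda>\<xi>. complex_of_real (W \<xi>)"] rapid_mult_poly_bounded[of h]
          rapid_imp_poly_bounded[OF \<open>rapid h\<close>] pbA)
  qed
  have dF: "deriv_along (axis i 1) (\<lambda>\<xi>. A0 \<xi> * (cnj (A1 \<xi>) * (complex_of_real (W \<xi>) * (h \<xi> * cnj (h \<xi>)))))
      (\<lambda>\<xi>. A0 \<xi> * X \<xi> + (complex_of_real \<rho> * A1 \<xi>) * (cnj (A1 \<xi>) * (complex_of_real (W \<xi>) * (h \<xi> * cnj (h \<xi>)))))"
    unfolding X_def by (intro deriv_along_mult dA0 deriv_along_cnj dA1 deriv_along_of_real dW dh)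
  have "(LINT \<xi>|lborel. A0 \<xi> * X \<xi> + complex_of_real (\<rho> * (W \<xi> * (norm (A1 \<xi>))\<^sup>2 * (norm (h \<xi>))\<^sup>2))) = 0"
    by (rule integral_deriv_along_eq_0[OF dF[unfolded sq] intF Bochner_Integration.integrable_add[OF intX intS]])
      (intro continuous_intros contA contX contW conth)
  then have "(LINT \<xi>|lborel. A0 \<xi> * X \<xi>) + complex_of_real (\<rho> * E A1) = 0"
    unfolding Bochner_Integration.integral_add[OF intX intS] integral_complex_of_real integral_mult_right_zero
    by (simp only: E_def h_def)
  then have "complex_of_real (\<rho> * E A1) = - (LINT \<xi>|lborel. A0 \<xi> * X \<xi>)"
    by (simp add: add_eq_0_iff)
  then have "\<bar>\<rho> * E A1\<bar> = norm (LINT \<xi>|lborel. A0 \<xi> * X \<xi>)"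
    by (metis norm_minus_cancel norm_of_real)
  also have "\<dots> \<le> (LINT \<xi>|lborel. \<rho> * P \<xi>)"
    using intX intP boundX by (intro integral_norm_bound[THEN order_trans] integral_mono) auto
  also have "\<dots> = \<rho> * (LINT \<xi>|lborel. P \<xi>)"
    by simp
  finally have "E A1 \<le> (LINT \<xi>|lborel. P \<xi>)"
    using \<rho> by (simp add: abs_le_iff)
  also have "\<dots> = c * (3 / 2 + d / 2) * E A0 + 1 / (2 * c) * E A2 + d / (2 * c) * E A1 + 1 / (c * \<rho>\<^sup>2) *
    (LINT \<xi>|lborel. W \<xi> * (norm (A1 \<xi>))\<^sup>2 * (norm (h' \<xi>))\<^sup>2)"
    unfolding P_def E_def h_def[symmetric]
    by (simp only: Bochner_Integration.integral_add Bochner_Integration.integrable_add integrable_mult_right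
        integral_mult_right_zero int contA pbA)
  finally show ?thesis
    unfolding h'_def .
qed

text \<open>\<open>A l\<close> stands for the \<open>l\<close>-th derivative of the symbol divided by \<open>\<rho> ^ l\<close>. As \<open>C\<close> does not depend
  on \<open>\<rho>\<close>, the first derivative gains a factor \<open>\<rho>\<close>.\<close>

lemma first_derivative_estimate:
  assumes K: "K \<ge> 1" and d: "0 \<le> d" and cW: "1 \<le> cW" and cB: "1 \<le> cB"
  obtains C :: real where "C \<ge> 0"
    "\<And>(v :: real^'n::finite \<Rightarrow> complex) a i \<rho> W W' A B.
      bump v \<Longrightarrow> \<rho> > 0 \<Longrightarrow> (\<And>x. v x \<noteq> 0 \<Longrightarrow> \<bar>x $ i - a $ i\<bar> \<le> \<rho>) \<Longrightarrow>
      (\<And>\<xi>. 0 \<le> W \<xi>) \<Longrightarrow> deriv_along (axis i 1) W W' \<Longrightarrow> (\<And>\<xi>. \<bar>W' \<xi>\<bar> \<le> d * \<rho> * W \<xi>) \<Longrightarrow>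
      continuous_on UNIV W \<Longrightarrow> continuous_on UNIV W' \<Longrightarrow> poly_bounded W \<Longrightarrow>
      (\<And>\<xi> t. W \<xi> \<le> cW * (1 + \<bar>t\<bar>) ^ RW * W (\<xi> + (t / \<rho>) *\<^sub>R axis i 1)) \<Longrightarrow>
      (\<And>l. l < K \<Longrightarrow> deriv_along (axis i 1) (A l) (\<lambda>\<xi>. complex_of_real \<rho> * A (Suc l) \<xi>)) \<Longrightarrow>
      (\<And>l. continuous_on UNIV (A l)) \<Longrightarrow> (\<And>l. poly_bounded (A l)) \<Longrightarrow>
      (\<And>\<xi>. norm (A K \<xi>) \<le> B \<xi>) \<Longrightarrow> continuous_on UNIV B \<Longrightarrow> poly_bounded B \<Longrightarrow>
      (\<And>\<xi> t. B \<xi> \<le> cB * (1 + \<bar>t\<bar>) ^ RB * B (\<xi> + (t / \<rho>) *\<^sub>R axis i 1)) \<Longrightarrow>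
      (LINT \<xi>|lborel. W \<xi> * (norm (A 1 \<xi>))\<^sup>2 * (norm (ft a v \<xi>))\<^sup>2) \<le>
        C * ((LINT \<xi>|lborel. W \<xi> * (norm (A 0 \<xi>))\<^sup>2 * (norm (ft a v \<xi>))\<^sup>2)
          + (LINT \<xi>|lborel. W \<xi> * (B \<xi>)\<^sup>2 * (norm (ft a v \<xi>))\<^sup>2))"
proof -
  \<comment> \<open>Growth exponent of the Bernstein weight below: that of \<open>W\<close> plus
    that of the tail of squares. Fixing it here makes the Bernstein constant independent of \<rho>
    and of the weights.\<close>
  define RV where "RV = RW + 2 * (RB + K)"
  define cV where "cV = cW * ((real K + 1)\<^sup>2 * cB\<^sup>2)"
  have cV: "0 \<le> cV"
    unfolding cV_def using cW by simp
  obtain CB where CB: "CB \<ge> 0" and bernstein: "\<And>(v :: real^'n \<Rightarrow> complex) a i \<rho> V c.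
      bump v \<Longrightarrow> \<rho> > 0 \<Longrightarrow> (\<And>x. v x \<noteq> 0 \<Longrightarrow> \<bar>x $ i - a $ i\<bar> \<le> \<rho>) \<Longrightarrow>
      V \<in> borel_measurable borel \<Longrightarrow> (\<And>\<xi>. 0 \<le> V \<xi>) \<Longrightarrow> c \<ge> 0 \<Longrightarrow>
      (\<And>\<xi> t. V \<xi> \<le> c * (1 + \<bar>t\<bar>) ^ RV * V (\<xi> + (t / \<rho>) *\<^sub>R axis i 1)) \<Longrightarrow>
      (\<integral>\<^sup>+\<xi>. ennreal (V \<xi> * (norm (ft a (\<lambda>x. - \<i> * complex_of_real (x $ i - a $ i) * v x) \<xi>))\<^sup>2) \<partial>lborel)
        \<le> ennreal (CB * c * \<rho>\<^sup>2) * (\<integral>\<^sup>+\<xi>. ennreal (V \<xi> * (norm (ft a v \<xi>))\<^sup>2) \<partial>lborel)"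
    using weighted_bernstein[where R=RV and 'n='n] by blast
  define D where "D = 2 + d + CB * cV"
  have D: "1 \<le> D"
    unfolding D_def using d CB cV by simp
  obtain C :: real where C: "C \<ge> 0" and absorb: "\<And>(\<alpha> :: nat \<Rightarrow> real) \<beta>. (\<And>k. 0 \<le> \<alpha> k) \<Longrightarrow> 0 \<le> \<beta> \<Longrightarrow> \<alpha> K \<le> \<beta> \<Longrightarrow>
      (\<And>k c. 1 \<le> k \<Longrightarrow> k < K \<Longrightarrow> 0 < c \<Longrightarrow> \<alpha> k \<le> c * D * \<alpha> (k - 1) + D / c * ((\<Sum>l=k..<K. \<alpha> l) + \<beta>)) \<Longrightarrow>
      \<alpha> 1 \<le> C * (\<alpha> 0 + \<beta>)"
    using downward_absorption[OF D K] by blast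
  show ?thesis
  proof
    show "C \<ge> 0" by (rule C)
    fix v :: "real^'n \<Rightarrow> complex" and a :: "real^'n" and i :: 'n and \<rho> :: real
      and W W' :: "real^'n \<Rightarrow> real" and A :: "nat \<Rightarrow> real^'n \<Rightarrow> complex" and B :: "real^'n \<Rightarrow> real"
    assume v: "bump v" and \<rho>: "\<rho> > 0" and supp: "\<And>x. v x \<noteq> 0 \<Longrightarrow> \<bar>x $ i - a $ i\<bar> \<le> \<rho>"
      and W0: "\<And>\<xi>. 0 \<le> W \<xi>" and dW: "deriv_along (axis i 1) W W'" and W': "\<And>\<xi>. \<bar>W' \<xi>\<bar> \<le> d * \<rho> * W \<xi>"
      and contW: "continuous_on UNIV W" "continuous_on UNIV W'" and pbW: "poly_bounded W"
      and tempW: "\<And>\<xi> t. W \<xi> \<le> cW * (1 + \<bar>t\<bar>) ^ RW * W (\<xi> + (t / \<rho>) *\<^sub>R axis i 1)"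
      and dA: "\<And>l. l < K \<Longrightarrow> deriv_along (axis i 1) (A l) (\<lambda>\<xi>. complex_of_real \<rho> * A (Suc l) \<xi>)"
      and contA: "\<And>l. continuous_on UNIV (A l)" and pbA: "\<And>l. poly_bounded (A l)"
      and AK: "\<And>\<xi>. norm (A K \<xi>) \<le> B \<xi>" and contB: "continuous_on UNIV B" and pbB: "poly_bounded B"
      and tempB: "\<And>\<xi> t. B \<xi> \<le> cB * (1 + \<bar>t\<bar>) ^ RB * B (\<xi> + (t / \<rho>) *\<^sub>R axis i 1)"
    let ?e = "axis i 1 :: real^'n"
    let ?v' = "\<lambda>x. - \<i> * complex_of_real (x $ i - a $ i) * v x"
    have v': "bump ?v'"
      unfolding mult.assoc by (intro bump_mult v C_infinity_coord C_infinity_const)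
    define \<alpha> where "\<alpha> l = (LINT \<xi>|lborel. W \<xi> * (norm (A l \<xi>))\<^sup>2 * (norm (ft a v \<xi>))\<^sup>2)" for l
    define \<beta> where "\<beta> = (LINT \<xi>|lborel. W \<xi> * (B \<xi>)\<^sup>2 * (norm (ft a v \<xi>))\<^sup>2)"
    have pbB2: "poly_bounded (\<lambda>\<xi>. (B \<xi>)\<^sup>2)"
      using poly_bounded_mult[OF pbB pbB] by (simp add: power2_eq_square)
    have contWA: "continuous_on UNIV (\<lambda>\<xi>. W \<xi> * (norm (A l \<xi>))\<^sup>2)" for l
      by (intro continuous_intros contW contA)
    have pbWA: "poly_bounded (\<lambda>\<xi>. W \<xi> * (norm (A l \<xi>))\<^sup>2)" for l
      by (intro poly_bounded_mult poly_bounded_norm_power2 pbW pbA)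
    have contWB: "continuous_on UNIV (\<lambda>\<xi>. W \<xi> * (B \<xi>)\<^sup>2)"
      by (intro continuous_intros contW contB)
    have pbWB: "poly_bounded (\<lambda>\<xi>. W \<xi> * (B \<xi>)\<^sup>2)"
      by (intro poly_bounded_mult pbB2 pbW)
    have intA: "integrable lborel (\<lambda>\<xi>. W \<xi> * (norm (A l \<xi>))\<^sup>2 * (norm (ft a w \<xi>))\<^sup>2)" if "bump w" for l w
      by (intro energy_integrable contWA pbWA that)
    have intB: "integrable lborel (\<lambda>\<xi>. W \<xi> * (B \<xi>)\<^sup>2 * (norm (ft a w \<xi>))\<^sup>2)" if "bump w" for w
      by (intro energy_integrable contWB pbWB that)
    have \<alpha>0: "0 \<le> \<alpha> l" for l
      unfolding \<alpha>_def using W0 by simp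
    have \<beta>0: "0 \<le> \<beta>"
      unfolding \<beta>_def using W0 by simp
    have "\<alpha> K \<le> \<beta>"
      unfolding \<alpha>_def \<beta>_def using W0 AK
      by (intro integral_mono intA intB v mult_right_mono mult_left_mono power_mono) auto
    have step: "\<alpha> k \<le> c * D * \<alpha> (k - 1) + D / c * ((\<Sum>l=k..<K. \<alpha> l) + \<beta>)"
      if k: "1 \<le> k" "k < K" and c: "0 < c" for k c
    proof -
      define T where "T = (\<Sum>l=k..<K. \<alpha> l) + \<beta>"
      \<comment> \<open>The Bernstein weight for step \<open>k\<close>. Its energy is
        \<open>T\<close>, exactly the tail in the absorption hypothesis.\<close>
      define V where "V \<xi> = W \<xi> * ((\<Sum>l=k..<K. (norm (A l \<xi>))\<^sup>2) + (B \<xi>)\<^sup>2)" for \<xi>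
      have V_eq: "V \<xi> * x = (\<Sum>l=k..<K. W \<xi> * (norm (A l \<xi>))\<^sup>2 * x) + W \<xi> * (B \<xi>)\<^sup>2 * x" for \<xi> x
        unfolding V_def by (simp add: distrib_left distrib_right sum_distrib_left sum_distrib_right mult_ac)
      have V0: "0 \<le> V \<xi>" for \<xi>
        unfolding V_def by (intro mult_nonneg_nonneg add_nonneg_nonneg sum_nonneg W0) auto
      have "continuous_on UNIV V"
        unfolding V_def by (intro continuous_intros contW contA contB)
      then have Vm: "V \<in> borel_measurable borel"
        by (rule borel_measurable_continuous_onI)
      have tempV: "V \<xi> \<le> cV * (1 + \<bar>t\<bar>) ^ RV * V (\<xi> + (t / \<rho>) *\<^sub>R ?e)" for \<xi> t
      proof -
        have "V \<xi> \<le> (cW * (1 + \<bar>t\<bar>) ^ RW * W (\<xi> + (t / \<rho>) *\<^sub>R ?e)) *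
            ((real K + 1)\<^sup>2 * cB\<^sup>2 * (1 + \<bar>t\<bar>) ^ (2 * (RB + K)) *
            ((\<Sum>j=k..<K. (norm (A j (\<xi> + (t / \<rho>) *\<^sub>R ?e)))\<^sup>2) + (B (\<xi> + (t / \<rho>) *\<^sub>R ?e))\<^sup>2))"
          unfolding V_def
        proof (rule mult_mono[OF tempW temperate_sum_squares[OF \<rho> dA AK tempB cB]])
          show "0 \<le> cW * (1 + \<bar>t\<bar>) ^ RW * W (\<xi> + (t / \<rho>) *\<^sub>R ?e)"
            using cW W0 by simp
        qed (use k in \<open>auto intro!: add_nonneg_nonneg sum_nonneg\<close>)
        also have "\<dots> = cV * (1 + \<bar>t\<bar>) ^ RV * V (\<xi> + (t / \<rho>) *\<^sub>R ?e)"
          unfolding V_def cV_def RV_def power_add by (simp only: mult_ac)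
        finally show ?thesis .
      qed
      have intV: "integrable lborel (\<lambda>\<xi>. V \<xi> * (norm (ft a w \<xi>))\<^sup>2)" if "bump w" for w
        unfolding V_eq by (intro Bochner_Integration.integrable_add Bochner_Integration.integrable_sum intA intB that)
      have IV: "(LINT \<xi>|lborel. V \<xi> * (norm (ft a v \<xi>))\<^sup>2) = T"
        unfolding V_eq T_def \<alpha>_def \<beta>_def using intA[OF v] intB[OF v] by simp
      have "ennreal (LINT \<xi>|lborel. V \<xi> * (norm (ft a ?v' \<xi>))\<^sup>2) \<le> ennreal (CB * cV * \<rho>\<^sup>2) * ennreal T"
        using bernstein[OF v \<rho> supp Vm V0 cV tempV] IV intV[OF v] intV[OF v'] V0
        by (simp add: nn_integral_eq_integral)
      then have bern: "(LINT \<xi>|lborel. V \<xi> * (norm (ft a ?v' \<xi>))\<^sup>2) \<le> CB * cV * \<rho>\<^sup>2 * T"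
      proof -
        assume *: "ennreal (LINT \<xi>|lborel. V \<xi> * (norm (ft a ?v' \<xi>))\<^sup>2) \<le> ennreal (CB * cV * \<rho>\<^sup>2) * ennreal T"
        have T0: "0 \<le> T"
          unfolding T_def by (intro add_nonneg_nonneg sum_nonneg \<alpha>0 \<beta>0)
        have "0 \<le> CB * cV * \<rho>\<^sup>2"
          using CB cV by simp
        with * T0 show ?thesis
          by (simp add: mult_nonneg_nonneg flip: ennreal_mult)
      qed
      \<comment> \<open>The integral left by the integration by parts has a weight that need not be
        temperate. It is one summand of \<open>V\<close>, for which the Bernstein inequality is
        available.\<close>
      have "(LINT \<xi>|lborel. W \<xi> * (norm (A k \<xi>))\<^sup>2 * (norm (ft a ?v' \<xi>))\<^sup>2) \<le> (LINT \<xi>|lborel. V \<xi> * (norm (ft a ?v' \<xi>))\<^sup>2)"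
      proof (intro integral_mono intA intV v' mult_right_mono)
        fix \<xi>
        have "(norm (A k \<xi>))\<^sup>2 \<le> (\<Sum>l=k..<K. (norm (A l \<xi>))\<^sup>2)"
          using k by (intro member_le_sum) auto
        then show "W \<xi> * (norm (A k \<xi>))\<^sup>2 \<le> V \<xi>"
          unfolding V_def using W0 by (intro mult_left_mono) (auto intro: add_increasing2)
      qed simp
      then have 3: "1 / (c * \<rho>\<^sup>2) * (LINT \<xi>|lborel. W \<xi> * (norm (A k \<xi>))\<^sup>2 * (norm (ft a ?v' \<xi>))\<^sup>2) \<le> 1 / (c * \<rho>\<^sup>2) * (CB * cV * \<rho>\<^sup>2 * T)"
        using bern c by (intro mult_left_mono) auto
      \<comment> \<open>The factor \<open>\<rho>^2\<close> of the Bernstein inequality cancels the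
        denominator; this is why the final constant is uniform in \<rho>.\<close>
      have 4: "1 / (c * \<rho>\<^sup>2) * (CB * cV * \<rho>\<^sup>2 * T) = CB * cV / c * T"
        using \<rho> by simp
      have "\<alpha> k \<le> (\<Sum>l=k..<K. \<alpha> l)"
        using k \<alpha>0 by (intro member_le_sum) auto
      then have k0: "\<alpha> k \<le> T"
        using \<beta>0 by (simp add: T_def)
      \<comment> \<open>At the top, \<open>Suc k = K\<close> lies outside the sum, and the term is
        bounded by \<beta> instead.\<close>
      have k1: "\<alpha> (Suc k) \<le> T"
      proof (cases "Suc k = K")
        case True
        then show ?thesis
          using \<open>\<alpha> K \<le> \<beta>\<close> \<alpha>0 by (simp add: T_def sum_nonneg add_increasing)
      next
        case False
        then have "\<alpha> (Suc k) \<le> (\<Sum>l=k..<K. \<alpha> l)"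
          using k \<alpha>0 by (intro member_le_sum) auto
        then show ?thesis
          using \<beta>0 by (simp add: T_def)
      qed
      have dA': "deriv_along ?e (A (k - 1)) (\<lambda>\<xi>. complex_of_real \<rho> * A k \<xi>)"
        using dA[of "k - 1"] k by simp
      have "\<alpha> k \<le> c * (3 / 2 + d / 2) * \<alpha> (k - 1) + 1 / (2 * c) * \<alpha> (Suc k) + d / (2 * c) * \<alpha> k + 1 / (c * \<rho>\<^sup>2) *
          (LINT \<xi>|lborel. W \<xi> * (norm (A k \<xi>))\<^sup>2 * (norm (ft a ?v' \<xi>))\<^sup>2)"
        unfolding \<alpha>_def
        by (rule energy_integration_by_parts[OF v \<rho> c d W0 dW W' contW pbW dA' dA[OF k(2)] contA contA contA pbA pbA pbA])
      also have "\<dots> \<le> c * D * \<alpha> (k - 1) + 1 / (2 * c) * T + d / (2 * c) * T + CB * cV / c * T"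
      proof (intro add_mono mult_left_mono mult_right_mono)
        show "3 / 2 + d / 2 \<le> D"
          unfolding D_def using d CB cV by (simp add: add_increasing2)
        show "1 / (c * \<rho>\<^sup>2) * (LINT \<xi>|lborel. W \<xi> * (norm (A k \<xi>))\<^sup>2 * (norm (ft a ?v' \<xi>))\<^sup>2) \<le> CB * cV / c * T"
          using 3 unfolding 4 .
      qed (use c d \<alpha>0 k0 k1 in auto)
      also have "\<dots> = c * D * \<alpha> (k - 1) + (1 / 2 + d / 2 + CB * cV) / c * T"
        using c by (simp add: field_simps)
      also have "\<dots> \<le> c * D * \<alpha> (k - 1) + D / c * T"
      proof (intro add_left_mono mult_right_mono divide_right_mono)
        show "1 / 2 + d / 2 + CB * cV \<le> D"
          unfolding D_def using d by simp
        show "0 \<le> T"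
          using k0 \<alpha>0[of k] by simp
      qed (use c in auto)
      finally show ?thesis
        unfolding T_def .
    qed
    show "(LINT \<xi>|lborel. W \<xi> * (norm (A 1 \<xi>))\<^sup>2 * (norm (ft a v \<xi>))\<^sup>2) \<le>
        C * ((LINT \<xi>|lborel. W \<xi> * (norm (A 0 \<xi>))\<^sup>2 * (norm (ft a v \<xi>))\<^sup>2)
          + (LINT \<xi>|lborel. W \<xi> * (B \<xi>)\<^sup>2 * (norm (ft a v \<xi>))\<^sup>2))"
      using absorb[of \<alpha> \<beta>, OF \<alpha>0 \<beta>0 \<open>\<alpha> K \<le> \<beta>\<close> step] unfolding \<alpha>_def \<beta>_def by simp
  qed
qed

section \<open>The energy estimate for symbols\<close>

text \<open>The square of the Sobolev norm of \<open>pseudo_diff Q v\<close>, up to the factor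
  \<open>(2 * pi) ^ (2 * CARD('n))\<close>, for symbols \<open>Q\<close> and bumps
  \<open>v\<close>.\<close>

definition energy :: "real \<Rightarrow> (real^'n::finite \<Rightarrow> complex) \<Rightarrow> (real^'n \<Rightarrow> complex) \<Rightarrow> real" where
  "energy s Q v = (LINT \<xi>|lborel. (1 + (norm \<xi>)\<^sup>2) powr s * (norm (Q \<xi>))\<^sup>2 * (norm (ft 0 v \<xi>))\<^sup>2)"

lemma continuous_on_japanese:
  assumes "l > 0"
  shows "continuous_on S (\<lambda>\<xi>::real^'n::finite. (l\<^sup>2 + (norm \<xi>)\<^sup>2) powr r)"
proof -
  have "l\<^sup>2 + (norm \<xi>)\<^sup>2 \<noteq> 0" for \<xi> :: "real^'n"
    using assms by (simp add: add_nonneg_eq_0_iff)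
  then show ?thesis
    by (intro continuous_intros) auto
qed

lemma poly_bounded_japanese:
  assumes "l \<ge> 1"
  shows "poly_bounded (\<lambda>\<xi>::real^'n::finite. (l\<^sup>2 + (norm \<xi>)\<^sup>2) powr r)"
proof -
  obtain k where k: "r \<le> real k"
    using real_arch_simple by blast
  have "norm ((l\<^sup>2 + (norm \<xi>)\<^sup>2) powr r) \<le> (l\<^sup>2) ^ k * (1 + norm \<xi>) ^ (2 * k)" for \<xi> :: "real^'n"
  proof -
    have l: "1 \<le> l\<^sup>2"
      using assms by simp
    have "(l\<^sup>2 + (norm \<xi>)\<^sup>2) powr r \<le> (l\<^sup>2 + (norm \<xi>)\<^sup>2) ^ k"
      by (rule powr_le_power[OF _ k]) (use l in \<open>simp add: add_increasing2\<close>)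
    also have "\<dots> \<le> (l\<^sup>2 * (1 + norm \<xi>)\<^sup>2) ^ k"
    proof (rule power_mono)
      have "(norm \<xi>)\<^sup>2 \<le> l\<^sup>2 * (norm \<xi>)\<^sup>2"
        using mult_right_mono[OF l, of "(norm \<xi>)\<^sup>2"] by simp
      then show "l\<^sup>2 + (norm \<xi>)\<^sup>2 \<le> l\<^sup>2 * (1 + norm \<xi>)\<^sup>2"
        by (simp add: power2_sum distrib_left add_increasing2)
    qed simp
    finally show ?thesis
      by (simp add: power_mult_distrib power_mult)
  qed
  then show ?thesis
    unfolding poly_bounded_def by (intro exI[of _ "(l\<^sup>2) ^ k"]) auto
qed

lemma deriv_along_japanese:
  assumes "l > 0"
  shows "deriv_along (axis i 1) (\<lambda>\<xi>::real^'n::finite. (l\<^sup>2 + (norm \<xi>)\<^sup>2) powr s)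
    (\<lambda>\<xi>. s * (l\<^sup>2 + (norm \<xi>)\<^sup>2) powr (s - 1) * (2 * \<xi> $ i))"
  unfolding deriv_along_def
proof (intro allI)
  fix x :: "real^'n" and t :: real
  have eq: "(norm (x + t *\<^sub>R axis i 1))\<^sup>2 = (norm x)\<^sup>2 + 2 * t * x $ i + t\<^sup>2" for t
    unfolding power2_norm_eq_inner
    by (simp add: inner_add_left inner_add_right inner_axis inner_axis' power2_eq_square algebra_simps)
  have pos: "l\<^sup>2 + ((norm x)\<^sup>2 + 2 * t * x $ i + t\<^sup>2) > 0"
    unfolding eq[symmetric] using assms by (simp add: add_pos_nonneg)
  have "((\<lambda>t. (l\<^sup>2 + ((norm x)\<^sup>2 + 2 * t * x $ i + t\<^sup>2)) powr s) has_real_derivative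
      s * (l\<^sup>2 + ((norm x)\<^sup>2 + 2 * t * x $ i + t\<^sup>2)) powr (s - of_nat 1) * (2 * x $ i + 2 * t)) (at t)"
    by (rule DERIV_fun_powr[where g="\<lambda>t. l\<^sup>2 + ((norm x)\<^sup>2 + 2 * t * x $ i + t\<^sup>2)", OF _ pos]) (auto intro!: derivative_eq_intros)
  then show "((\<lambda>t. (l\<^sup>2 + (norm (x + t *\<^sub>R axis i 1))\<^sup>2) powr s) has_vector_derivative
      s * (l\<^sup>2 + (norm (x + t *\<^sub>R axis i 1))\<^sup>2) powr (s - 1) * (2 * (x + t *\<^sub>R axis i 1) $ i)) (at t)"
    unfolding eq has_real_derivative_iff_has_vector_derivative[symmetric] by simp
qed

text \<open>By the inequality of arithmetic and geometric means
  \<open>2 * |\<xi> $ i| / \<rho>\<close> is at most the base of the power. A derivative of the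
  modified weight thus costs a factor \<rho>.\<close>

lemma deriv_japanese_bound:
  fixes \<xi> :: "real^'n::finite"
  assumes \<rho>: "\<rho> > 0"
  shows "\<bar>s * ((1/\<rho>)\<^sup>2 + (norm \<xi>)\<^sup>2) powr (s - 1) * (2 * \<xi> $ i)\<bar> \<le> \<bar>s\<bar> * \<rho> * ((1/\<rho>)\<^sup>2 + (norm \<xi>)\<^sup>2) powr s"
proof -
  define X where "X = (1/\<rho>)\<^sup>2 + (norm \<xi>)\<^sup>2"
  have X: "X > 0"
    unfolding X_def using \<rho> by (simp add: add_pos_nonneg)
  have "2 * (1/\<rho>) * \<bar>\<xi> $ i\<bar> \<le> (1/\<rho>)\<^sup>2 + \<bar>\<xi> $ i\<bar>\<^sup>2"
    by (rule sum_squares_bound)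
  also have "\<dots> \<le> X"
    unfolding X_def by (intro add_left_mono power_mono component_le_norm_cart) auto
  finally have "2 * \<bar>\<xi> $ i\<bar> \<le> \<rho> * X"
    using \<rho> by (simp add: field_simps)
  then have "\<bar>s\<bar> * X powr (s - 1) * (2 * \<bar>\<xi> $ i\<bar>) \<le> \<bar>s\<bar> * X powr (s - 1) * (\<rho> * X)"
    by (intro mult_left_mono) auto
  also have "\<dots> = \<bar>s\<bar> * \<rho> * (X powr (s - 1) * X powr 1)"
    using X by simp
  also have "X powr (s - 1) * X powr 1 = X powr s"
    unfolding powr_add[symmetric] by simp
  finally show ?thesis
    unfolding X_def by (simp add: abs_mult)
qed

text \<open>On the compact ball of radius \<open>l\<close> every continuous function is dominated by
  the error weight, whatever its order \<open>r\<close>. The constant depends on \<open>l\<close>,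
  hence on \<rho>, and is therefore allowed only in front of the error norm.\<close>

lemma low_frequency_bound:
  fixes f :: "real^'n::finite \<Rightarrow> real"
  assumes "continuous_on UNIV f"
  obtains c where "c \<ge> 0" "\<And>\<xi>. norm \<xi> \<le> l \<Longrightarrow> f \<xi> \<le> c * (1 + (norm \<xi>)\<^sup>2) powr r"
proof -
  let ?g = "\<lambda>\<xi>::real^'n. (1\<^sup>2 + (norm \<xi>)\<^sup>2) powr (- r)"
  have "compact ((\<lambda>\<xi>. f \<xi> * ?g \<xi>) ` cball 0 l)"
    by (intro compact_continuous_image continuous_intros continuous_on_japanese continuous_on_subset[OF assms]) auto
  then have "bounded ((\<lambda>\<xi>. f \<xi> * ?g \<xi>) ` cball 0 l)"
    by (rule compact_imp_bounded)
  then obtain b where "\<forall>y\<in>(\<lambda>\<xi>. f \<xi> * ?g \<xi>) ` cball 0 l. norm y \<le> b"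
    unfolding bounded_iff by blast
  then have b: "\<bar>f \<xi> * ?g \<xi>\<bar> \<le> b" if "norm \<xi> \<le> l" for \<xi>
    using that by auto
  have "f \<xi> \<le> max b 0 * (1 + (norm \<xi>)\<^sup>2) powr r" if "norm \<xi> \<le> l" for \<xi>
  proof -
    have pos: "0 < 1 + (norm \<xi>)\<^sup>2"
      by (simp add: add_pos_nonneg)
    have "f \<xi> * ?g \<xi> \<le> max b 0"
      using b[OF that] by auto
    then have "(f \<xi> * ?g \<xi>) * (1 + (norm \<xi>)\<^sup>2) powr r \<le> max b 0 * (1 + (norm \<xi>)\<^sup>2) powr r"
      by (rule mult_right_mono) simp
    moreover have "?g \<xi> * (1 + (norm \<xi>)\<^sup>2) powr r = 1"
      using pos by (simp add: powr_minus)
    ultimately show ?thesis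
      by (simp add: mult.assoc)
  qed
  then show ?thesis
    using that[of "max b 0"] by simp
qed

text \<open>The constants are chosen in the order \<open>K\<close>, \<open>C\<close>, \<rho>, and
  only then those of the error term. \<open>C\<close> depends on the orders but not on \<rho>, so
  the factor \<open>\<rho>^2\<close> gained by the first derivative can be made small against
  it.\<close>

lemma energy_partial_deriv_le:
  fixes Q :: "real^'n::finite \<Rightarrow> complex"
  assumes Q: "symbol m Q" and \<delta>: "\<delta> > 0"
  obtains \<rho> c where "\<rho> > 0" "c \<ge> 0"
    "\<And>v a. bump v \<Longrightarrow> (\<And>x. v x \<noteq> 0 \<Longrightarrow> \<bar>x $ i - a $ i\<bar> \<le> \<rho>) \<Longrightarrow>
      energy s (partial_deriv i Q) v \<le> \<delta> * energy s Q v + c * energy r (\<lambda>_. 1) v"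
proof -
  obtain K0 where K0: "s + m - r \<le> real K0"
    using real_arch_simple by blast
  \<comment> \<open>With \<open>K\<close> derivatives the order \<open>s + m - K\<close> is at most
    \<open>r\<close>, so that \<open>B\<close> contributes to the error only. The successor ensures
    \<open>K \<ge> 1\<close>.\<close>
  define K where "K = Suc K0"
  have K: "K \<ge> 1" "s + m - r \<le> real K"
    using K0 by (auto simp: K_def)
  obtain Ns where Ns: "\<bar>s\<bar> \<le> real Ns"
    using real_arch_simple by blast
  \<comment> \<open>Halved because the base of the weight is quadratic in \<xi>.\<close>
  define q where "q = (m - real K) / 2"
  obtain Nq where Nq: "\<bar>q\<bar> \<le> real Nq"
    using real_arch_simple by blast
  have pow2: "(1::real) \<le> 2 ^ Ns" "(1::real) \<le> 2 ^ Nq"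
    by simp_all
  obtain C :: real where C: "C \<ge> 0" and main: "\<And>(v :: real^'n \<Rightarrow> complex) a i \<rho> W W' A B.
      bump v \<Longrightarrow> \<rho> > 0 \<Longrightarrow> (\<And>x. v x \<noteq> 0 \<Longrightarrow> \<bar>x $ i - a $ i\<bar> \<le> \<rho>) \<Longrightarrow>
      (\<And>\<xi>. 0 \<le> W \<xi>) \<Longrightarrow> deriv_along (axis i 1) W W' \<Longrightarrow> (\<And>\<xi>. \<bar>W' \<xi>\<bar> \<le> \<bar>s\<bar> * \<rho> * W \<xi>) \<Longrightarrow>
      continuous_on UNIV W \<Longrightarrow> continuous_on UNIV W' \<Longrightarrow> poly_bounded W \<Longrightarrow>
      (\<And>\<xi> t. W \<xi> \<le> 2 ^ Ns * (1 + \<bar>t\<bar>) ^ (2 * Ns) * W (\<xi> + (t / \<rho>) *\<^sub>R axis i 1)) \<Longrightarrow>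
      (\<And>l. l < K \<Longrightarrow> deriv_along (axis i 1) (A l) (\<lambda>\<xi>. complex_of_real \<rho> * A (Suc l) \<xi>)) \<Longrightarrow>
      (\<And>l. continuous_on UNIV (A l)) \<Longrightarrow> (\<And>l. poly_bounded (A l)) \<Longrightarrow>
      (\<And>\<xi>. norm (A K \<xi>) \<le> B \<xi>) \<Longrightarrow> continuous_on UNIV B \<Longrightarrow> poly_bounded B \<Longrightarrow>
      (\<And>\<xi> t. B \<xi> \<le> 2 ^ Nq * (1 + \<bar>t\<bar>) ^ (2 * Nq) * B (\<xi> + (t / \<rho>) *\<^sub>R axis i 1)) \<Longrightarrow>
      (LINT \<xi>|lborel. W \<xi> * (norm (A 1 \<xi>))\<^sup>2 * (norm (ft a v \<xi>))\<^sup>2) \<le>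
        C * ((LINT \<xi>|lborel. W \<xi> * (norm (A 0 \<xi>))\<^sup>2 * (norm (ft a v \<xi>))\<^sup>2)
          + (LINT \<xi>|lborel. W \<xi> * (B \<xi>)\<^sup>2 * (norm (ft a v \<xi>))\<^sup>2))"
    using first_derivative_estimate[where RW="2 * Ns" and RB="2 * Nq" and 'n='n, OF K(1) abs_ge_zero[of s] pow2(1) pow2(2)]
    by blast
  define \<kappa> where "\<kappa> = 2 powr \<bar>s\<bar>"
  have \<kappa>: "\<kappa> > 0"
    by (simp add: \<kappa>_def)
  \<comment> \<open>One factor \<kappa> is paid for each passage between the weights
    \<open>?X\<close> and \<open>?Y\<close>, once for the first derivative and once back for
    \<open>Q\<close> itself. \<open>C + 1\<close> avoids division by 0, and the bound by 1 gives
    \<open>l \<ge> 1\<close>.\<close>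
  define \<rho> where "\<rho> = min 1 (sqrt (\<delta> / (\<kappa>\<^sup>2 * (C + 1))))"
  have \<rho>: "\<rho> > 0" "\<rho> \<le> 1"
    using \<delta> \<kappa> C by (auto simp: \<rho>_def)
  have \<rho>2: "\<kappa> * \<rho>\<^sup>2 * C * \<kappa> \<le> \<delta>"
  proof -
    have "\<rho>\<^sup>2 \<le> (sqrt (\<delta> / (\<kappa>\<^sup>2 * (C + 1))))\<^sup>2"
      using \<rho> by (intro power_mono) (auto simp: \<rho>_def)
    also have "\<dots> = \<delta> / (\<kappa>\<^sup>2 * (C + 1))"
      using \<delta> C by simp
    finally have "\<kappa>\<^sup>2 * (C + 1) * \<rho>\<^sup>2 \<le> \<delta>"
      using \<kappa> C by (simp add: pos_le_divide_eq mult.commute)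
    moreover have "\<kappa>\<^sup>2 * (C + 1) * \<rho>\<^sup>2 = \<kappa> * \<rho>\<^sup>2 * C * \<kappa> + (\<kappa> * \<rho>)\<^sup>2"
      by (simp add: power2_eq_square algebra_simps)
    ultimately show ?thesis
      using zero_le_power2[of "\<kappa> * \<rho>"] by linarith
  qed
  define l where "l = 1 / \<rho>"
  have l: "l \<ge> 1" "l > 0"
    using \<rho> by (auto simp: l_def)
  have l2: "1 \<le> l\<^sup>2"
    using l by simp
  let ?X = "\<lambda>\<xi>::real^'n. l\<^sup>2 + (norm \<xi>)\<^sup>2" and ?Y = "\<lambda>\<xi>::real^'n. 1 + (norm \<xi>)\<^sup>2"
  have X1: "1 \<le> ?X \<xi>" and Y1: "1 \<le> ?Y \<xi>" for \<xi>
    using l2 by (auto intro: add_increasing2)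
  have X0: "0 < ?X \<xi>" and Y0: "0 < ?Y \<xi>" for \<xi>
    using X1[of \<xi>] Y1[of \<xi>] by linarith+
  have contY: "continuous_on UNIV (\<lambda>\<xi>. ?Y \<xi> powr e)" for e
    using continuous_on_japanese[of 1 UNIV e] by simp
  have pbY: "poly_bounded (\<lambda>\<xi>. ?Y \<xi> powr e)" for e
    using poly_bounded_japanese[of 1 e] by simp
  define dQ where "dQ l = foldr partial_deriv (replicate l i) Q" for l
  have dQ: "symbol (m - real l) (dQ l)" for l
    using symbol_foldr[OF Q, of "replicate l i"] by (simp add: dQ_def)
  obtain cK where cK: "cK \<ge> 0" "\<And>\<xi>. norm (dQ K \<xi>) \<le> cK * (1 + norm \<xi>) powr (m - real K)"
    using symbol_bound[OF dQ] by blast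
  define A where "A k \<xi> = complex_of_real (l ^ k) * dQ k \<xi>" for k \<xi>
  \<comment> \<open>Depends on \<rho>, without harm: temperance of \<open>B\<close> is invariant
    under constant factors, so \<open>DB\<close> affects only the error constant
    \<open>c3\<close>.\<close>
  define DB where "DB = l ^ K * cK * (2 * l\<^sup>2) powr \<bar>q\<bar>"
  have DB: "0 \<le> DB"
    unfolding DB_def using l cK by simp
  define B where "B \<xi> = DB * ?X \<xi> powr q" for \<xi>
  have AK: "norm (A K \<xi>) \<le> B \<xi>" for \<xi>
  proof -
    let ?Z = "(1 + norm \<xi>)\<^sup>2"
    have pos: "1 + norm \<xi> > 0"
      by (simp add: add_pos_nonneg)
    have "?Z \<le> 2 * l\<^sup>2 * ?X \<xi>"
    proof -
      have "?Z \<le> 2 * ?Y \<xi>"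
        using sum_squares_bound[of 1 "norm \<xi>"] by (simp add: power2_sum)
      also have "\<dots> \<le> 2 * ?X \<xi>"
        using l2 by simp
      also have "\<dots> \<le> l\<^sup>2 * (2 * ?X \<xi>)"
        using mult_right_mono[OF l2, of "2 * ?X \<xi>"] X0[of \<xi>] by simp
      finally show ?thesis
        by (simp only: mult_ac)
    qed
    moreover have "?X \<xi> \<le> 2 * l\<^sup>2 * ?Z"
    proof -
      have "(norm \<xi>)\<^sup>2 \<le> l\<^sup>2 * (norm \<xi>)\<^sup>2"
        using mult_right_mono[OF l2, of "(norm \<xi>)\<^sup>2"] by simp
      then have "?X \<xi> \<le> l\<^sup>2 * ?Z"
        by (simp add: power2_sum distrib_left add_increasing2)
      also have "\<dots> \<le> 2 * l\<^sup>2 * ?Z"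
        by (intro mult_right_mono) auto
      finally show ?thesis .
    qed
    ultimately have Z1: "?Z powr q \<le> (2 * l\<^sup>2) powr \<bar>q\<bar> * ?X \<xi> powr q"
      using pos X0 by (intro powr_le_powr_comparable) auto
    have Z2: "?Z powr q = (1 + norm \<xi>) powr (m - real K)"
    proof -
      have "?Z = (1 + norm \<xi>) powr 2"
        using pos by simp
      then show ?thesis
        by (simp only: powr_powr) (simp add: q_def diff_divide_distrib)
    qed
    have "norm (dQ K \<xi>) \<le> cK * ((2 * l\<^sup>2) powr \<bar>q\<bar> * ?X \<xi> powr q)"
      using cK(2)[of \<xi>] mult_left_mono[OF Z1 cK(1)] unfolding Z2 by (rule order_trans)
    then have "l ^ K * norm (dQ K \<xi>) \<le> l ^ K * (cK * ((2 * l\<^sup>2) powr \<bar>q\<bar> * ?X \<xi> powr q))"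
      using l by (intro mult_left_mono) auto
    then show ?thesis
      using l by (simp add: A_def B_def DB_def norm_mult norm_power mult_ac)
  qed
  have dA: "deriv_along (axis i 1) (A k) (\<lambda>\<xi>. complex_of_real \<rho> * A (Suc k) \<xi>)" for k
  proof -
    have "deriv_along (axis i 1) (A k) (\<lambda>\<xi>. complex_of_real (l ^ k) * partial_deriv i (dQ k) \<xi>)"
      unfolding A_def using dQ[of k] by (intro deriv_along_cmult C_infinity_deriv_along) (simp add: symbol_def)
    moreover have "complex_of_real (l ^ k) * partial_deriv i (dQ k) \<xi> = complex_of_real \<rho> * A (Suc k) \<xi>" for \<xi>
      using \<rho> by (simp add: A_def dQ_def l_def)
    ultimately show ?thesis
      by simp
  qed
  have contA: "continuous_on UNIV (A k)" for k
    unfolding A_def by (intro continuous_intros symbol_continuous[OF dQ])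
  have pbA: "poly_bounded (A k)" for k
    by (rule poly_bounded_bound[OF symbol_poly_bounded[OF dQ[of k]], of _ "l ^ k"])
      (use l in \<open>simp add: A_def norm_mult norm_power\<close>)
  have contB: "continuous_on UNIV B"
    unfolding B_def by (intro continuous_intros continuous_on_japanese l)
  have pbB: "poly_bounded B"
    by (rule poly_bounded_bound[OF poly_bounded_japanese[OF l(1), of q], of _ DB]) (use DB in \<open>simp add: B_def abs_mult\<close>)
  have tempB: "B \<xi> \<le> 2 ^ Nq * (1 + \<bar>t\<bar>) ^ (2 * Nq) * B (\<xi> + (t / \<rho>) *\<^sub>R axis i 1)" for \<xi> t
    unfolding B_def l_def using mult_left_mono[OF temperate_japanese[OF \<rho>(1) Nq, of \<xi> t i] DB] by (simp add: mult_ac)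
  have contdQ: "continuous_on UNIV (dQ k)" for k
    by (rule symbol_continuous[OF dQ])
  have contYQ: "continuous_on UNIV (\<lambda>\<xi>. ?Y \<xi> powr e * (norm (dQ k \<xi>))\<^sup>2)" for e k
    by (intro continuous_intros contdQ contY)
  have contXQ: "continuous_on UNIV (\<lambda>\<xi>. ?X \<xi> powr e * (norm (dQ k \<xi>))\<^sup>2)" for e k
    by (intro continuous_intros contdQ continuous_on_japanese l)
  obtain c1 where c1: "c1 \<ge> 0" "\<And>\<xi>. norm \<xi> \<le> l \<Longrightarrow> ?Y \<xi> powr s * (norm (dQ 1 \<xi>))\<^sup>2 \<le> c1 * ?Y \<xi> powr r"
    using low_frequency_bound[OF contYQ] by blast
  obtain c2 where c2: "c2 \<ge> 0" "\<And>\<xi>. norm \<xi> \<le> l \<Longrightarrow> ?X \<xi> powr s * (norm (dQ 0 \<xi>))\<^sup>2 \<le> c2 * ?Y \<xi> powr r"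
    using low_frequency_bound[OF contXQ] by blast
  \<comment> \<open>Beyond radius \<open>l\<close> the two bases agree up to a factor 2, so their
    powers agree up to \<kappa>, uniformly in \<rho>. Below \<open>l\<close> this uniformity fails,
    and \<open>c1\<close> and \<open>c2\<close> take over.\<close>
  have high: "?Y \<xi> powr s \<le> \<kappa> * ?X \<xi> powr s" "?X \<xi> powr s \<le> \<kappa> * ?Y \<xi> powr s" if "norm \<xi> > l" for \<xi>
  proof -
    have "l\<^sup>2 \<le> (norm \<xi>)\<^sup>2"
      using that l by (intro power_mono) auto
    then have "?Y \<xi> \<le> 2 * ?X \<xi>" "?X \<xi> \<le> 2 * ?Y \<xi>"
      using l2 by (simp_all add: distrib_left)
    then show "?Y \<xi> powr s \<le> \<kappa> * ?X \<xi> powr s" "?X \<xi> powr s \<le> \<kappa> * ?Y \<xi> powr s"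
      unfolding \<kappa>_def using X0 Y0 by (auto intro!: powr_le_powr_comparable)
  qed
  \<comment> \<open>The gain: the squared first derivative is \<open>\<rho>^2\<close> times the
    square of the scaled \<open>A 1\<close>.\<close>
  have p1: "?Y \<xi> powr s * (norm (dQ 1 \<xi>))\<^sup>2 \<le> \<kappa> * \<rho>\<^sup>2 * (?X \<xi> powr s * (norm (A 1 \<xi>))\<^sup>2) + c1 * ?Y \<xi> powr r" for \<xi>
  proof -
    have "\<kappa> * \<rho>\<^sup>2 * (?X \<xi> powr s * (norm (A 1 \<xi>))\<^sup>2) = \<kappa> * ?X \<xi> powr s * (norm (dQ 1 \<xi>))\<^sup>2"
      using \<rho> by (simp add: A_def l_def norm_mult norm_divide power_mult_distrib power_divide)
    moreover have "?Y \<xi> powr s * (norm (dQ 1 \<xi>))\<^sup>2 \<le> \<kappa> * ?X \<xi> powr s * (norm (dQ 1 \<xi>))\<^sup>2 + c1 * ?Y \<xi> powr r"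
    proof (cases "norm \<xi> \<le> l")
      case True
      then show ?thesis
        using c1(2)[OF True] \<kappa> by (intro add_increasing) auto
    next
      case False
      then show ?thesis
        using mult_right_mono[OF high(1), of \<xi> "(norm (dQ 1 \<xi>))\<^sup>2"] c1(1) by (intro add_increasing2) auto
    qed
    ultimately show ?thesis
      by (simp only:)
  qed
  have p2: "?X \<xi> powr s * (norm (A 0 \<xi>))\<^sup>2 \<le> \<kappa> * (?Y \<xi> powr s * (norm (dQ 0 \<xi>))\<^sup>2) + c2 * ?Y \<xi> powr r" for \<xi>
  proof (cases "norm \<xi> \<le> l")
    case True
    then show ?thesis
      using c2(2)[OF True] \<kappa> by (intro add_increasing) (auto simp: A_def)
  next
    case False
    then show ?thesis
      using mult_right_mono[OF high(2), of \<xi> "(norm (dQ 0 \<xi>))\<^sup>2"] c2(1)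
      by (intro add_increasing2) (auto simp: A_def mult.assoc)
  qed
  define c3 where "c3 = DB\<^sup>2 * (l\<^sup>2) powr \<bar>r\<bar>"
  have c3: "c3 \<ge> 0"
    by (simp add: c3_def)
  \<comment> \<open>The choice of \<open>K\<close> enters here: since the base is at least 1, the
    exponent can be raised to \<open>r\<close>.\<close>
  have p3: "?X \<xi> powr s * (B \<xi>)\<^sup>2 \<le> c3 * ?Y \<xi> powr r" for \<xi>
  proof -
    have "(?X \<xi> powr q)\<^sup>2 = ?X \<xi> powr (m - real K)"
      using X0[of \<xi>] by (simp add: power2_eq_square q_def flip: powr_add)
    then have "?X \<xi> powr s * (B \<xi>)\<^sup>2 = DB\<^sup>2 * ?X \<xi> powr (s + (m - real K))"
      by (simp add: B_def power_mult_distrib powr_add)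
    also have "\<dots> \<le> DB\<^sup>2 * ?X \<xi> powr r"
      using K(2) X1[of \<xi>] by (intro mult_left_mono powr_mono) auto
    also have "DB\<^sup>2 * ?X \<xi> powr r \<le> DB\<^sup>2 * ((l\<^sup>2) powr \<bar>r\<bar> * ?Y \<xi> powr r)"
    proof (intro mult_left_mono powr_le_powr_comparable[OF X0 Y0])
      have "(norm \<xi>)\<^sup>2 \<le> l\<^sup>2 * (norm \<xi>)\<^sup>2"
        using mult_right_mono[OF l2, of "(norm \<xi>)\<^sup>2"] by simp
      then show "?X \<xi> \<le> l\<^sup>2 * ?Y \<xi>"
        by (simp add: distrib_left)
      show "?Y \<xi> \<le> l\<^sup>2 * ?X \<xi>"
        using l2 by (intro order_trans[OF _ mult_right_mono[OF l2 less_imp_le[OF X0[of \<xi>]]]]) simp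
    qed simp
    also have "\<dots> = c3 * ?Y \<xi> powr r"
      by (simp only: c3_def mult.assoc)
    finally show ?thesis .
  qed
  have estimate: "energy s (partial_deriv i Q) v \<le> \<delta> * energy s Q v + (\<kappa> * \<rho>\<^sup>2 * C * (c2 + c3) + c1) * energy r (\<lambda>_. 1) v"
    if v: "bump v" and supp: "\<And>x. v x \<noteq> 0 \<Longrightarrow> \<bar>x $ i - a $ i\<bar> \<le> \<rho>" for v a
  proof -
    let ?h = "\<lambda>\<xi>. (norm (ft 0 v \<xi>))\<^sup>2"
    define \<nu> where "\<nu> = (LINT \<xi>|lborel. ?Y \<xi> powr r * ?h \<xi>)"
    define \<epsilon>0 where "\<epsilon>0 = (LINT \<xi>|lborel. ?Y \<xi> powr s * (norm (dQ 0 \<xi>))\<^sup>2 * ?h \<xi>)"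
    define \<epsilon>1 where "\<epsilon>1 = (LINT \<xi>|lborel. ?Y \<xi> powr s * (norm (dQ 1 \<xi>))\<^sup>2 * ?h \<xi>)"
    define \<alpha>0 where "\<alpha>0 = (LINT \<xi>|lborel. ?X \<xi> powr s * (norm (A 0 \<xi>))\<^sup>2 * ?h \<xi>)"
    define \<alpha>1 where "\<alpha>1 = (LINT \<xi>|lborel. ?X \<xi> powr s * (norm (A 1 \<xi>))\<^sup>2 * ?h \<xi>)"
    define \<beta> where "\<beta> = (LINT \<xi>|lborel. ?X \<xi> powr s * (B \<xi>)\<^sup>2 * ?h \<xi>)"
    have pbB2: "poly_bounded (\<lambda>\<xi>. (B \<xi>)\<^sup>2)"
      using poly_bounded_mult[OF pbB pbB] by (simp add: power2_eq_square)
    have i\<nu>: "integrable lborel (\<lambda>\<xi>. ?Y \<xi> powr r * ?h \<xi>)"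
      by (intro energy_integrable contY pbY v)
    have i\<epsilon>: "integrable lborel (\<lambda>\<xi>. ?Y \<xi> powr s * (norm (dQ k \<xi>))\<^sup>2 * ?h \<xi>)" for k
      by (intro energy_integrable contYQ poly_bounded_mult poly_bounded_norm_power2 pbY symbol_poly_bounded[OF dQ] v)
    have i\<alpha>: "integrable lborel (\<lambda>\<xi>. ?X \<xi> powr s * (norm (A k \<xi>))\<^sup>2 * ?h \<xi>)" for k
      by (intro energy_integrable continuous_intros continuous_on_japanese l contA poly_bounded_mult
          poly_bounded_norm_power2 poly_bounded_japanese pbA v)
    have i\<beta>: "integrable lborel (\<lambda>\<xi>. ?X \<xi> powr s * (B \<xi>)\<^sup>2 * ?h \<xi>)"
      by (intro energy_integrable continuous_intros continuous_on_japanese l contB poly_bounded_mult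
          pbB2 poly_bounded_japanese v)
    have nn: "0 \<le> \<nu>" "0 \<le> \<epsilon>0"
      by (simp_all add: \<nu>_def \<epsilon>0_def)
    have e1: "\<epsilon>1 \<le> \<kappa> * \<rho>\<^sup>2 * \<alpha>1 + c1 * \<nu>"
    proof -
      have "\<epsilon>1 \<le> (LINT \<xi>|lborel. \<kappa> * \<rho>\<^sup>2 * (?X \<xi> powr s * (norm (A 1 \<xi>))\<^sup>2 * ?h \<xi>) + c1 * (?Y \<xi> powr r * ?h \<xi>))"
        unfolding \<epsilon>1_def
      proof (intro integral_mono i\<epsilon> Bochner_Integration.integrable_add integrable_mult_right i\<alpha> i\<nu>)
        fix \<xi>
        show "?Y \<xi> powr s * (norm (dQ 1 \<xi>))\<^sup>2 * ?h \<xi> \<le>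
            \<kappa> * \<rho>\<^sup>2 * (?X \<xi> powr s * (norm (A 1 \<xi>))\<^sup>2 * ?h \<xi>) + c1 * (?Y \<xi> powr r * ?h \<xi>)"
          using mult_right_mono[OF p1[of \<xi>], of "?h \<xi>"] by (simp only: zero_le_power2 distrib_right mult.assoc)
      qed
      also have "\<dots> = \<kappa> * \<rho>\<^sup>2 * \<alpha>1 + c1 * \<nu>"
        unfolding \<alpha>1_def \<nu>_def
        by (simp only: Bochner_Integration.integral_add integrable_mult_right i\<alpha> i\<nu> integral_mult_right_zero)
      finally show ?thesis .
    qed
    have e2: "\<alpha>0 \<le> \<kappa> * \<epsilon>0 + c2 * \<nu>"
    proof -
      have "\<alpha>0 \<le> (LINT \<xi>|lborel. \<kappa> * (?Y \<xi> powr s * (norm (dQ 0 \<xi>))\<^sup>2 * ?h \<xi>) + c2 * (?Y \<xi> powr r * ?h \<xi>))"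
        unfolding \<alpha>0_def
      proof (intro integral_mono i\<epsilon> Bochner_Integration.integrable_add integrable_mult_right i\<alpha> i\<nu>)
        fix \<xi>
        show "?X \<xi> powr s * (norm (A 0 \<xi>))\<^sup>2 * ?h \<xi> \<le>
            \<kappa> * (?Y \<xi> powr s * (norm (dQ 0 \<xi>))\<^sup>2 * ?h \<xi>) + c2 * (?Y \<xi> powr r * ?h \<xi>)"
          using mult_right_mono[OF p2[of \<xi>], of "?h \<xi>"] by (simp only: zero_le_power2 distrib_right mult.assoc)
      qed
      also have "\<dots> = \<kappa> * \<epsilon>0 + c2 * \<nu>"
        unfolding \<epsilon>0_def \<nu>_def
        by (simp only: Bochner_Integration.integral_add integrable_mult_right i\<epsilon> i\<nu> integral_mult_right_zero)
      finally show ?thesis .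
    qed
    have e3: "\<beta> \<le> c3 * \<nu>"
    proof -
      have "\<beta> \<le> (LINT \<xi>|lborel. c3 * (?Y \<xi> powr r * ?h \<xi>))"
        unfolding \<beta>_def
      proof (intro integral_mono i\<beta> integrable_mult_right i\<nu>)
        fix \<xi>
        show "?X \<xi> powr s * (B \<xi>)\<^sup>2 * ?h \<xi> \<le> c3 * (?Y \<xi> powr r * ?h \<xi>)"
          using mult_right_mono[OF p3[of \<xi>], of "?h \<xi>"] by (simp only: zero_le_power2 mult.assoc)
      qed
      then show ?thesis
        unfolding \<nu>_def by (simp only: integral_mult_right_zero)
    qed
    \<comment> \<open>The transform is recentred at \<open>a\<close>, which leaves its absolute
      value unchanged, so that the hypothesis on the support can be used.\<close>
    have e4: "\<alpha>1 \<le> C * (\<alpha>0 + \<beta>)"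
      unfolding \<alpha>1_def \<alpha>0_def \<beta>_def norm_ft_shift[of a, symmetric]
    proof (rule main[OF v \<rho>(1) supp])
      show "deriv_along (axis i 1) (\<lambda>\<xi>. ?X \<xi> powr s) (\<lambda>\<xi>. s * ?X \<xi> powr (s - 1) * (2 * \<xi> $ i))"
        by (rule deriv_along_japanese[OF l(2)])
      show "\<bar>s * ?X \<xi> powr (s - 1) * (2 * \<xi> $ i)\<bar> \<le> \<bar>s\<bar> * \<rho> * ?X \<xi> powr s" for \<xi>
        unfolding l_def by (rule deriv_japanese_bound[OF \<rho>(1)])
      show "?X \<xi> powr s \<le> 2 ^ Ns * (1 + \<bar>t\<bar>) ^ (2 * Ns) * ?X (\<xi> + (t / \<rho>) *\<^sub>R axis i 1) powr s" for \<xi> t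
        unfolding l_def by (rule temperate_japanese[OF \<rho>(1) Ns])
      show "continuous_on UNIV (\<lambda>\<xi>. s * ?X \<xi> powr (s - 1) * (2 * \<xi> $ i))"
        by (intro continuous_intros continuous_on_japanese l)
    qed (auto intro: continuous_on_japanese poly_bounded_japanese l dA contA pbA AK contB pbB tempB)
    have "\<epsilon>1 \<le> \<kappa> * \<rho>\<^sup>2 * (C * ((\<kappa> * \<epsilon>0 + c2 * \<nu>) + c3 * \<nu>)) + c1 * \<nu>"
    proof -
      have "C * (\<alpha>0 + \<beta>) \<le> C * ((\<kappa> * \<epsilon>0 + c2 * \<nu>) + c3 * \<nu>)"
        using C e2 e3 by (intro mult_left_mono add_mono)
      then have "\<kappa> * \<rho>\<^sup>2 * \<alpha>1 \<le> \<kappa> * \<rho>\<^sup>2 * (C * ((\<kappa> * \<epsilon>0 + c2 * \<nu>) + c3 * \<nu>))"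
        using e4 \<kappa> by (intro mult_left_mono) auto
      then show ?thesis
        using e1 by linarith
    qed
    also have "\<dots> = (\<kappa> * \<rho>\<^sup>2 * C * \<kappa>) * \<epsilon>0 + (\<kappa> * \<rho>\<^sup>2 * C * (c2 + c3) + c1) * \<nu>"
      by (simp add: algebra_simps)
    also have "\<dots> \<le> \<delta> * \<epsilon>0 + (\<kappa> * \<rho>\<^sup>2 * C * (c2 + c3) + c1) * \<nu>"
      using \<rho>2 nn by (intro add_right_mono mult_right_mono)
    finally show ?thesis
      by (simp add: energy_def \<epsilon>0_def \<epsilon>1_def \<nu>_def dQ_def)
  qed
  show ?thesis
  proof (rule that[of \<rho> "\<kappa> * \<rho>\<^sup>2 * C * (c2 + c3) + c1"])
    show "0 \<le> \<kappa> * \<rho>\<^sup>2 * C * (c2 + c3) + c1"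
      using \<kappa> C c1 c2 c3 by (intro add_nonneg_nonneg mult_nonneg_nonneg) auto
  qed (use \<rho> estimate in auto)
qed

section \<open>From one derivative to multi-indices, and from energies to norms\<close>

lemma energy_nonneg: "0 \<le> energy s Q v"
  by (simp add: energy_def)

text \<open>Serves all derivatives but the outermost one, which supplies the small factor. The
  one-derivative estimate is iterated with \<delta> = 1. The error order \<open>r\<close> is the
  same for every intermediate symbol, so the errors add up while the radius shrinks.\<close>

lemma energy_foldr_partial_deriv_le:
  fixes P :: "real^'n::finite \<Rightarrow> complex"
  assumes P: "symbol m P"
  shows "\<exists>\<rho>>0. \<exists>c\<ge>0. \<forall>v a. bump v \<and> (\<forall>x i. v x \<noteq> 0 \<longrightarrow> \<bar>x $ i - a $ i\<bar> \<le> \<rho>) \<longrightarrow>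
    energy s (foldr partial_deriv is P) v \<le> energy s P v + c * energy r (\<lambda>_. 1) v"
proof (induction "is")
  case Nil
  show ?case
    by (intro exI[of _ 1] conjI exI[of _ 0]) auto
next
  case (Cons i "is")
  obtain \<rho>1 c1 where 1: "\<rho>1 > 0" "c1 \<ge> 0"
    "\<And>v a. bump v \<Longrightarrow> (\<And>x i. v x \<noteq> 0 \<Longrightarrow> \<bar>x $ i - a $ i\<bar> \<le> \<rho>1) \<Longrightarrow>
      energy s (foldr partial_deriv is P) v \<le> energy s P v + c1 * energy r (\<lambda>_. 1) v"
    using Cons.IH by blast
  obtain \<rho>2 c2 where 2: "\<rho>2 > 0" "c2 \<ge> 0"
    "\<And>v a. bump v \<Longrightarrow> (\<And>x. v x \<noteq> 0 \<Longrightarrow> \<bar>x $ i - a $ i\<bar> \<le> \<rho>2) \<Longrightarrow>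
      energy s (partial_deriv i (foldr partial_deriv is P)) v
        \<le> 1 * energy s (foldr partial_deriv is P) v + c2 * energy r (\<lambda>_. 1) v"
    using energy_partial_deriv_le[OF symbol_foldr[OF P, of "is"] zero_less_one] by blast
  have "energy s (foldr partial_deriv (i # is) P) v \<le> energy s P v + (c1 + c2) * energy r (\<lambda>_. 1) v"
    if "bump v" "\<And>x i. v x \<noteq> 0 \<Longrightarrow> \<bar>x $ i - a $ i\<bar> \<le> min \<rho>1 \<rho>2" for v a
  proof -
    have "energy s (foldr partial_deriv is P) v \<le> energy s P v + c1 * energy r (\<lambda>_. 1) v"
      by (rule 1(3)[OF that(1), of a]) (use that(2) in force)
    moreover have "energy s (partial_deriv i (foldr partial_deriv is P)) v
        \<le> 1 * energy s (foldr partial_deriv is P) v + c2 * energy r (\<lambda>_. 1) v"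
      by (rule 2(3)[OF that(1), of a]) (use that(2) in force)
    ultimately show ?thesis
      by (simp add: distrib_right)
  qed
  then show ?case
    using 1(1,2) 2(1,2)
    by - (rule exI[of _ "min \<rho>1 \<rho>2"], rule conjI, simp, rule exI[of _ "c1 + c2"], rule conjI, simp, blast)
qed

lemma
  fixes v :: "real^'n::finite \<Rightarrow> complex"
  assumes v: "bump v"
  shows sobolev_norm_pseudo_diff:
      "symbol m Q \<Longrightarrow> sobolev_norm s (pseudo_diff Q v) = sqrt (energy s Q v) / (2 * pi) ^ CARD('n)"
    and sobolev_norm_bump: "sobolev_norm s v = sqrt (energy s (\<lambda>_. 1) v) / (2 * pi) ^ CARD('n)"
proof -
  let ?k = "(1 / (2 * pi) ^ CARD('n))\<^sup>2 :: real"
  have eq: "sqrt (LINT \<xi>|lborel. (1 + (norm \<xi>)\<^sup>2) powr s * (norm (Q \<xi> * fourier v \<xi>))\<^sup>2) = sqrt (energy s Q v) / (2 * pi) ^ CARD('n)" for Q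
  proof -
    have "(1 + (norm \<xi>)\<^sup>2) powr s * (norm (Q \<xi> * fourier v \<xi>))\<^sup>2
        = ?k * ((1 + (norm \<xi>)\<^sup>2) powr s * (norm (Q \<xi>))\<^sup>2 * (norm (ft 0 v \<xi>))\<^sup>2)" for \<xi>
      by (simp add: fourier_eq_ft norm_mult norm_divide norm_power power_mult_distrib power_divide)
    then have "(LINT \<xi>|lborel. (1 + (norm \<xi>)\<^sup>2) powr s * (norm (Q \<xi> * fourier v \<xi>))\<^sup>2) = ?k * energy s Q v"
      unfolding energy_def by (simp only: integral_mult_right_zero)
    then show ?thesis
      by (simp add: real_sqrt_mult real_sqrt_divide)
  qed
  show "sobolev_norm s (pseudo_diff Q v) = sqrt (energy s Q v) / (2 * pi) ^ CARD('n)" if "symbol m Q"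
    unfolding sobolev_norm_def fourier_pseudo_diff[OF that v] by (rule eq)
  show "sobolev_norm s v = sqrt (energy s (\<lambda>_. 1) v) / (2 * pi) ^ CARD('n)"
    unfolding sobolev_norm_def using eq[of "\<lambda>_. 1"] by simp
qed

lemma sqrt_le_linear:
  assumes "x \<le> \<delta>\<^sup>2 * y + c * z" "0 \<le> \<delta>" "0 \<le> y" "0 \<le> c" "0 \<le> z"
  shows "sqrt x \<le> \<delta> * sqrt y + sqrt c * sqrt z"
proof -
  have "sqrt x \<le> sqrt (\<delta>\<^sup>2 * y + c * z)"
    using assms(1) by simp
  also have "\<dots> \<le> sqrt (\<delta>\<^sup>2 * y) + sqrt (c * z)"
    using assms by (intro sqrt_add_le_add_sqrt) auto
  finally show ?thesis
    using assms(2) by (simp add: real_sqrt_mult)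
qed

theorem theorem1:
  fixes P :: "real^'n::finite \<Rightarrow> complex"
    and m s \<theta> \<delta> :: real
    and \<alpha> :: "'n \<Rightarrow> nat"
  assumes "P \<in> symbol_class m"
    and "\<theta> \<ge> 1"
    and "\<And>i. \<alpha> i \<ge> 1"
    and "\<delta> > 0"
  shows "\<exists>\<rho>>0. \<exists>c>0. \<forall>\<Omega>::(real^'n) set. open \<Omega> \<and> bounded \<Omega> \<and> diameter \<Omega> < \<rho> \<longrightarrow>
    (\<forall>u\<in>test_functions \<Omega>.
      sobolev_norm s (pseudo_diff (multi_deriv \<alpha> P) u)
        \<le> \<delta> * sobolev_norm s (pseudo_diff P u) + c * sobolev_norm (s + m - \<theta>) u)"
proof -
  let ?r = "s + m - \<theta>"
  have P: "symbol m P"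
    using assms(1) by (rule symbol_class_symbol)
  obtain js where js: "\<And>i. count_list js i = \<alpha> i"
    using multi_index_list_exists[of \<alpha>] by blast
  \<comment> \<open>Here \<open>undefined\<close> is just some coordinate; as \<alpha> is positive
    there, at least one derivative can be split off.\<close>
  have "js \<noteq> []"
    using js[of undefined] assms(3)[of undefined] by auto
  then obtain i "is" where i: "js = i # is"
    by (cases js) auto
  have "\<alpha> = count_list (i # is)"
    using js i by auto
  then have \<alpha>: "multi_deriv \<alpha> P = partial_deriv i (foldr partial_deriv is P)"
    using P multi_deriv_eq_foldr[of P "i # is"] by (simp add: symbol_def)
  obtain \<rho>1 c1 where 1: "\<rho>1 > 0" "c1 \<ge> 0"
    "\<And>v a. bump v \<Longrightarrow> (\<And>x i. v x \<noteq> 0 \<Longrightarrow> \<bar>x $ i - a $ i\<bar> \<le> \<rho>1) \<Longrightarrow>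
      energy s (foldr partial_deriv is P) v \<le> energy s P v + c1 * energy ?r (\<lambda>_. 1) v"
    using energy_foldr_partial_deriv_le[OF P, of s "is" ?r] by blast
  \<comment> \<open>Energies are squares of norms, so the outermost derivative is estimated with
    \<open>\<delta>^2\<close>.\<close>
  have "\<delta>\<^sup>2 > 0"
    using assms(4) by simp
  then obtain \<rho>2 c2 where 2: "\<rho>2 > 0" "c2 \<ge> 0"
    "\<And>v a. bump v \<Longrightarrow> (\<And>x. v x \<noteq> 0 \<Longrightarrow> \<bar>x $ i - a $ i\<bar> \<le> \<rho>2) \<Longrightarrow>
      energy s (partial_deriv i (foldr partial_deriv is P)) v
        \<le> \<delta>\<^sup>2 * energy s (foldr partial_deriv is P) v + c2 * energy ?r (\<lambda>_. 1) v"
    using energy_partial_deriv_le[OF symbol_foldr[OF P, of "is"]] by blast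
  define c where "c = \<delta>\<^sup>2 * c1 + c2 + 1"
  have c: "c > 0"
    unfolding c_def using 1 2 by (simp add: add_nonneg_pos)
  have "sobolev_norm s (pseudo_diff (multi_deriv \<alpha> P) u) \<le> \<delta> * sobolev_norm s (pseudo_diff P u) + sqrt c * sobolev_norm ?r u"
    if \<Omega>: "bounded \<Omega>" "diameter \<Omega> < min \<rho>1 \<rho>2" and u: "u \<in> test_functions \<Omega>" for \<Omega> :: "(real^'n) set" and u
  proof -
    have b: "bump u"
      using u by (rule test_functions_bump)
    have mem: "x \<in> \<Omega>" if "u x \<noteq> 0" for x
      using u that closure_subset by (fastforce simp: test_functions_def)
    \<comment> \<open>The centre may be any point where \<open>u\<close> does not vanish, since the
      whole support lies within the diameter of \<Omega> from it. If \<open>u\<close> is zero, any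
      point will do.\<close>
    obtain a where a: "\<And>x k. u x \<noteq> 0 \<Longrightarrow> \<bar>x $ k - a $ k\<bar> \<le> min \<rho>1 \<rho>2"
    proof (cases "\<exists>a. u a \<noteq> 0")
      case True
      then obtain a where ua: "u a \<noteq> 0"
        by blast
      have "\<bar>x $ k - a $ k\<bar> \<le> min \<rho>1 \<rho>2" if "u x \<noteq> 0" for x k
      proof -
        have "\<bar>x $ k - a $ k\<bar> \<le> dist x a"
          using component_le_norm_cart[of "x - a" k] by (simp add: dist_norm)
        also have "\<dots> \<le> diameter \<Omega>"
          by (rule diameter_bounded_bound[OF \<Omega>(1) mem[OF that] mem[OF ua]])
        finally show ?thesis
          using \<Omega>(2) by simp
      qed
      then show ?thesis
        by (rule that)
    qed (use that in blast)
    have e1: "energy s (foldr partial_deriv is P) u \<le> energy s P u + c1 * energy ?r (\<lambda>_. 1) u"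
      by (rule 1(3)[OF b, of a]) (use a in force)
    have "energy s (partial_deriv i (foldr partial_deriv is P)) u
        \<le> \<delta>\<^sup>2 * energy s (foldr partial_deriv is P) u + c2 * energy ?r (\<lambda>_. 1) u"
      by (rule 2(3)[OF b, of a]) (use a in force)
    also have "\<dots> \<le> \<delta>\<^sup>2 * (energy s P u + c1 * energy ?r (\<lambda>_. 1) u) + c2 * energy ?r (\<lambda>_. 1) u"
      using e1 by (intro add_right_mono mult_left_mono) auto
    also have "\<dots> \<le> \<delta>\<^sup>2 * energy s P u + c * energy ?r (\<lambda>_. 1) u"
      unfolding c_def using energy_nonneg[of ?r "\<lambda>_. 1" u] by (simp add: algebra_simps)
    finally have "sqrt (energy s (multi_deriv \<alpha> P) u) \<le> \<delta> * sqrt (energy s P u) + sqrt c * sqrt (energy ?r (\<lambda>_. 1) u)"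
      unfolding \<alpha> using assms(4) c by (intro sqrt_le_linear energy_nonneg) auto
    then have "sqrt (energy s (multi_deriv \<alpha> P) u) / (2 * pi) ^ CARD('n)
        \<le> (\<delta> * sqrt (energy s P u) + sqrt c * sqrt (energy ?r (\<lambda>_. 1) u)) / (2 * pi) ^ CARD('n)"
      by (intro divide_right_mono) auto
    moreover have "symbol (m - real (length is) - 1) (multi_deriv \<alpha> P)"
      unfolding \<alpha> by (intro symbol_partial symbol_foldr P)
    ultimately show ?thesis
      by (simp add: sobolev_norm_pseudo_diff[OF b] sobolev_norm_pseudo_diff[OF b P] sobolev_norm_bump[OF b] add_divide_distrib)
  qed
  then show ?thesis
    using 1(1) 2(1) c
    by - (rule exI[of _ "min \<rho>1 \<rho>2"], rule conjI, simp, rule exI[of _ "sqrt c"], rule conjI, simp, blast)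
qed

end
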